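(* Let $\Bbbk$ be a commutative ring, let $Q$ be a finite quiver, let $N\ge2$ be an integer, let $A=\Bbbk Q/(Q_N)$ be the truncated algebra, and let $E\subseteq A$ be the subalgebra spanned by the vertices. Let $l\in\{1,\dots,N-1\}$ and let $\delta:\Bbbk Q_1\to\Bbbk Q_l$ be an $E^e$-linear map. Write also $\delta$ for the $E^e$-linear derivations $\Bbbk Q\to\Bbbk Q$ and $A\to A$ that extend it. Then there is a $\delta^e$-lifting $\delta_\bullet:\mathrm{Br}_\bullet\to\mathrm{Br}_\bullet$ of $\delta:A\to A$ to the resolution $\mathrm{Br}_\bullet$ of $A$ such that for each $i\ge0$ and each path $w=\alpha_1\cdots\alpha_{\zeta(i)}\in Q_{\zeta(i)}$ we have $$\delta_i(1\otimes w\otimes1)=\begin{cases}\Delta_{l-1}^{\zeta(i)}(\delta(w)),&\text{if $i$ is even;}\\[4pt]\Delta_{l-1}^{\zeta(i)}(\delta(w))+\displaystyle\sum_{j=0}^{l-2}\Delta_j^{\zeta(i)}\bigl(\alpha_1\cdots\alpha_{\zeta(i)-1}\delta(\alpha_{\zeta(i)})\bigr),&\text{if $i$ is odd.}\end{cases}$$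
   Context: $Q_m$ denotes the set of paths of length $m$ in $Q$, so $Q_0$ is the set of vertices and $Q_1$ the set of arrows, and $|w|$ is the length of a path $w$. For a set $Z$ of paths, $\Bbbk Z$ is the free $\Bbbk$-module on $Z$, an $E$-bimodule in the natural way. $E^e$-linear means a morphism of $E$-bimodules, so an $E^e$-linear map sends each path to a combination of parallel paths. $(Q_N)$ is the two-sided ideal of the path algebra $\Bbbk Q$ generated by $Q_N$. For $m\le N-1$, $\Bbbk Q_m$ is viewed inside $A$. Paths are written so that $\alpha\beta$ is traversed starting with $\alpha$. Let $\zeta:\mathbb N_0\to\mathbb N_0$ be given by $\zeta(2k)=Nk$ and $\zeta(2k+1)=Nk+1$. The Bardzell resolution $\mathrm{Br}_\bullet\to A$ of $A$ as an $A$-bimodule has $\mathrm{Br}_i=A\otimes_E\Bbbk Q_{\zeta(i)}\otimes_EA$, augmentation $\mathrm{Br}_0=A\otimes_EA\to A$ given by multiplication, and differentials such that for $w\in Q_{\zeta(i)}$ $$d(1\otimes w\otimes1)=\sum_{aub=w,\ u\in Q_{N(k-1)+1}}a\otimes u\otimes b\quad\text{if } i=2k\ge2,$$ and $d(1\otimes w\otimes1)=a\otimes r\otimes1-1\otimes l'\otimes b$ if $i=2k+1$, where $a,b\in Q_1$ and $r,l'\in Q_{Nk}$ are such that $w=ar=l'b$. For $n,m\ge0$, $\Delta_n^m:\Bbbk Q\to A\otimes_E\Bbbk Q_m\otimes_EA$ is the $E^e$-linear map with $\Delta_n^m(w)=0$ for each path $w$ with $|w|<n+m$, and $\Delta_n^m(w)=a\otimes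 u\otimes b$ otherwise, where $w=aub$ is the unique factorization with $|a|=n$ and $|u|=m$ (here $a$ and $b$ stand for their classes in $A$). $A^e=A\otimes A^{\mathrm{op}}$ and $\delta^e=\delta\otimes1+1\otimes\delta$. A $\delta^e$-lifting of $\delta:A\to A$ to $\mathrm{Br}_\bullet$ is a sequence of $\Bbbk$-linear maps $\delta_i:\mathrm{Br}_i\to\mathrm{Br}_i$ commuting with the differentials, with $\epsilon\delta_0=\delta\epsilon$ for the augmentation $\epsilon$, and with $\delta_i(apb)=\delta(a)pb+a\delta_i(p)b+ap\delta(b)$ for all $a,b\in A$ and $p\in\mathrm{Br}_i$. *)

theory Defs
  imports "HOL-Algebra.Module" "HOL-Algebra.QuotRing" "Graph_Theory.Arc_Walk"
begin

section \<open>Linear algebra over a commutative ring\<close>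

definition linear_map ::
  "('k, 'r) ring_scheme \<Rightarrow> ('k, 'a, 'm) module_scheme \<Rightarrow> ('k, 'b, 'n) module_scheme
    \<Rightarrow> ('a \<Rightarrow> 'b) \<Rightarrow> bool" where
  "linear_map R M M' f \<longleftrightarrow>
     (\<forall>x\<in>carrier M. f x \<in> carrier M') \<and>
     (\<forall>x\<in>carrier M. \<forall>y\<in>carrier M. f (x \<oplus>\<^bsub>M\<^esub> y) = f x \<oplus>\<^bsub>M'\<^esub> f y) \<and>
     (\<forall>c\<in>carrier R. \<forall>x\<in>carrier M. f (c \<odot>\<^bsub>M\<^esub> x) = c \<odot>\<^bsub>M'\<^esub> f x)"

text \<open>The free module on a set \<open>Z\<close> consists of the finitely supported functions on \<open>Z\<close>, extended
  by zero. A module is a ring record with scalar multiplication, so that the fields for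
  multiplication and unit carry no meaning here.\<close>

definition free_module :: "('k, 'r) ring_scheme \<Rightarrow> 'b set \<Rightarrow> ('k, 'b \<Rightarrow> 'k) module" where
  "free_module R Z =
     \<lparr>carrier = {f. (\<forall>z. f z \<in> carrier R) \<and> finite {z. f z \<noteq> \<zero>\<^bsub>R\<^esub>} \<and> {z. f z \<noteq> \<zero>\<^bsub>R\<^esub>} \<subseteq> Z},
      mult = undefined, one = undefined,
      zero = (\<lambda>_. \<zero>\<^bsub>R\<^esub>), add = (\<lambda>f g z. f z \<oplus>\<^bsub>R\<^esub> g z),
      smult = (\<lambda>c f z. c \<otimes>\<^bsub>R\<^esub> f z)\<rparr>"

definition basis_vec :: "('k, 'r) ring_scheme \<Rightarrow> 'b \<Rightarrow> 'b \<Rightarrow> 'k" where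
  "basis_vec R z = (\<lambda>z'. if z' = z then \<one>\<^bsub>R\<^esub> else \<zero>\<^bsub>R\<^esub>)"

definition linear_ext ::
  "('k, 'r) ring_scheme \<Rightarrow> ('k, 'm, 's) module_scheme \<Rightarrow> ('b \<Rightarrow> 'm) \<Rightarrow> ('b \<Rightarrow> 'k) \<Rightarrow> 'm" where
  "linear_ext R M g f = (\<Oplus>\<^bsub>M\<^esub> z \<in> {z. f z \<noteq> \<zero>\<^bsub>R\<^esub>}. f z \<odot>\<^bsub>M\<^esub> g z)"

definition span_module ::
  "('k, 'r) ring_scheme \<Rightarrow> ('k, 'm, 's) module_scheme \<Rightarrow> 'm set \<Rightarrow> 'm set" where
  "span_module R M S = \<Inter>{H. submodule H R M \<and> S \<subseteq> H}"

text \<open>Quotient by a submodule, or, when \<open>M\<close> carries a multiplication, by a two-sided ideal.\<close>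

definition quotient_module :: "('k, 'm, 's) module_scheme \<Rightarrow> 'm set \<Rightarrow> ('k, 'm set) module" where
  "quotient_module M H =
     ring.extend (M Quot H) (module.fields (\<lambda>c X. \<Union>x\<in>X. H +>\<^bsub>M\<^esub> (c \<odot>\<^bsub>M\<^esub> x)))"


section \<open>Quivers, paths and the path algebra\<close>

text \<open>A quiver is a directed multigraph, possibly with loops. A path is a triple of its source, its
  list of arrows in the order of traversal, and its target; the end points are recorded because of
  the trivial paths.\<close>

type_synonym ('v, 'e) path = "'v \<times> 'e list \<times> 'v"

definition paths :: "('v, 'e) pre_digraph \<Rightarrow> ('v, 'e) path set" where
  "paths Q = {(u, p, v). pre_digraph.awalk Q u p v}"

definition path_length :: "('v, 'e) path \<Rightarrow> nat" where
  "path_length w = length (fst (snd w))"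

definition paths_of_length :: "('v, 'e) pre_digraph \<Rightarrow> nat \<Rightarrow> ('v, 'e) path set" where
  "paths_of_length Q m = {w \<in> paths Q. path_length w = m}"

text \<open>The part of a path between its \<open>i\<close>-th and \<open>j\<close>-th vertices, counted from 0, for
  \<open>i \<le> j \<le> path_length w\<close>.\<close>

definition subpath :: "('v, 'e) pre_digraph \<Rightarrow> ('v, 'e) path \<Rightarrow> nat \<Rightarrow> nat \<Rightarrow> ('v, 'e) path" where
  "subpath Q w i j = (case w of (u, p, v) \<Rightarrow>
     (pre_digraph.awalk_verts Q u p ! i, take (j - i) (drop i p), pre_digraph.awalk_verts Q u p ! j))"

definition kQ_len ::
  "('k, 'r) ring_scheme \<Rightarrow> ('v, 'e) pre_digraph \<Rightarrow> nat \<Rightarrow> ('k, ('v, 'e) path \<Rightarrow> 'k) module" where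
  "kQ_len R Q m = free_module R (paths_of_length Q m)"

definition path_prod ::
  "('k, 'r) ring_scheme \<Rightarrow> ('v, 'e) path \<Rightarrow> ('v, 'e) path \<Rightarrow> ('v, 'e) path \<Rightarrow> 'k" where
  "path_prod R a b = (case a of (u, p, v) \<Rightarrow> case b of (u', q, v') \<Rightarrow>
     if v = u' then basis_vec R (u, p @ q, v') else (\<lambda>_. \<zero>\<^bsub>R\<^esub>))"

definition path_algebra ::
  "('k, 'r) ring_scheme \<Rightarrow> ('v, 'e) pre_digraph \<Rightarrow> ('k, ('v, 'e) path \<Rightarrow> 'k) module" where
  "path_algebra R Q = (let M = free_module R (paths Q) in
     M\<lparr>mult := (\<lambda>f g. linear_ext R M (\<lambda>a. linear_ext R M (\<lambda>b. path_prod R a b) g) f),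
       one := (\<lambda>w. if w \<in> paths_of_length Q 0 then \<one>\<^bsub>R\<^esub> else \<zero>\<^bsub>R\<^esub>)\<rparr>)"


section \<open>The truncated algebra\<close>

definition trunc_ideal ::
  "('k, 'r) ring_scheme \<Rightarrow> ('v, 'e) pre_digraph \<Rightarrow> nat \<Rightarrow> (('v, 'e) path \<Rightarrow> 'k) set" where
  "trunc_ideal R Q N = Idl\<^bsub>path_algebra R Q\<^esub> (basis_vec R ` paths_of_length Q N)"

definition trunc_algebra ::
  "('k, 'r) ring_scheme \<Rightarrow> ('v, 'e) pre_digraph \<Rightarrow> nat \<Rightarrow> ('k, (('v, 'e) path \<Rightarrow> 'k) set) module" where
  "trunc_algebra R Q N = quotient_module (path_algebra R Q) (trunc_ideal R Q N)"

definition trunc_class ::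
  "('k, 'r) ring_scheme \<Rightarrow> ('v, 'e) pre_digraph \<Rightarrow> nat \<Rightarrow> (('v, 'e) path \<Rightarrow> 'k)
    \<Rightarrow> (('v, 'e) path \<Rightarrow> 'k) set" where
  "trunc_class R Q N x = trunc_ideal R Q N +>\<^bsub>path_algebra R Q\<^esub> x"

text \<open>The subalgebra spanned by the vertices, inside the truncated algebra. It is the isomorphic
  image of the span \<open>kQ_len R Q 0\<close> of the vertices inside the path algebra, and it acts on path
  modules through this isomorphism.\<close>

definition vertex_subalgebra ::
  "('k, 'r) ring_scheme \<Rightarrow> ('v, 'e) pre_digraph \<Rightarrow> nat \<Rightarrow> (('v, 'e) path \<Rightarrow> 'k) set set" where
  "vertex_subalgebra R Q N = trunc_class R Q N ` carrier (kQ_len R Q 0)"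

text \<open>Morphisms of \<open>E\<close>-bimodules between \<open>E\<close>-subbimodules \<open>M\<close>, \<open>M'\<close> of an algebra \<open>B\<close>, and
  \<open>E\<close>-bilinear derivations of \<open>B\<close>, where \<open>E\<close> is a subalgebra of \<open>B\<close>.\<close>

definition bimodule_linear ::
  "('k, 'r) ring_scheme \<Rightarrow> ('k, 'b, 's) module_scheme \<Rightarrow> 'b set
    \<Rightarrow> ('k, 'b, 'm) module_scheme \<Rightarrow> ('k, 'b, 'n) module_scheme \<Rightarrow> ('b \<Rightarrow> 'b) \<Rightarrow> bool" where
  "bimodule_linear R B E M M' f \<longleftrightarrow>
     linear_map R M M' f \<and>
     (\<forall>e\<in>E. \<forall>x\<in>carrier M. f (e \<otimes>\<^bsub>B\<^esub> x) = e \<otimes>\<^bsub>B\<^esub> f x \<and> f (x \<otimes>\<^bsub>B\<^esub> e) = f x \<otimes>\<^bsub>B\<^esub> e)"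

definition bilinear_derivation ::
  "('k, 'r) ring_scheme \<Rightarrow> ('k, 'b, 's) module_scheme \<Rightarrow> 'b set \<Rightarrow> ('b \<Rightarrow> 'b) \<Rightarrow> bool" where
  "bilinear_derivation R B E f \<longleftrightarrow>
     bimodule_linear R B E B B f \<and>
     (\<forall>x\<in>carrier B. \<forall>y\<in>carrier B. f (x \<otimes>\<^bsub>B\<^esub> y) = f x \<otimes>\<^bsub>B\<^esub> y \<oplus>\<^bsub>B\<^esub> x \<otimes>\<^bsub>B\<^esub> f y)"


section \<open>The bimodules \<open>A \<otimes>\<^sub>E kQ\<^sub>m \<otimes>\<^sub>E A\<close>\<close>

type_synonym ('v, 'e, 'k) trunc = "(('v, 'e) path \<Rightarrow> 'k) set"
type_synonym ('v, 'e, 'k) triple =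
  "('v, 'e, 'k) trunc \<times> (('v, 'e) path \<Rightarrow> 'k) \<times> ('v, 'e, 'k) trunc"
type_synonym ('v, 'e, 'k) tensor = "(('v, 'e, 'k) triple \<Rightarrow> 'k) set"

definition triple_module ::
  "('k, 'r) ring_scheme \<Rightarrow> ('v, 'e) pre_digraph \<Rightarrow> nat \<Rightarrow> nat
    \<Rightarrow> ('k, ('v, 'e, 'k) triple \<Rightarrow> 'k) module" where
  "triple_module R Q N m = free_module R
     (carrier (trunc_algebra R Q N) \<times> carrier (kQ_len R Q m) \<times> carrier (trunc_algebra R Q N))"

text \<open>The relations of the tensor product: linearity over the ground ring in each of the three
  factors, and balancedness over \<open>E\<close> at each of the two tensor signs.\<close>

definition tensor_relations ::
  "('k, 'r) ring_scheme \<Rightarrow> ('v, 'e) pre_digraph \<Rightarrow> nat \<Rightarrow> nat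
    \<Rightarrow> (('v, 'e, 'k) triple \<Rightarrow> 'k) set" where
  "tensor_relations R Q N m = (let
       F = triple_module R Q N m; P = path_algebra R Q; A = trunc_algebra R Q N;
       V = kQ_len R Q m; E = carrier (kQ_len R Q 0); cl = trunc_class R Q N;
       t = (\<lambda>a u b. basis_vec R (a, u, b))
     in
       {t (a \<oplus>\<^bsub>A\<^esub> a') u b \<ominus>\<^bsub>F\<^esub> (t a u b \<oplus>\<^bsub>F\<^esub> t a' u b) | a a' u b.
          a \<in> carrier A \<and> a' \<in> carrier A \<and> u \<in> carrier V \<and> b \<in> carrier A} \<union>
       {t a (u \<oplus>\<^bsub>V\<^esub> u') b \<ominus>\<^bsub>F\<^esub> (t a u b \<oplus>\<^bsub>F\<^esub> t a u' b) | a u u' b.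
          a \<in> carrier A \<and> u \<in> carrier V \<and> u' \<in> carrier V \<and> b \<in> carrier A} \<union>
       {t a u (b \<oplus>\<^bsub>A\<^esub> b') \<ominus>\<^bsub>F\<^esub> (t a u b \<oplus>\<^bsub>F\<^esub> t a u b') | a u b b'.
          a \<in> carrier A \<and> u \<in> carrier V \<and> b \<in> carrier A \<and> b' \<in> carrier A} \<union>
       {t (c \<odot>\<^bsub>A\<^esub> a) u b \<ominus>\<^bsub>F\<^esub> c \<odot>\<^bsub>F\<^esub> t a u b | c a u b.
          c \<in> carrier R \<and> a \<in> carrier A \<and> u \<in> carrier V \<and> b \<in> carrier A} \<union>
       {t a (c \<odot>\<^bsub>V\<^esub> u) b \<ominus>\<^bsub>F\<^esub> c \<odot>\<^bsub>F\<^esub> t a u b | c a u b.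
          c \<in> carrier R \<and> a \<in> carrier A \<and> u \<in> carrier V \<and> b \<in> carrier A} \<union>
       {t a u (c \<odot>\<^bsub>A\<^esub> b) \<ominus>\<^bsub>F\<^esub> c \<odot>\<^bsub>F\<^esub> t a u b | c a u b.
          c \<in> carrier R \<and> a \<in> carrier A \<and> u \<in> carrier V \<and> b \<in> carrier A} \<union>
       {t (a \<otimes>\<^bsub>A\<^esub> cl e) u b \<ominus>\<^bsub>F\<^esub> t a (e \<otimes>\<^bsub>P\<^esub> u) b | a e u b.
          a \<in> carrier A \<and> e \<in> E \<and> u \<in> carrier V \<and> b \<in> carrier A} \<union>
       {t a (u \<otimes>\<^bsub>P\<^esub> e) b \<ominus>\<^bsub>F\<^esub> t a u (cl e \<otimes>\<^bsub>A\<^esub> b) | a e u b.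
          a \<in> carrier A \<and> e \<in> E \<and> u \<in> carrier V \<and> b \<in> carrier A})"

definition tensor_module ::
  "('k, 'r) ring_scheme \<Rightarrow> ('v, 'e) pre_digraph \<Rightarrow> nat \<Rightarrow> nat \<Rightarrow> ('k, ('v, 'e, 'k) tensor) module" where
  "tensor_module R Q N m =
     quotient_module (triple_module R Q N m)
       (span_module R (triple_module R Q N m) (tensor_relations R Q N m))"

definition pure_tensor ::
  "('k, 'r) ring_scheme \<Rightarrow> ('v, 'e) pre_digraph \<Rightarrow> nat \<Rightarrow> nat
    \<Rightarrow> ('v, 'e, 'k) trunc \<Rightarrow> (('v, 'e) path \<Rightarrow> 'k) \<Rightarrow> ('v, 'e, 'k) trunc \<Rightarrow> ('v, 'e, 'k) tensor" where
  "pure_tensor R Q N m a u b =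
     span_module R (triple_module R Q N m) (tensor_relations R Q N m)
       +>\<^bsub>triple_module R Q N m\<^esub> basis_vec R (a, u, b)"

text \<open>The linear map out of the tensor product induced by a trilinear and \<open>E\<close>-balanced map \<open>g\<close>, the
  value on a class being computed on any of its representatives.\<close>

definition tensor_lift ::
  "('k, 'r) ring_scheme \<Rightarrow> ('k, 'm, 's) module_scheme \<Rightarrow> (('v, 'e, 'k) triple \<Rightarrow> 'm)
    \<Rightarrow> ('v, 'e, 'k) tensor \<Rightarrow> 'm" where
  "tensor_lift R T g X = (THE y. \<exists>f\<in>X. y = linear_ext R T g f)"

definition bimod_act ::
  "('k, 'r) ring_scheme \<Rightarrow> ('v, 'e) pre_digraph \<Rightarrow> nat \<Rightarrow> nat
    \<Rightarrow> ('v, 'e, 'k) trunc \<Rightarrow> ('v, 'e, 'k) tensor \<Rightarrow> ('v, 'e, 'k) trunc \<Rightarrow> ('v, 'e, 'k) tensor" where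
  "bimod_act R Q N m a X b = (let A = trunc_algebra R Q N in
     tensor_lift R (tensor_module R Q N m)
       (\<lambda>(x, u, y). pure_tensor R Q N m (a \<otimes>\<^bsub>A\<^esub> x) u (y \<otimes>\<^bsub>A\<^esub> b)) X)"

text \<open>\<open>a \<otimes> u \<otimes> b\<close> for the factorization \<open>w = aub\<close> with \<open>a\<close> of length \<open>n\<close> and \<open>u\<close> of length \<open>m\<close>.\<close>

definition split_tensor ::
  "('k, 'r) ring_scheme \<Rightarrow> ('v, 'e) pre_digraph \<Rightarrow> nat \<Rightarrow> nat \<Rightarrow> nat
    \<Rightarrow> ('v, 'e) path \<Rightarrow> ('v, 'e, 'k) tensor" where
  "split_tensor R Q N n m w = pure_tensor R Q N m
     (trunc_class R Q N (basis_vec R (subpath Q w 0 n)))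
     (basis_vec R (subpath Q w n (n + m)))
     (trunc_class R Q N (basis_vec R (subpath Q w (n + m) (path_length w))))"

definition Delta ::
  "('k, 'r) ring_scheme \<Rightarrow> ('v, 'e) pre_digraph \<Rightarrow> nat \<Rightarrow> nat \<Rightarrow> nat
    \<Rightarrow> (('v, 'e) path \<Rightarrow> 'k) \<Rightarrow> ('v, 'e, 'k) tensor" where
  "Delta R Q N n m = linear_ext R (tensor_module R Q N m)
     (\<lambda>w. if path_length w < n + m then \<zero>\<^bsub>tensor_module R Q N m\<^esub> else split_tensor R Q N n m w)"


section \<open>The Bardzell resolution\<close>

definition zeta :: "nat \<Rightarrow> nat \<Rightarrow> nat" where
  "zeta N i = (if even i then N * (i div 2) else N * (i div 2) + 1)"

definition Br ::
  "('k, 'r) ring_scheme \<Rightarrow> ('v, 'e) pre_digraph \<Rightarrow> nat \<Rightarrow> nat \<Rightarrow> ('k, ('v, 'e, 'k) tensor) module" where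
  "Br R Q N i = tensor_module R Q N (zeta N i)"

text \<open>The tensor product of \<open>A\<close> with itself over \<open>E\<close> is \<open>A \<otimes>\<^sub>E kQ\<^sub>0 \<otimes>\<^sub>E A\<close>, since \<open>kQ\<^sub>0\<close> is \<open>E\<close>.\<close>

definition Br_aug ::
  "('k, 'r) ring_scheme \<Rightarrow> ('v, 'e) pre_digraph \<Rightarrow> nat \<Rightarrow> ('v, 'e, 'k) tensor \<Rightarrow> ('v, 'e, 'k) trunc" where
  "Br_aug R Q N = (let A = trunc_algebra R Q N in
     tensor_lift R A (\<lambda>(x, u, y). x \<otimes>\<^bsub>A\<^esub> trunc_class R Q N u \<otimes>\<^bsub>A\<^esub> y))"

text \<open>The value of the differential of degree \<open>i \<ge> 1\<close> on \<open>1 \<otimes> w \<otimes> 1\<close>. For \<open>i = 2 * k\<close> the middle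
  length \<open>N * (k - 1) + 1\<close> is \<open>zeta N (i - 1)\<close>, and a factorization of \<open>w\<close> is given by the
  length \<open>j\<close> of its first factor.\<close>

definition Br_diff_gen ::
  "('k, 'r) ring_scheme \<Rightarrow> ('v, 'e) pre_digraph \<Rightarrow> nat \<Rightarrow> nat
    \<Rightarrow> ('v, 'e) path \<Rightarrow> ('v, 'e, 'k) tensor" where
  "Br_diff_gen R Q N i w =
     (let m = zeta N (i - 1); n = path_length w; A = trunc_algebra R Q N;
          cl = (\<lambda>v. trunc_class R Q N (basis_vec R v)) in
     if even i
     then (\<Oplus>\<^bsub>Br R Q N (i - 1)\<^esub> j \<in> {j. j + m \<le> n}. split_tensor R Q N j m w)
     else pure_tensor R Q N m (cl (subpath Q w 0 1)) (basis_vec R (subpath Q w 1 n)) \<one>\<^bsub>A\<^esub>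
       \<ominus>\<^bsub>Br R Q N (i - 1)\<^esub>
       pure_tensor R Q N m \<one>\<^bsub>A\<^esub> (basis_vec R (subpath Q w 0 (n - 1))) (cl (subpath Q w (n - 1) n)))"

definition Br_diff ::
  "('k, 'r) ring_scheme \<Rightarrow> ('v, 'e) pre_digraph \<Rightarrow> nat \<Rightarrow> nat
    \<Rightarrow> ('v, 'e, 'k) tensor \<Rightarrow> ('v, 'e, 'k) tensor" where
  "Br_diff R Q N i = (let M = Br R Q N (i - 1) in
     tensor_lift R M
       (\<lambda>(x, u, y). bimod_act R Q N (zeta N (i - 1)) x (linear_ext R M (Br_diff_gen R Q N i) u) y))"

definition e_lifting ::
  "('k, 'r) ring_scheme \<Rightarrow> ('v, 'e) pre_digraph \<Rightarrow> nat
    \<Rightarrow> (('v, 'e, 'k) trunc \<Rightarrow> ('v, 'e, 'k) trunc)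
    \<Rightarrow> (nat \<Rightarrow> ('v, 'e, 'k) tensor \<Rightarrow> ('v, 'e, 'k) tensor) \<Rightarrow> bool" where
  "e_lifting R Q N d D \<longleftrightarrow>
     (\<forall>i. linear_map R (Br R Q N i) (Br R Q N i) (D i)) \<and>
     (\<forall>i\<ge>1. \<forall>p\<in>carrier (Br R Q N i).
        Br_diff R Q N i (D i p) = D (i - 1) (Br_diff R Q N i p)) \<and>
     (\<forall>p\<in>carrier (Br R Q N 0). Br_aug R Q N (D 0 p) = d (Br_aug R Q N p)) \<and>
     (\<forall>i. \<forall>a\<in>carrier (trunc_algebra R Q N). \<forall>b\<in>carrier (trunc_algebra R Q N).
        \<forall>p\<in>carrier (Br R Q N i).
          (let act = bimod_act R Q N (zeta N i) in
             D i (act a p b) =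
               act (d a) p b \<oplus>\<^bsub>Br R Q N i\<^esub> act a (D i p) b \<oplus>\<^bsub>Br R Q N i\<^esub> act a p (d b)))"

end

(*  A = kQ/(Q_N) inherits from the path algebra an E-bilinear derivation, and a bimodule map out of
    A \<otimes> kQ_m \<otimes> A is the same as an E-bilinear map on kQ_m.  Hence the prescribed values on the
    elements 1 \<otimes> w \<otimes> 1 extend uniquely to maps satisfying the Leibniz rule, and since the defect of
    commuting with the differentials is a bimodule map, only its values at 1 \<otimes> w \<otimes> 1 matter.

    These values are computed through Delta by means of cl f \<otimes> u \<otimes> cl g = Delta_n^m(f u g) for
    f in kQ_n and u in kQ_m.  For even i put x_q = \<alpha>_1 ... \<alpha>_q \<delta>(\<alpha>_{q+1} ... ) and
    F(j) = sum_{s < l-1} Delta_{j+s}(x_{j+m'-1}) with m' = zeta(i-1): the j-th summand of the defect is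
    F(j) - F(j+1), and F(0) = F(N) = 0 because the outer factors have length at least N.  For odd i
    both sides collapse to the same four terms. *)

theory Submission
  imports Defs
begin

section \<open>Linear maps and free modules\<close>

text \<open>The shape of the formula is forced by the right outer factor of a tensor a \<otimes> u
  \<otimes> b. Differentiating \<open>a\<close> moves \<open>u\<close> by l - 1 places, and the
  value prescribed for the generator is cut l - 1 places further as well; differentiating
  \<open>b\<close> leaves \<open>u\<close> where it was. So each tensor shows a discrepancy between
  \<open>Delta\<close> at j and at j + l - 1 of one and the same element, namely the part of
  \<delta>(w) that comes from \<open>b\<close>. In odd degree the differential raises the index of
  \<open>Delta\<close> by one and subtracts the unraised term. A sum of l - 1 consecutive
  \<open>Delta\<close>s therefore has a jump by l - 1 as its boundary, which is the origin of the
  correction sum and of its range.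

  E-bilinearity makes them vanish on vertices. With the Leibniz rule this determines them on all
  paths and gives both the degree l - 1 and the compatibility with the projection to
  \<open>A\<close>.

  Since \<open>Delta\<close> is zero by convention on paths too short to be cut, every rule that
  moves its index has to carry a bound on lengths.\<close>

lemma linear_mapI:
  assumes "\<And>x. x \<in> carrier M \<Longrightarrow> f x \<in> carrier M'"
    and "\<And>x y. \<lbrakk>x \<in> carrier M; y \<in> carrier M\<rbrakk> \<Longrightarrow> f (x \<oplus>\<^bsub>M\<^esub> y) = f x \<oplus>\<^bsub>M'\<^esub> f y"
    and "\<And>c x. \<lbrakk>c \<in> carrier R; x \<in> carrier M\<rbrakk> \<Longrightarrow> f (c \<odot>\<^bsub>M\<^esub> x) = c \<odot>\<^bsub>M'\<^esub> f x"
  shows "linear_map R M M' f"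
  using assms by (simp add: linear_map_def)

lemma
  assumes "linear_map R M M' f"
  shows linear_map_closed: "x \<in> carrier M \<Longrightarrow> f x \<in> carrier M'"
    and linear_map_add: "\<lbrakk>x \<in> carrier M; y \<in> carrier M\<rbrakk> \<Longrightarrow> f (x \<oplus>\<^bsub>M\<^esub> y) = f x \<oplus>\<^bsub>M'\<^esub> f y"
    and linear_map_smult:
      "\<lbrakk>c \<in> carrier R; x \<in> carrier M\<rbrakk> \<Longrightarrow> f (c \<odot>\<^bsub>M\<^esub> x) = c \<odot>\<^bsub>M'\<^esub> f x"
  using assms by (simp_all add: linear_map_def)

lemma linear_map_comp:
  assumes "linear_map R M M' f" and "linear_map R M' M'' g"
  shows "linear_map R M M'' (\<lambda>x. g (f x))"
  using assms by (simp add: linear_map_def)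

lemma linear_map_plus:
  assumes "Module.module R M'" and f: "linear_map R M M' f" and g: "linear_map R M M' g"
  shows "linear_map R M M' (\<lambda>x. f x \<oplus>\<^bsub>M'\<^esub> g x)"
proof -
  interpret M': Module.module R M' by fact
  show ?thesis
    by (rule linear_mapI)
      (simp_all add: linear_map_closed[OF f] linear_map_closed[OF g] linear_map_add[OF f]
        linear_map_add[OF g] linear_map_smult[OF f] linear_map_smult[OF g] M'.M.add.m_ac
        M'.smult_r_distr)
qed

lemma linear_map_zero:
  assumes "Module.module R M" and "Module.module R M'" and f: "linear_map R M M' f"
  shows "f \<zero>\<^bsub>M\<^esub> = \<zero>\<^bsub>M'\<^esub>"
proof -
  interpret M: Module.module R M by fact
  interpret M': Module.module R M' by fact
  have "f (\<zero>\<^bsub>R\<^esub> \<odot>\<^bsub>M\<^esub> \<zero>\<^bsub>M\<^esub>) = \<zero>\<^bsub>R\<^esub> \<odot>\<^bsub>M'\<^esub> f \<zero>\<^bsub>M\<^esub>"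
    by (rule linear_map_smult[OF f]) simp_all
  then show ?thesis by (simp add: linear_map_closed[OF f])
qed

lemma linear_map_uminus:
  assumes "Module.module R M" and "Module.module R M'" and f: "linear_map R M M' f" and x: "x \<in> carrier M"
  shows "f (\<ominus>\<^bsub>M\<^esub> x) = \<ominus>\<^bsub>M'\<^esub> f x"
proof -
  interpret M: Module.module R M by fact
  interpret M': Module.module R M' by fact
  have "f (\<ominus>\<^bsub>M\<^esub> x) \<oplus>\<^bsub>M'\<^esub> f x = f (\<ominus>\<^bsub>M\<^esub> x \<oplus>\<^bsub>M\<^esub> x)"
    using x by (simp add: linear_map_add[OF f])
  also have "\<dots> = \<zero>\<^bsub>M'\<^esub>"
    using x by (simp add: M.M.l_neg linear_map_zero[OF assms(1-3)])
  finally have "\<ominus>\<^bsub>M'\<^esub> f x = f (\<ominus>\<^bsub>M\<^esub> x)"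
    using x by (intro M'.M.minus_equality linear_map_closed[OF f]) auto
  then show ?thesis ..
qed

lemma linear_map_minus:
  assumes "Module.module R M" and "Module.module R M'" and f: "linear_map R M M' f"
    and "x \<in> carrier M" and "y \<in> carrier M"
  shows "f (x \<ominus>\<^bsub>M\<^esub> y) = f x \<ominus>\<^bsub>M'\<^esub> f y"
proof -
  interpret M: Module.module R M by fact
  show ?thesis
    using assms by (simp add: a_minus_def linear_map_add[OF f] linear_map_uminus[OF assms(1-3)])
qed

lemma linear_map_finsum:
  assumes "Module.module R M" and "Module.module R M'" and f: "linear_map R M M' f" and "g \<in> S \<rightarrow> carrier M"
  shows "f (\<Oplus>\<^bsub>M\<^esub> i \<in> S. g i) = (\<Oplus>\<^bsub>M'\<^esub> i \<in> S. f (g i))"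
proof -
  interpret M: Module.module R M by fact
  interpret M': Module.module R M' by fact
  show ?thesis
    using assms(4)
    by (induction S rule: infinite_finite_induct)
      (auto simp: linear_map_zero[OF assms(1-3)] linear_map_add[OF f] Pi_def
        linear_map_closed[OF f] M.M.finsum_closed)
qed

section \<open>Finite sums: shifting, telescoping, differences\<close>

lemma (in abelian_monoid) finsum_eq_zero:
  assumes "\<And>i. i \<in> S \<Longrightarrow> f i = \<zero>"
  shows "(\<Oplus>i \<in> S. f i) = \<zero>"
  using assms by (rule add.finprod_one_eqI)

text \<open>Both sides are the sum of \<open>f\<close> over \<open>{..n}\<close>, once with the
  first and once with the last term split off. It serves to compare a sum of \<open>Delta\<close>s
  with the same sum moved by one place.\<close>

lemma (in abelian_group) finsum_shift:
  assumes "\<And>s. f s \<in> carrier G"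
  shows "f 0 \<oplus> (\<Oplus>s\<in>{..<n}. f (Suc s)) = (\<Oplus>s\<in>{..<n::nat}. f s) \<oplus> f n"
proof (induction n)
  case (Suc n)
  have "f 0 \<oplus> (\<Oplus>s\<in>{..<Suc n}. f (Suc s)) = f (Suc n) \<oplus> (f 0 \<oplus> (\<Oplus>s\<in>{..<n}. f (Suc s)))"
    using assms by (simp add: lessThan_Suc a_ac)
  also have "\<dots> = f (Suc n) \<oplus> ((\<Oplus>s\<in>{..<n}. f s) \<oplus> f n)" by (simp only: Suc)
  also have "\<dots> = (\<Oplus>s\<in>{..<Suc n}. f s) \<oplus> f (Suc n)"
    using assms by (simp add: lessThan_Suc a_ac)
  finally show ?case .
qed (use assms in simp)

lemma (in abelian_group) finsum_telescope:
  assumes "\<And>s. f s \<in> carrier G"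
  shows "(\<Oplus>j\<in>{..<n::nat}. f j \<ominus> f (Suc j)) = f 0 \<ominus> f n"
proof (induction n)
  case (Suc n)
  have "(\<Oplus>j\<in>{..<Suc n}. f j \<ominus> f (Suc j)) = (f n \<ominus> f (Suc n)) \<oplus> (f 0 \<ominus> f n)"
    using assms by (simp add: lessThan_Suc Suc)
  also have "\<dots> = f 0 \<ominus> f (Suc n)"
    using assms by (simp add: minus_eq a_ac r_neg1 r_neg2)
  finally show ?case .
qed (use assms in \<open>simp add: minus_eq r_neg\<close>)

lemma (in abelian_group) finsum_minus:
  assumes "\<And>s. s \<in> S \<Longrightarrow> f s \<in> carrier G" and "\<And>s. s \<in> S \<Longrightarrow> g s \<in> carrier G"
  shows "(\<Oplus>s\<in>S. f s \<ominus> g s) = (\<Oplus>s\<in>S. f s) \<ominus> (\<Oplus>s\<in>S. g s)"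
  using assms
proof (induction S rule: infinite_finite_induct)
  case (insert s S)
  then have "(\<Oplus>s\<in>insert s S. f s \<ominus> g s) = (f s \<ominus> g s) \<oplus> ((\<Oplus>s\<in>S. f s) \<ominus> (\<Oplus>s\<in>S. g s))"
    by (simp add: Pi_def)
  then show ?case
    using insert by (simp add: Pi_def minus_eq minus_add a_ac)
qed (simp_all add: minus_eq r_neg)

lemma linear_map_cong:
  assumes "Module.module R M" and "linear_map R M M' f" and "\<And>x. x \<in> carrier M \<Longrightarrow> g x = f x"
  shows "linear_map R M M' g"
proof -
  interpret Module.module R M by fact
  show ?thesis using assms(2,3) by (simp add: linear_map_def)
qed

lemma finsum_linear_map:
  assumes "Module.module R M" and "Module.module R M'" and "\<And>i. i \<in> S \<Longrightarrow> linear_map R M M' (f i)"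
  shows "linear_map R M M' (\<lambda>x. \<Oplus>\<^bsub>M'\<^esub> i \<in> S. f i x)"
proof -
  interpret M': Module.module R M' by fact
  have zero: "linear_map R M M' (\<lambda>x. \<zero>\<^bsub>M'\<^esub>)" by (rule linear_mapI) auto
  show ?thesis
    using assms(3)
  proof (induction S rule: infinite_finite_induct)
    case (insert i S)
    have "linear_map R M M' (\<lambda>x. f i x \<oplus>\<^bsub>M'\<^esub> (\<Oplus>\<^bsub>M'\<^esub> i \<in> S. f i x))"
      using insert by (intro linear_map_plus assms(2)) auto
    then show ?case
      by (rule linear_map_cong[OF assms(1)])
        (use insert in \<open>auto intro!: M'.M.finsum_insert dest: linear_map_closed\<close>)
  qed (simp_all add: zero)
qed

section \<open>Free modules and linear maps given on a basis\<close>

lemma free_module_simps: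
  "f \<in> carrier (free_module R Z) \<longleftrightarrow>
     (\<forall>z. f z \<in> carrier R) \<and> finite {z. f z \<noteq> \<zero>\<^bsub>R\<^esub>} \<and> {z. f z \<noteq> \<zero>\<^bsub>R\<^esub>} \<subseteq> Z"
  "\<zero>\<^bsub>free_module R Z\<^esub> = (\<lambda>_. \<zero>\<^bsub>R\<^esub>)"
  "f \<oplus>\<^bsub>free_module R Z\<^esub> g = (\<lambda>z. f z \<oplus>\<^bsub>R\<^esub> g z)"
  "c \<odot>\<^bsub>free_module R Z\<^esub> f = (\<lambda>z. c \<otimes>\<^bsub>R\<^esub> f z)"
  by (simp_all add: free_module_def)

context cring begin

lemma free_module_add_closed:
  assumes "f \<in> carrier (free_module R Z)" and "g \<in> carrier (free_module R Z)"
  shows "f \<oplus>\<^bsub>free_module R Z\<^esub> g \<in> carrier (free_module R Z)"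
proof -
  have "{z. f z \<oplus> g z \<noteq> \<zero>} \<subseteq> {z. f z \<noteq> \<zero>} \<union> {z. g z \<noteq> \<zero>}" by auto
  then show ?thesis
    using assms by (auto simp: free_module_simps intro: finite_subset)
qed

lemma free_module_smult_closed:
  assumes "c \<in> carrier R" and "f \<in> carrier (free_module R Z)"
  shows "c \<odot>\<^bsub>free_module R Z\<^esub> f \<in> carrier (free_module R Z)"
proof -
  have "{z. c \<otimes> f z \<noteq> \<zero>} \<subseteq> {z. f z \<noteq> \<zero>}" using assms(1) by auto
  then show ?thesis
    using assms by (auto simp: free_module_simps intro: finite_subset)
qed

lemma free_module_module: "Module.module R (free_module R Z)"
proof (rule moduleI)
  show "cring R" by (rule is_cring)
  show "abelian_group (free_module R Z)"
  proof (rule abelian_groupI)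
    fix f assume f: "f \<in> carrier (free_module R Z)"
    have "(\<ominus> \<one>) \<odot>\<^bsub>free_module R Z\<^esub> f \<in> carrier (free_module R Z)"
      using f by (intro free_module_smult_closed) auto
    moreover have "(\<ominus> \<one>) \<odot>\<^bsub>free_module R Z\<^esub> f \<oplus>\<^bsub>free_module R Z\<^esub> f = \<zero>\<^bsub>free_module R Z\<^esub>"
      using f by (simp add: free_module_simps fun_eq_iff l_minus l_neg)
    ultimately show "\<exists>y\<in>carrier (free_module R Z). y \<oplus>\<^bsub>free_module R Z\<^esub> f = \<zero>\<^bsub>free_module R Z\<^esub>"
      by blast
  qed (auto simp: free_module_add_closed, auto simp: free_module_simps fun_eq_iff a_ac)
qed (auto simp: free_module_smult_closed, auto simp: free_module_simps fun_eq_iff l_distr r_distr m_assoc)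

lemma basis_vec_closed: "z \<in> Z \<Longrightarrow> basis_vec R z \<in> carrier (free_module R Z)"
  by (auto simp: free_module_simps basis_vec_def if_distrib cong: if_cong)

lemma free_module_mono: "Y \<subseteq> Z \<Longrightarrow> carrier (free_module R Y) \<subseteq> carrier (free_module R Z)"
  by (fastforce simp: free_module_simps)

text \<open>The support is removed one point at a time, so that a statement compatible with linear
  combinations need only be checked on basis vectors.\<close>

lemma free_module_induct [consumes 1, case_names zero add]:
  assumes "f \<in> carrier (free_module R Z)"
    and "P (\<lambda>_. \<zero>)"
    and step: "\<And>c z f. \<lbrakk>c \<in> carrier R; z \<in> Z; f \<in> carrier (free_module R Z); P f\<rbrakk>
      \<Longrightarrow> P ((c \<odot>\<^bsub>free_module R Z\<^esub> basis_vec R z) \<oplus>\<^bsub>free_module R Z\<^esub> f)"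
  shows "P f"
proof -
  have "finite {z. f z \<noteq> \<zero>}" using assms(1) by (simp add: free_module_simps)
  then show ?thesis
    using assms(1)
  proof (induction "{z. f z \<noteq> \<zero>}" arbitrary: f rule: finite_induct)
    case empty
    then have "f = (\<lambda>_. \<zero>)" by auto
    then show ?case using assms(2) by simp
  next
    case (insert z S)
    define g where "g = f(z := \<zero>)"
    have S: "S = {x. g x \<noteq> \<zero>}" using insert.hyps(2,4) by (auto simp: g_def)
    have fz: "f z \<in> carrier R" and z: "z \<in> Z"
      using insert.prems insert.hyps(4) by (auto simp: free_module_simps)
    have "finite {x. g x \<noteq> \<zero>}" using insert.hyps(1) S by simp
    then have g: "g \<in> carrier (free_module R Z)"
      using insert.prems by (auto simp: free_module_simps g_def split: if_splits)
    have "f = (f z \<odot>\<^bsub>free_module R Z\<^esub> basis_vec R z) \<oplus>\<^bsub>free_module R Z\<^esub> g"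
      using insert.prems by (auto simp: free_module_simps basis_vec_def g_def fun_eq_iff)
    then show ?case
      using step[OF fz z g insert.hyps(3)[OF S g]] by simp
  qed
qed

lemma free_linear_eqI:
  assumes M: "Module.module R M" and f: "linear_map R (free_module R Z) M f"
    and g: "linear_map R (free_module R Z) M g"
    and eq: "\<And>z. z \<in> Z \<Longrightarrow> f (basis_vec R z) = g (basis_vec R z)"
    and "x \<in> carrier (free_module R Z)"
  shows "f x = g x"
  using assms(5)
proof (induction rule: free_module_induct)
  case zero
  show ?case
    using linear_map_zero[OF free_module_module M f] linear_map_zero[OF free_module_module M g]
    by (simp add: free_module_simps)
next
  case (add c z x)
  then show ?case
    by (simp add: linear_map_add[OF f] linear_map_add[OF g] linear_map_smult[OF f]
        linear_map_smult[OF g] free_module_smult_closed basis_vec_closed eq)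
qed

end

context Module.module begin

text \<open>\<open>linear_ext\<close> sums over the support of \<open>f\<close>, which changes with
  \<open>f\<close>. Summing over a common finite superset makes the values at different
  \<open>f\<close> comparable.\<close>

lemma linear_ext_superset:
  assumes "finite S" and "{z. f z \<noteq> \<zero>} \<subseteq> S" and "\<And>z. f z \<in> carrier R"
    and "\<And>z. z \<in> S \<Longrightarrow> g z \<in> carrier M"
  shows "linear_ext R M g f = (\<Oplus>\<^bsub>M\<^esub> z \<in> S. f z \<odot>\<^bsub>M\<^esub> g z)"
  unfolding linear_ext_def
  using assms by (intro M.add.finprod_mono_neutral_cong_left) auto

lemma linear_ext_linear:
  assumes g: "\<And>z. z \<in> Z \<Longrightarrow> g z \<in> carrier M"
  shows "linear_map R (free_module R Z) M (linear_ext R M g)"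
proof (rule linear_mapI)
  fix f assume f: "f \<in> carrier (free_module R Z)"
  show "linear_ext R M g f \<in> carrier M"
    unfolding linear_ext_def using f g
    by (intro M.finsum_closed) (auto simp: free_module_simps)
  fix c assume c: "c \<in> carrier R"
  have fin: "finite {z. f z \<noteq> \<zero>}" and sub: "{z. f z \<noteq> \<zero>} \<subseteq> Z" and fc: "\<And>z. f z \<in> carrier R"
    using f by (auto simp: free_module_simps)
  have "linear_ext R M g (c \<odot>\<^bsub>free_module R Z\<^esub> f)
      = (\<Oplus>\<^bsub>M\<^esub> z \<in> {z. f z \<noteq> \<zero>}. (c \<odot>\<^bsub>free_module R Z\<^esub> f) z \<odot>\<^bsub>M\<^esub> g z)"
    using c fc fin sub g by (intro linear_ext_superset) (auto simp: free_module_simps)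
  also have "\<dots> = (\<Oplus>\<^bsub>M\<^esub> z \<in> {z. f z \<noteq> \<zero>}. c \<odot>\<^bsub>M\<^esub> (f z \<odot>\<^bsub>M\<^esub> g z))"
    using c fc sub g by (intro M.finsum_cong') (auto simp: free_module_simps smult_assoc1)
  also have "\<dots> = c \<odot>\<^bsub>M\<^esub> linear_ext R M g f"
    unfolding linear_ext_def using c fin fc sub g
    by (intro finsum_smult_ldistr[symmetric]) auto
  finally show "linear_ext R M g (c \<odot>\<^bsub>free_module R Z\<^esub> f) = c \<odot>\<^bsub>M\<^esub> linear_ext R M g f" .
next
  fix f f' assume f: "f \<in> carrier (free_module R Z)" and f': "f' \<in> carrier (free_module R Z)"
  define S where "S = {z. f z \<noteq> \<zero>} \<union> {z. f' z \<noteq> \<zero>}"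
  have S: "finite S" "S \<subseteq> Z" "{z. f z \<noteq> \<zero>} \<subseteq> S" "{z. f' z \<noteq> \<zero>} \<subseteq> S"
    and fc: "\<And>z. f z \<in> carrier R" and fc': "\<And>z. f' z \<in> carrier R"
    using f f' by (auto simp: free_module_simps S_def)
  have "linear_ext R M g (f \<oplus>\<^bsub>free_module R Z\<^esub> f')
      = (\<Oplus>\<^bsub>M\<^esub> z \<in> S. (f z \<oplus> f' z) \<odot>\<^bsub>M\<^esub> g z)"
    using S fc fc' g by (subst linear_ext_superset[of S]) (auto simp: free_module_simps S_def)
  also have "\<dots> = (\<Oplus>\<^bsub>M\<^esub> z \<in> S. f z \<odot>\<^bsub>M\<^esub> g z \<oplus>\<^bsub>M\<^esub> f' z \<odot>\<^bsub>M\<^esub> g z)"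
    using S fc fc' g by (intro M.finsum_cong') (auto simp: smult_l_distr)
  also have "\<dots> = (\<Oplus>\<^bsub>M\<^esub> z \<in> S. f z \<odot>\<^bsub>M\<^esub> g z) \<oplus>\<^bsub>M\<^esub> (\<Oplus>\<^bsub>M\<^esub> z \<in> S. f' z \<odot>\<^bsub>M\<^esub> g z)"
    using S fc fc' g by (intro M.finsum_addf) auto
  also have "\<dots> = linear_ext R M g f \<oplus>\<^bsub>M\<^esub> linear_ext R M g f'"
    using S fc fc' g by (subst (1 2) linear_ext_superset[of S]) auto
  finally show "linear_ext R M g (f \<oplus>\<^bsub>free_module R Z\<^esub> f') = linear_ext R M g f \<oplus>\<^bsub>M\<^esub> linear_ext R M g f'" .
qed

lemma linear_ext_basis_vec:
  assumes "g z \<in> carrier M"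
  shows "linear_ext R M g (basis_vec R z) = g z"
proof -
  have "linear_ext R M g (basis_vec R z) = (\<Oplus>\<^bsub>M\<^esub> z' \<in> {z}. basis_vec R z z' \<odot>\<^bsub>M\<^esub> g z')"
    using assms by (intro linear_ext_superset) (auto simp: basis_vec_def)
  then show ?thesis using assms by (simp add: basis_vec_def)
qed

text \<open>This is linearity in the family \<open>h x\<close> and not in the coefficients
  \<open>f\<close>. The product of the path algebra is a nested \<open>linear_ext\<close>, and its
  second factor enters through the family.\<close>

lemma linear_ext_param:
  assumes f: "f \<in> carrier (free_module R Z)" and M': "Module.module R M'"
    and h: "\<And>z. z \<in> Z \<Longrightarrow> linear_map R M' M (\<lambda>x. h x z)"
  shows "linear_map R M' M (\<lambda>x. linear_ext R M (h x) f)"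
proof -
  interpret M': Module.module R M' by fact
  have hc: "\<And>x z. \<lbrakk>x \<in> carrier M'; z \<in> Z\<rbrakk> \<Longrightarrow> h x z \<in> carrier M"
    using linear_map_closed[OF h] by blast
  show ?thesis
    using f
  proof (induction rule: free_module_induct)
    case zero
    show ?case by (rule linear_mapI) (auto simp: linear_ext_def)
  next
    case (add c z f)
    note lin = linear_ext_linear[where g = "h _"]
    have eq: "linear_ext R M (h x) (c \<odot>\<^bsub>free_module R Z\<^esub> basis_vec R z \<oplus>\<^bsub>free_module R Z\<^esub> f)
        = c \<odot>\<^bsub>M\<^esub> h x z \<oplus>\<^bsub>M\<^esub> linear_ext R M (h x) f" if x: "x \<in> carrier M'" for x
      using add x hc[OF x]
      by (simp add: linear_map_add[OF lin[of Z x]] linear_map_smult[OF lin[of Z x]]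
          free_module_smult_closed basis_vec_closed linear_ext_basis_vec)
    have "linear_map R M' M (\<lambda>x. c \<odot>\<^bsub>M\<^esub> h x z \<oplus>\<^bsub>M\<^esub> linear_ext R M (h x) f)"
    proof (rule linear_map_plus[OF module_axioms])
      show "linear_map R M' M (\<lambda>x. c \<odot>\<^bsub>M\<^esub> h x z)"
      proof (rule linear_mapI)
        \<comment> \<open>Scaling by \<open>c\<close> is itself linear because the ground ring is
          commutative.\<close>
        fix d x assume "d \<in> carrier R" "x \<in> carrier M'"
        then show "c \<odot>\<^bsub>M\<^esub> h (d \<odot>\<^bsub>M'\<^esub> x) z = d \<odot>\<^bsub>M\<^esub> (c \<odot>\<^bsub>M\<^esub> h x z)"
          using add hc by (simp add: linear_map_smult[OF h] smult_assoc1[symmetric] R.m_comm)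
      qed (use add hc in \<open>simp_all add: linear_map_add[OF h] smult_r_distr\<close>)
    qed (rule add.IH)
    then show ?case
      by (rule linear_map_cong[OF M' _ eq])
  qed
qed

end

section \<open>Quotients\<close>

lemma quotient_module_simps:
  "carrier (quotient_module M H) = {H +>\<^bsub>M\<^esub> x | x. x \<in> carrier M}"
  "\<zero>\<^bsub>quotient_module M H\<^esub> = H"
  "\<one>\<^bsub>quotient_module M H\<^esub> = H +>\<^bsub>M\<^esub> \<one>\<^bsub>M\<^esub>"
  "X \<oplus>\<^bsub>quotient_module M H\<^esub> Y = X <+>\<^bsub>M\<^esub> Y"
  "X \<otimes>\<^bsub>quotient_module M H\<^esub> Y = rcoset_mult M H X Y"
  "c \<odot>\<^bsub>quotient_module M H\<^esub> X = (\<Union>x\<in>X. H +>\<^bsub>M\<^esub> (c \<odot>\<^bsub>M\<^esub> x))"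
  by (auto simp: quotient_module_def ring.defs module.defs FactRing_simps)

context Module.module begin

context
  fixes H
  assumes H: "submodule H R M"
begin

interpretation H: abelian_subgroup H M
  by (intro abelian_subgroupI3 additive_subgroup.intro submodule.axioms[OF H] M.abelian_group_axioms)

lemma quotient_add:
  assumes "x \<in> carrier M" and "y \<in> carrier M"
  shows "(H +>\<^bsub>M\<^esub> x) \<oplus>\<^bsub>quotient_module M H\<^esub> (H +>\<^bsub>M\<^esub> y) = H +>\<^bsub>M\<^esub> (x \<oplus>\<^bsub>M\<^esub> y)"
  using assms by (simp add: quotient_module_simps H.a_rcos_sum)

text \<open>The scalar action is defined as a union over all representatives of a coset. As
  \<open>H\<close> is stable under scalars, every representative yields the same coset, so the union
  collapses.\<close>

lemma quotient_smult:
  assumes c: "c \<in> carrier R" and x: "x \<in> carrier M"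
  shows "c \<odot>\<^bsub>quotient_module M H\<^esub> (H +>\<^bsub>M\<^esub> x) = H +>\<^bsub>M\<^esub> (c \<odot>\<^bsub>M\<^esub> x)"
proof -
  have "H +>\<^bsub>M\<^esub> (c \<odot>\<^bsub>M\<^esub> y) = H +>\<^bsub>M\<^esub> (c \<odot>\<^bsub>M\<^esub> x)" if y: "y \<in> H +>\<^bsub>M\<^esub> x" for y
  proof -
    obtain h where h: "h \<in> H" "y = h \<oplus>\<^bsub>M\<^esub> x"
      using y by (auto simp: a_r_coset_def')
    then have "c \<odot>\<^bsub>M\<^esub> y = c \<odot>\<^bsub>M\<^esub> h \<oplus>\<^bsub>M\<^esub> c \<odot>\<^bsub>M\<^esub> x"
      using c x by (simp add: smult_r_distr)
    moreover have "c \<odot>\<^bsub>M\<^esub> h \<in> H"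
      using c h by (intro submodule.smult_closed[OF H])
    ultimately have "c \<odot>\<^bsub>M\<^esub> y \<in> H +>\<^bsub>M\<^esub> (c \<odot>\<^bsub>M\<^esub> x)"
      by (auto simp: a_r_coset_def')
    then show ?thesis
      using c x by (intro H.a_repr_independence'[symmetric]) auto
  qed
  then have "(\<Union>y\<in>H +>\<^bsub>M\<^esub> x. H +>\<^bsub>M\<^esub> (c \<odot>\<^bsub>M\<^esub> y)) = (\<Union>y\<in>H +>\<^bsub>M\<^esub> x. H +>\<^bsub>M\<^esub> (c \<odot>\<^bsub>M\<^esub> x))"
    by (rule SUP_cong[OF refl])
  also have "\<dots> = H +>\<^bsub>M\<^esub> (c \<odot>\<^bsub>M\<^esub> x)"
    using H.a_rcos_self[OF x] by blast
  finally show ?thesis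
    unfolding quotient_module_simps .
qed

lemma quotient_closed: "x \<in> carrier M \<Longrightarrow> H +>\<^bsub>M\<^esub> x \<in> carrier (quotient_module M H)"
  by (auto simp: quotient_module_simps)

lemma quotient_cases:
  assumes "X \<in> carrier (quotient_module M H)"
  obtains x where "x \<in> carrier M" and "X = H +>\<^bsub>M\<^esub> x"
  using assms by (auto simp: quotient_module_simps)

lemma quotient_zero: "\<zero>\<^bsub>quotient_module M H\<^esub> = H +>\<^bsub>M\<^esub> \<zero>\<^bsub>M\<^esub>"
  by (simp add: quotient_module_simps H.a_rcos_const)

lemma quotient_eq_zeroI: "x \<in> H \<Longrightarrow> H +>\<^bsub>M\<^esub> x = \<zero>\<^bsub>quotient_module M H\<^esub>"
  by (simp add: quotient_module_simps H.a_rcos_const)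

lemma quotient_eqI:
  assumes x: "x \<in> carrier M" and y: "y \<in> carrier M" and "x \<ominus>\<^bsub>M\<^esub> y \<in> H"
  shows "H +>\<^bsub>M\<^esub> x = H +>\<^bsub>M\<^esub> y"
proof -
  have "x = (x \<ominus>\<^bsub>M\<^esub> y) \<oplus>\<^bsub>M\<^esub> y"
    using x y by (simp add: M.minus_eq M.a_assoc M.l_neg)
  then have "x \<in> H +>\<^bsub>M\<^esub> y"
    using assms(3) by (auto simp: a_r_coset_def')
  then show ?thesis
    using y by (intro H.a_repr_independence'[symmetric])
qed

lemma quotient_module_module: "Module.module R (quotient_module M H)"
proof (rule moduleI)
  show "cring R" by (rule is_cring)
  show "abelian_group (quotient_module M H)"
  proof (rule abelian_groupI)
    fix X assume "X \<in> carrier (quotient_module M H)"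
    then obtain x where x: "x \<in> carrier M" "X = H +>\<^bsub>M\<^esub> x" by (rule quotient_cases)
    show "\<exists>Y\<in>carrier (quotient_module M H). Y \<oplus>\<^bsub>quotient_module M H\<^esub> X = \<zero>\<^bsub>quotient_module M H\<^esub>"
      using x by (intro bexI[of _ "H +>\<^bsub>M\<^esub> (\<ominus>\<^bsub>M\<^esub> x)"])
        (auto simp: quotient_add quotient_zero M.l_neg intro: quotient_closed simp del: M.a_coset_add_zero)
  qed (auto elim!: quotient_cases simp: quotient_add quotient_zero M.a_ac
      intro!: quotient_closed simp del: M.a_coset_add_zero)
qed (auto elim!: quotient_cases simp: quotient_add quotient_smult smult_l_distr smult_r_distr
    smult_assoc1 intro!: quotient_closed)

lemma quotient_linear: "linear_map R M (quotient_module M H) (\<lambda>x. H +>\<^bsub>M\<^esub> x)"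
  by (rule linear_mapI) (simp_all add: quotient_closed quotient_add quotient_smult)

end

lemma span_submodule:
  assumes "S \<subseteq> carrier M"
  shows "submodule (span_module R M S) R M"
proof -
  \<comment> \<open>The intersection runs over a nonempty family, hence stays inside the
    carrier.\<close>
  have "carrier M \<in> {H. submodule H R M \<and> S \<subseteq> H}"
    using assms carrier_is_submodule by auto
  then show ?thesis
    unfolding span_module_def
    by (intro submoduleI)
      (auto dest: submoduleE additive_subgroup.zero_closed intro: submoduleE(2-6)
        simp: additive_subgroup.zero_closed[OF additive_subgroup.intro[OF submodule.axioms(1)]])
qed

lemma span_superset: "S \<subseteq> span_module R M S"
  by (auto simp: span_module_def)

lemma span_least: "\<lbrakk>submodule H R M; S \<subseteq> H\<rbrakk> \<Longrightarrow> span_module R M S \<subseteq> H"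
  by (auto simp: span_module_def)

text \<open>Combined with \<open>span_least\<close>: a linear map that kills the generators kills
  their span.\<close>

lemma kernel_submodule:
  assumes "Module.module R M'" and f: "linear_map R M M' f"
  shows "submodule {x \<in> carrier M. f x = \<zero>\<^bsub>M'\<^esub>} R M"
proof -
  interpret M': Module.module R M' by fact
  show ?thesis
    by (rule submoduleI)
      (auto simp: linear_map_add[OF f] linear_map_smult[OF f] linear_map_zero[OF module_axioms assms]
        linear_map_uminus[OF module_axioms assms])
qed

end

context
  fixes R :: "('k, 'r) ring_scheme" and M :: "('k, 'm, 's) module_scheme"
    and Z :: "('v, 'e, 'k) triple set"
    and S :: "(('v, 'e, 'k) triple \<Rightarrow> 'k) set" and g :: "('v, 'e, 'k) triple \<Rightarrow> 'm"
  assumes M: "Module.module R M"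
    and S: "S \<subseteq> carrier (free_module R Z)"
    and g: "\<And>z. z \<in> Z \<Longrightarrow> g z \<in> carrier M"
    and kill: "\<And>s. s \<in> S \<Longrightarrow> linear_ext R M g s = \<zero>\<^bsub>M\<^esub>"
begin

interpretation M: Module.module R M by (rule M)
interpretation F: Module.module R "free_module R Z" by (rule M.free_module_module)

text \<open>Despite its name, \<^const>\<open>tensor_lift\<close> is the map induced on any quotient of a free module.\<close>

lemma tensor_lift_coset:
  assumes f: "f \<in> carrier (free_module R Z)"
  shows "tensor_lift R M g (span_module R (free_module R Z) S +>\<^bsub>free_module R Z\<^esub> f)
    = linear_ext R M g f"
proof -
  let ?F = "free_module R Z" and ?H = "span_module R (free_module R Z) S"
  note lin = M.linear_ext_linear[where g = g, OF g]
  have H: "submodule ?H R ?F" using S by (rule F.span_submodule)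
  have ker: "?H \<subseteq> {x \<in> carrier ?F. linear_ext R M g x = \<zero>\<^bsub>M\<^esub>}"
    using S kill by (intro F.span_least F.kernel_submodule[OF M lin]) auto
  have eq: "linear_ext R M g f' = linear_ext R M g f" if f': "f' \<in> ?H +>\<^bsub>?F\<^esub> f" for f'
  proof -
    obtain h where h: "h \<in> ?H" "f' = h \<oplus>\<^bsub>?F\<^esub> f"
      using f' by (auto simp: a_r_coset_def')
    then have "h \<in> carrier ?F" "linear_ext R M g h = \<zero>\<^bsub>M\<^esub>" using ker by auto
    then show ?thesis
      using f h by (simp add: linear_map_add[OF lin] linear_map_closed[OF lin])
  qed
  \<comment> \<open>The coset is nonempty, so the description in \<open>tensor_lift\<close> has a
    witness; \<open>eq\<close> gives its uniqueness.\<close>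
  have self: "f \<in> ?H +>\<^bsub>?F\<^esub> f"
  proof -
    have "\<zero>\<^bsub>?F\<^esub> \<in> ?H"
      using submodule.axioms(1)[OF H] subgroup.one_closed by fastforce
    then show ?thesis
      using f unfolding a_r_coset_def' by (auto intro!: bexI[of _ "\<zero>\<^bsub>?F\<^esub>"])
  qed
  show ?thesis
    unfolding tensor_lift_def
  proof (rule the_equality)
    show "\<exists>f'\<in>?H +>\<^bsub>?F\<^esub> f. linear_ext R M g f = linear_ext R M g f'"
      using self by (rule bexI[rotated]) (rule refl)
  qed (elim bexE, simp only: eq)
qed

lemma tensor_lift_linear:
  "linear_map R (quotient_module (free_module R Z) (span_module R (free_module R Z) S)) M
     (tensor_lift R M g)"
proof -
  note lin = M.linear_ext_linear[where g = g, OF g]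
  note H = F.span_submodule[OF S]
  show ?thesis
    by (rule linear_mapI)
      (auto elim!: F.quotient_cases[OF H] simp: F.quotient_add[OF H] F.quotient_smult[OF H]
        tensor_lift_coset linear_map_closed[OF lin] linear_map_add[OF lin] linear_map_smult[OF lin])
qed

end

section \<open>Associative algebras\<close>

text \<open>The path algebra is noncommutative in general, so scalars must be required to pass
  through either factor separately.\<close>

locale assoc_algebra = Module.module R M + ring M for R and M (structure) +
  assumes smult_mult_left:
      "\<lbrakk>c \<in> carrier R; x \<in> carrier M; y \<in> carrier M\<rbrakk> \<Longrightarrow> (c \<odot> x) \<otimes> y = c \<odot> (x \<otimes> y)"
    and smult_mult_right:
      "\<lbrakk>c \<in> carrier R; x \<in> carrier M; y \<in> carrier M\<rbrakk> \<Longrightarrow> x \<otimes> (c \<odot> y) = c \<odot> (x \<otimes> y)"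
begin

text \<open>Scaling by \<open>c\<close> is multiplication by the element
  \<open>c \<odot> \<one>\<close>, which an ideal absorbs.\<close>

lemma ideal_submodule:
  assumes "ideal I M"
  shows "submodule I R M"
proof -
  interpret I: ideal I M by fact
  have "c \<odot> x \<in> I" if "c \<in> carrier R" "x \<in> I" for c x
    using that I.I_l_closed[of x "c \<odot> \<one>"] by (simp add: smult_mult_left)
  then show ?thesis
    by (intro submodule.intro submodule_axioms.intro I.a_subgroup)
qed

lemma quotient_mult:
  assumes "ideal I M" and "x \<in> carrier M" and "y \<in> carrier M"
  shows "(I +> x) \<otimes>\<^bsub>quotient_module M I\<^esub> (I +> y) = I +> (x \<otimes> y)"
  using assms by (simp add: quotient_module_simps ideal.rcoset_mult_add)

lemma quotient_assoc_algebra: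
  assumes I: "ideal I M"
  shows "assoc_algebra R (quotient_module M I)"
proof -
  note H = ideal_submodule[OF I]
  interpret Q: Module.module R "quotient_module M I"
    by (rule quotient_module_module[OF H])
  have one: "\<one>\<^bsub>quotient_module M I\<^esub> = I +> \<one>" by (simp add: quotient_module_simps)
  show ?thesis
  proof (intro assoc_algebra.intro assoc_algebra_axioms.intro Q.module_axioms ringI Q.abelian_group_axioms
      monoidI)
  qed (auto elim!: quotient_cases[OF H] simp: quotient_add[OF H] quotient_smult[OF H]
      quotient_mult[OF I] one smult_mult_left smult_mult_right m_assoc l_distr r_distr
      intro!: quotient_closed[OF H])
qed

lemma mult_left_linear: "x \<in> carrier M \<Longrightarrow> linear_map R M M (\<lambda>y. x \<otimes> y)"
  by (rule linear_mapI) (simp_all add: r_distr smult_mult_right)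

lemma mult_right_linear: "y \<in> carrier M \<Longrightarrow> linear_map R M M (\<lambda>x. x \<otimes> y)"
  by (rule linear_mapI) (simp_all add: l_distr smult_mult_left)

end

section \<open>The path algebra\<close>

lemma path_algebra_simps:
  "carrier (path_algebra R Q) = carrier (free_module R (paths Q))"
  "add (path_algebra R Q) = add (free_module R (paths Q))"
  "zero (path_algebra R Q) = zero (free_module R (paths Q))"
  "smult (path_algebra R Q) = smult (free_module R (paths Q))"
  "mult (path_algebra R Q) = (\<lambda>f g. linear_ext R (free_module R (paths Q))
     (\<lambda>a. linear_ext R (free_module R (paths Q)) (\<lambda>b. path_prod R a b) g) f)"
  "one (path_algebra R Q) = (\<lambda>w. if w \<in> paths_of_length Q 0 then \<one>\<^bsub>R\<^esub> else \<zero>\<^bsub>R\<^esub>)"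
  by (simp_all add: path_algebra_def Let_def)

lemma linear_map_path_algebra:
  "linear_map R (path_algebra R Q) M f \<longleftrightarrow> linear_map R (free_module R (paths Q)) M f"
  "linear_map R M (path_algebra R Q) g \<longleftrightarrow> linear_map R M (free_module R (paths Q)) g"
  by (simp_all add: linear_map_def path_algebra_simps)

text \<open>The graded pieces differ from the path algebra in their carriers only. Elements of
  different degrees can thus be added and compared inside \<open>P\<close> without inclusion
  maps.\<close>

lemma kQ_simps:
  "add (kQ_len R Q m) = add (path_algebra R Q)"
  "zero (kQ_len R Q m) = zero (path_algebra R Q)"
  "smult (kQ_len R Q m) = smult (path_algebra R Q)"
  unfolding kQ_len_def path_algebra_simps(2-4) by (simp_all add: free_module_def)

text \<open>Total concatenation: whether the end points match is tested in
  \<open>path_prod_eq\<close>, outside this function.\<close>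

definition path_comp :: "('v, 'e) path \<Rightarrow> ('v, 'e) path \<Rightarrow> ('v, 'e) path" where
  "path_comp a b = (fst a, fst (snd a) @ fst (snd b), snd (snd b))"

abbreviation source :: "('v, 'e) path \<Rightarrow> 'v" where "source \<equiv> fst"
abbreviation target :: "('v, 'e) path \<Rightarrow> 'v" where "target w \<equiv> snd (snd w)"

lemma path_prod_eq:
  "path_prod R a b = (if target a = source b then basis_vec R (path_comp a b) else (\<lambda>_. \<zero>\<^bsub>R\<^esub>))"
  by (cases a; cases b) (simp add: path_prod_def path_comp_def)

lemma path_comp_simps [simp]:
  "source (path_comp a b) = source a" "target (path_comp a b) = target b"
  "path_length (path_comp a b) = path_length a + path_length b"
  "path_comp (path_comp a b) c = path_comp a (path_comp b c)"
  by (simp_all add: path_comp_def path_length_def)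

lemma paths_of_lengthD: "w \<in> paths_of_length Q m \<Longrightarrow> w \<in> paths Q \<and> path_length w = m"
  by (simp add: paths_of_length_def)

lemma path_in_paths_of_length: "w \<in> paths Q \<Longrightarrow> w \<in> paths_of_length Q (path_length w)"
  by (simp add: paths_of_length_def)

locale quiver = cring R + G: fin_digraph Q
  for R :: "('k, 'r) ring_scheme" (structure) and Q :: "('v, 'e) pre_digraph"
begin

abbreviation "P \<equiv> path_algebra R Q"
abbreviation "bv \<equiv> basis_vec R"

lemma paths_iff: "w \<in> paths Q \<longleftrightarrow> G.awalk (source w) (fst (snd w)) (target w)"
  by (cases w) (simp add: paths_def)

lemma path_comp_in_paths:
  "\<lbrakk>a \<in> paths Q; b \<in> paths Q; target a = source b\<rbrakk> \<Longrightarrow> path_comp a b \<in> paths Q"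
  by (auto simp: paths_iff path_comp_def intro: G.awalk_appendI)

lemma paths_of_length_0: "paths_of_length Q 0 = (\<lambda>v. (v, [], v)) ` verts Q"
  by (auto simp: paths_of_length_def paths_def path_length_def G.awalk_Nil_iff)

lemma trivial_path_in_paths: "v \<in> verts Q \<Longrightarrow> (v, [], v) \<in> paths Q"
  by (simp add: paths_iff G.awalk_Nil_iff)

lemma source_target_in_verts:
  assumes "w \<in> paths Q"
  shows "source w \<in> verts Q" and "target w \<in> verts Q"
  using assms by (auto simp: paths_iff)

lemma path_comp_trivial [simp]:
  "path_comp (source w, [], v) w = w" "path_comp w (v, [], target w) = w"
  by (simp_all add: path_comp_def)

lemma path_prod_closed:
  assumes "a \<in> paths Q" and "b \<in> paths Q"
  shows "path_prod R a b \<in> carrier (free_module R (paths Q))"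
proof -
  interpret F: Module.module R "free_module R (paths Q)" by (rule free_module_module)
  have "(\<lambda>_. \<zero>) \<in> carrier (free_module R (paths Q))"
    using F.M.zero_closed by (simp add: free_module_simps(2))
  then show ?thesis
    using assms by (auto simp: path_prod_eq intro!: basis_vec_closed path_comp_in_paths)
qed

lemma P_module: "Module.module R P"
proof -
  interpret F: Module.module R "free_module R (paths Q)" by (rule free_module_module)
  \<comment> \<open>Being an abelian group depends on the additive monoid alone, which the new
    product and unit do not touch.\<close>
  have "add_monoid P = add_monoid (free_module R (paths Q))"
    by (simp add: path_algebra_simps)
  then have "abelian_group P"
    using F.abelian_group_axioms
    by (simp add: abelian_group_def abelian_monoid_def abelian_group_axioms_def)
  then show ?thesis
    by (intro moduleI is_cring)
      (auto simp: path_algebra_simps F.smult_l_distr F.smult_r_distr F.smult_assoc1)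
qed

lemma P_linear_eqI:
  assumes "Module.module R M" and "linear_map R P M f" and "linear_map R P M g"
    and "\<And>w. w \<in> paths Q \<Longrightarrow> f (bv w) = g (bv w)" and "x \<in> carrier P"
  shows "f x = g x"
  using assms by (intro free_linear_eqI[of M "paths Q" f g x])
    (simp_all add: linear_map_path_algebra path_algebra_simps)

lemma P_mult_left_linear: "x \<in> carrier P \<Longrightarrow> linear_map R P P (\<lambda>y. x \<otimes>\<^bsub>P\<^esub> y)"
  and P_mult_right_linear: "y \<in> carrier P \<Longrightarrow> linear_map R P P (\<lambda>x. x \<otimes>\<^bsub>P\<^esub> y)"
proof -
  interpret F: Module.module R "free_module R (paths Q)" by (rule free_module_module)
  have lin: "linear_map R (free_module R (paths Q)) (free_module R (paths Q))
      (linear_ext R (free_module R (paths Q)) (path_prod R a))" if "a \<in> paths Q" for a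
    using that by (intro F.linear_ext_linear path_prod_closed)
  show "linear_map R P P (\<lambda>y. x \<otimes>\<^bsub>P\<^esub> y)" if "x \<in> carrier P"
    using that unfolding linear_map_path_algebra path_algebra_simps
    by (intro F.linear_ext_param[where Z = "paths Q"] free_module_module lin)
  show "linear_map R P P (\<lambda>x. x \<otimes>\<^bsub>P\<^esub> y)" if "y \<in> carrier P"
    using that unfolding linear_map_path_algebra path_algebra_simps
    by (intro F.linear_ext_linear linear_map_closed[OF lin])
qed

lemma basis_mult:
  assumes "a \<in> paths Q" and "b \<in> paths Q"
  shows "bv a \<otimes>\<^bsub>P\<^esub> bv b = path_prod R a b"
proof -
  interpret F: Module.module R "free_module R (paths Q)" by (rule free_module_module)
  show ?thesis
    using assms by (simp add: path_algebra_simps F.linear_ext_basis_vec path_prod_closed)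
qed

lemma basis_closed: "w \<in> paths Q \<Longrightarrow> bv w \<in> carrier P"
  by (simp add: path_algebra_simps basis_vec_closed)

lemma basis_mult_comp:
  "\<lbrakk>a \<in> paths Q; b \<in> paths Q; target a = source b\<rbrakk> \<Longrightarrow> bv a \<otimes>\<^bsub>P\<^esub> bv b = bv (path_comp a b)"
  by (simp add: basis_mult path_prod_eq)

lemma basis_mult_zero:
  "\<lbrakk>a \<in> paths Q; b \<in> paths Q; target a \<noteq> source b\<rbrakk> \<Longrightarrow> bv a \<otimes>\<^bsub>P\<^esub> bv b = \<zero>\<^bsub>P\<^esub>"
  by (simp add: basis_mult path_prod_eq path_algebra_simps(3) free_module_simps)

text \<open>The unit is the sum of all vertices; it has finite support because the quiver has
  finitely many of them.\<close>

lemma P_one_closed: "\<one>\<^bsub>P\<^esub> \<in> carrier P"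
proof -
  have "finite (paths_of_length Q 0)" by (simp add: paths_of_length_0)
  then have "finite {w. \<one>\<^bsub>P\<^esub> w \<noteq> \<zero>}"
    by (rule rev_finite_subset) (auto simp: path_algebra_simps)
  then show ?thesis
    by (auto simp: path_algebra_simps free_module_simps paths_of_length_def)
qed

lemma P_one_mult_basis:
  assumes w: "w \<in> paths Q"
  shows "\<one>\<^bsub>P\<^esub> \<otimes>\<^bsub>P\<^esub> bv w = bv w" and "bv w \<otimes>\<^bsub>P\<^esub> \<one>\<^bsub>P\<^esub> = bv w"
proof -
  let ?F = "free_module R (paths Q)" and ?V = "paths_of_length Q 0"
  interpret F: Module.module R ?F by (rule free_module_module)
  have fin: "finite ?V" by (simp add: paths_of_length_0)
  have V: "(source w, [], source w) \<in> ?V" "(target w, [], target w) \<in> ?V"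
    using source_target_in_verts[OF w] by (auto simp: paths_of_length_0)
  have bw: "bv w \<in> carrier ?F" using w by (rule basis_vec_closed)
  have zero: "(\<lambda>_. \<zero>) = \<zero>\<^bsub>?F\<^esub>" by (simp add: free_module_simps)
  \<comment> \<open>Exactly one vertex does not annihilate \<open>bv w\<close>. With
    \<open>c\<close> the trivial path at the source or at the target of \<open>w\<close>, this
    settles the left or the right unit law.\<close>
  have sum: "linear_ext R ?F g \<one>\<^bsub>P\<^esub> = bv w"
    if c: "c \<in> ?V" and g: "\<And>a. a \<in> ?V \<Longrightarrow> g a = (if c = a then bv w else \<zero>\<^bsub>?F\<^esub>)" for g c
  proof -
    have "linear_ext R ?F g \<one>\<^bsub>P\<^esub> = (\<Oplus>\<^bsub>?F\<^esub> a \<in> ?V. \<one>\<^bsub>P\<^esub> a \<odot>\<^bsub>?F\<^esub> g a)"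
      using fin g bw by (intro F.linear_ext_superset) (auto simp: path_algebra_simps)
    also have "\<dots> = (\<Oplus>\<^bsub>?F\<^esub> a \<in> ?V. if c = a then bv w else \<zero>\<^bsub>?F\<^esub>)"
      using g bw by (intro F.M.finsum_cong') (auto simp: path_algebra_simps)
    also have "\<dots> = bv w"
      using fin bw c by (intro F.M.finsum_singleton) auto
    finally show ?thesis .
  qed
  have "\<one>\<^bsub>P\<^esub> \<otimes>\<^bsub>P\<^esub> bv w = linear_ext R ?F (\<lambda>a. linear_ext R ?F (path_prod R a) (bv w)) \<one>\<^bsub>P\<^esub>"
    by (simp add: path_algebra_simps)
  also have "\<dots> = bv w"
  proof (rule sum[OF V(1)])
    fix a assume a: "a \<in> ?V"
    then show "linear_ext R ?F (path_prod R a) (bv w)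
        = (if (source w, [], source w) = a then bv w else \<zero>\<^bsub>?F\<^esub>)"
      using w by (subst F.linear_ext_basis_vec)
        (auto simp: path_prod_closed paths_of_length_0 trivial_path_in_paths path_prod_eq zero
          path_comp_def bw)
  qed
  finally show "\<one>\<^bsub>P\<^esub> \<otimes>\<^bsub>P\<^esub> bv w = bv w" .
  have "bv w \<otimes>\<^bsub>P\<^esub> \<one>\<^bsub>P\<^esub> = linear_ext R ?F (\<lambda>a. linear_ext R ?F (path_prod R a) \<one>\<^bsub>P\<^esub>) (bv w)"
    by (simp add: path_algebra_simps)
  also have "\<dots> = linear_ext R ?F (path_prod R w) \<one>\<^bsub>P\<^esub>"
    using P_one_closed w
    by (intro F.linear_ext_basis_vec linear_map_closed[OF F.linear_ext_linear[where Z = "paths Q"]])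
      (auto simp: path_prod_closed path_algebra_simps)
  also have "\<dots> = bv w"
    using w by (intro sum[OF V(2)]) (auto simp: paths_of_length_0 path_prod_eq zero path_comp_def)
  finally show "bv w \<otimes>\<^bsub>P\<^esub> \<one>\<^bsub>P\<^esub> = bv w" .
qed

lemma P_assoc_algebra: "assoc_algebra R P"
proof -
  interpret P: Module.module R P by (rule P_module)
  have closed: "x \<otimes>\<^bsub>P\<^esub> y \<in> carrier P" if "x \<in> carrier P" "y \<in> carrier P" for x y
    using that linear_map_closed[OF P_mult_left_linear] by blast
  have assoc_basis: "(bv a \<otimes>\<^bsub>P\<^esub> bv b) \<otimes>\<^bsub>P\<^esub> bv c = bv a \<otimes>\<^bsub>P\<^esub> (bv b \<otimes>\<^bsub>P\<^esub> bv c)"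
    if p: "a \<in> paths Q" "b \<in> paths Q" "c \<in> paths Q" for a b c
  proof -
    have z: "\<zero>\<^bsub>P\<^esub> \<otimes>\<^bsub>P\<^esub> bv c = \<zero>\<^bsub>P\<^esub>" "bv a \<otimes>\<^bsub>P\<^esub> \<zero>\<^bsub>P\<^esub> = \<zero>\<^bsub>P\<^esub>"
      using p by (auto intro!: linear_map_zero[OF P_module P_module] P_mult_left_linear
          P_mult_right_linear basis_closed)
    show ?thesis
      using p by (cases "target a = source b"; cases "target b = source c")
        (simp_all add: basis_mult_comp basis_mult_zero path_comp_in_paths z)
  qed
  \<comment> \<open>Associativity is freed from basis vectors one factor at a time, from right to
    left, each time by comparing two linear maps.\<close>
  have assoc1: "(bv a \<otimes>\<^bsub>P\<^esub> bv b) \<otimes>\<^bsub>P\<^esub> z = bv a \<otimes>\<^bsub>P\<^esub> (bv b \<otimes>\<^bsub>P\<^esub> z)"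
    if "a \<in> paths Q" "b \<in> paths Q" "z \<in> carrier P" for a b z
    using that(3)
    by (rule P_linear_eqI[OF P_module, rotated 3])
      (auto intro!: P_mult_left_linear closed basis_closed that assoc_basis
        linear_map_comp[OF P_mult_left_linear P_mult_left_linear])
  have assoc2: "(bv a \<otimes>\<^bsub>P\<^esub> y) \<otimes>\<^bsub>P\<^esub> z = bv a \<otimes>\<^bsub>P\<^esub> (y \<otimes>\<^bsub>P\<^esub> z)"
    if "a \<in> paths Q" "y \<in> carrier P" "z \<in> carrier P" for a y z
    using that(2)
    by (rule P_linear_eqI[OF P_module, rotated 3])
      (auto intro!: closed basis_closed that assoc1
        linear_map_comp[OF P_mult_left_linear P_mult_right_linear]
        linear_map_comp[OF P_mult_right_linear P_mult_left_linear])
  have assoc: "(x \<otimes>\<^bsub>P\<^esub> y) \<otimes>\<^bsub>P\<^esub> z = x \<otimes>\<^bsub>P\<^esub> (y \<otimes>\<^bsub>P\<^esub> z)"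
    if "x \<in> carrier P" "y \<in> carrier P" "z \<in> carrier P" for x y z
    using that(1)
    by (rule P_linear_eqI[OF P_module, rotated 3])
      (auto intro!: P_mult_right_linear closed basis_closed that assoc2
        linear_map_comp[OF P_mult_right_linear P_mult_right_linear])
  have id: "linear_map R P P (\<lambda>x. x)" by (rule linear_mapI) auto
  have l_one: "\<one>\<^bsub>P\<^esub> \<otimes>\<^bsub>P\<^esub> x = x" if "x \<in> carrier P" for x
    by (rule P_linear_eqI[OF P_module _ id _ that, of "\<lambda>x. \<one>\<^bsub>P\<^esub> \<otimes>\<^bsub>P\<^esub> x"])
      (auto intro!: P_mult_left_linear P_one_closed P_one_mult_basis)
  have r_one: "x \<otimes>\<^bsub>P\<^esub> \<one>\<^bsub>P\<^esub> = x" if "x \<in> carrier P" for x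
    by (rule P_linear_eqI[OF P_module _ id _ that, of "\<lambda>x. x \<otimes>\<^bsub>P\<^esub> \<one>\<^bsub>P\<^esub>"])
      (auto intro!: P_mult_right_linear P_one_closed P_one_mult_basis)
  show ?thesis
    by (intro assoc_algebra.intro P.module_axioms assoc_algebra_axioms.intro ringI
        P.abelian_group_axioms monoidI)
      (auto simp: closed assoc l_one r_one P_one_closed linear_map_add[OF P_mult_left_linear]
        linear_map_add[OF P_mult_right_linear] linear_map_smult[OF P_mult_left_linear]
        linear_map_smult[OF P_mult_right_linear])
qed

sublocale P: assoc_algebra R P by (rule P_assoc_algebra)

subsection \<open>Subpaths\<close>

lemma awalk_verts_nth_left:
  assumes "G.awalk u p x" and "G.awalk x q v" and "i \<le> length p"
  shows "G.awalk_verts u (p @ q) ! i = G.awalk_verts u p ! i"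
  using assms G.awalk_verts_append[of u p q v]
  by (auto simp: nth_append G.length_awalk_verts intro: G.awalk_appendI)

lemma awalk_verts_nth_right:
  assumes "G.awalk u p x" and "G.awalk x q v"
  shows "G.awalk_verts u (p @ q) ! (length p + i) = G.awalk_verts x q ! i"
  using assms G.awalk_verts_append2[of u p q v]
  by (auto simp: nth_append G.length_awalk_verts intro: G.awalk_appendI)

lemma awalk_verts_nth_0: "G.awalk u p v \<Longrightarrow> G.awalk_verts u p ! 0 = u"
  by (metis G.awalk_verts_non_Nil G.awhd_of_awalk hd_conv_nth)

lemma awalk_verts_nth_length: "G.awalk u p v \<Longrightarrow> G.awalk_verts u p ! length p = v"
  by (metis G.awlast_if_cas G.awalk_def G.awalk_verts_non_Nil G.length_awalk_verts diff_Suc_1 last_conv_nth)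

lemma path_split:
  assumes "w \<in> paths Q" and "i \<le> path_length w"
  obtains a b where "a \<in> paths Q" "b \<in> paths Q" "target a = source b" "w = path_comp a b"
    "path_length a = i"
proof -
  obtain u p v where w: "w = (u, p, v)" by (cases w)
  have "G.awalk u (take i p @ drop i p) v"
    using assms by (simp add: w paths_iff)
  then have "G.awalk u (take i p) (G.awlast u (take i p))" "G.awalk (G.awlast u (take i p)) (drop i p) v"
    by (simp_all only: G.awalk_append_iff)
  then show ?thesis
    using assms(2) by (intro that[of "(u, take i p, G.awlast u (take i p))" "(G.awlast u (take i p), drop i p, v)"])
      (auto simp: w paths_iff path_comp_def path_length_def)
qed

text \<open>Subpaths are defined by vertex numbers. This rule, the next one and
  \<open>subpath_full\<close> compute them from a factorization instead.\<close>

lemma subpath_comp_left: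
  assumes "a \<in> paths Q" and "b \<in> paths Q" and "target a = source b"
    and "i \<le> j" and "j \<le> path_length a"
  shows "subpath Q (path_comp a b) i j = subpath Q a i j"
  using assms
  by (cases a; cases b)
    (auto simp: subpath_def path_comp_def paths_iff path_length_def awalk_verts_nth_left)

lemma subpath_comp_right:
  assumes "a \<in> paths Q" and "b \<in> paths Q" and "target a = source b"
  shows "subpath Q (path_comp a b) (path_length a + i) (path_length a + j) = subpath Q b i j"
  using assms
  by (cases a; cases b)
    (auto simp: subpath_def path_comp_def paths_iff path_length_def awalk_verts_nth_right)

lemma subpath_full: "w \<in> paths Q \<Longrightarrow> subpath Q w 0 (path_length w) = w"
  by (cases w) (auto simp: subpath_def paths_iff path_length_def awalk_verts_nth_0
      awalk_verts_nth_length)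

lemma subpath_in_paths_of_length:
  assumes w: "w \<in> paths Q" and ij: "i \<le> j" "j \<le> path_length w"
  shows "subpath Q w i j \<in> paths_of_length Q (j - i)"
proof -
  obtain a c where 1: "a \<in> paths Q" "c \<in> paths Q" "target a = source c" "w = path_comp a c"
    "path_length a = i"
    using path_split[OF w order_trans[OF ij]] .
  have "j - i \<le> path_length c" using 1 ij by auto
  then obtain b d where 2: "b \<in> paths Q" "d \<in> paths Q" "target b = source d" "c = path_comp b d"
    "path_length b = j - i"
    using path_split[OF 1(2)] by blast
  have "subpath Q w i j = subpath Q c 0 (j - i)"
    using subpath_comp_right[of a c 0 "j - i"] 1 ij by simp
  also have "\<dots> = b"
    using subpath_comp_left[of b d 0 "j - i"] subpath_full[of b] 2 by simp
  finally show ?thesis using 2 by (simp add: paths_of_length_def)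
qed

lemma subpath_in_paths: "\<lbrakk>w \<in> paths Q; i \<le> j; j \<le> path_length w\<rbrakk> \<Longrightarrow> subpath Q w i j \<in> paths Q"
  using paths_of_lengthD[OF subpath_in_paths_of_length] by blast

lemma subpath_length: "\<lbrakk>w \<in> paths Q; i \<le> j; j \<le> path_length w\<rbrakk> \<Longrightarrow> path_length (subpath Q w i j) = j - i"
  using paths_of_lengthD[OF subpath_in_paths_of_length] by blast

lemma subpath_target_source: "target (subpath Q w i j) = source (subpath Q w j k)"
  by (cases w) (simp add: subpath_def)

lemma path_comp_subpath:
  assumes "i \<le> j" and "j \<le> k"
  shows "path_comp (subpath Q w i j) (subpath Q w j k) = subpath Q w i k"
proof -
  have "take (k - i) (drop i p) = take (j - i) (drop i p) @ take (k - j) (drop j p)" for p :: "'e list"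
    using assms take_add[of "j - i" "k - j" "drop i p"] by simp
  then show ?thesis
    by (cases w) (simp add: subpath_def path_comp_def)
qed

lemma subpath_mult:
  assumes "w \<in> paths Q" and "i \<le> j" and "j \<le> k" and "k \<le> path_length w"
  shows "bv (subpath Q w i j) \<otimes>\<^bsub>P\<^esub> bv (subpath Q w j k) = bv (subpath Q w i k)"
  using assms
  by (simp add: basis_mult_comp subpath_in_paths subpath_target_source[of w i j k] path_comp_subpath)

text \<open>Cut \<open>w\<close> at \<open>i\<close> and at \<open>j\<close>; the rules for
  compositions then discard the two outer pieces.\<close>

lemma subpath_subpath:
  assumes w: "w \<in> paths Q" and "i \<le> j" and "j \<le> path_length w" and "i' \<le> j'" and "j' \<le> j - i"
  shows "subpath Q (subpath Q w i j) i' j' = subpath Q w (i + i') (i + j')"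
proof -
  let ?a = "subpath Q w 0 i" and ?b = "subpath Q w i j" and ?c = "subpath Q w j (path_length w)"
  have p: "?a \<in> paths Q" "?b \<in> paths Q" "?c \<in> paths Q" "path_length ?a = i" "path_length ?b = j - i"
    using assms by (auto intro: subpath_in_paths simp: subpath_length)
  have ts: "target ?a = source ?b" "target ?b = source ?c" by (simp_all add: subpath_target_source)
  have "w = path_comp ?a (path_comp ?b ?c)"
    using assms by (simp add: path_comp_subpath subpath_full)
  then have "subpath Q w (i + i') (i + j') = subpath Q (path_comp ?b ?c) i' j'"
    using subpath_comp_right[of ?a "path_comp ?b ?c" i' j'] p ts path_comp_in_paths[of ?b ?c] by simp
  also have "\<dots> = subpath Q ?b i' j'"
    using assms p ts by (intro subpath_comp_left) auto
  finally show ?thesis ..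
qed

subsection \<open>The grading by length\<close>

abbreviation "kQ \<equiv> kQ_len R Q"

lemma kQ_module: "Module.module R (kQ m)"
  unfolding kQ_len_def by (rule free_module_module)

lemma kQ_subset: "carrier (kQ m) \<subseteq> carrier P"
  unfolding kQ_len_def path_algebra_simps
  by (rule free_module_mono) (auto simp: paths_of_length_def)

lemma kQ_in_P [simp]: "x \<in> carrier (kQ m) \<Longrightarrow> x \<in> carrier P"
  using kQ_subset by auto

lemma basis_in_kQ: "w \<in> paths_of_length Q m \<Longrightarrow> bv w \<in> carrier (kQ m)"
  by (simp add: kQ_len_def basis_vec_closed)

lemma kQ_closed:
  "\<zero>\<^bsub>P\<^esub> \<in> carrier (kQ m)"
  "\<lbrakk>x \<in> carrier (kQ m); y \<in> carrier (kQ m)\<rbrakk> \<Longrightarrow> x \<oplus>\<^bsub>P\<^esub> y \<in> carrier (kQ m)"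
  "\<lbrakk>c \<in> carrier R; x \<in> carrier (kQ m)\<rbrakk> \<Longrightarrow> c \<odot>\<^bsub>P\<^esub> x \<in> carrier (kQ m)"
proof -
  interpret K: Module.module R "kQ m" by (rule kQ_module)
  show "\<zero>\<^bsub>P\<^esub> \<in> carrier (kQ m)" using K.M.zero_closed by (simp add: kQ_simps)
  show "x \<oplus>\<^bsub>P\<^esub> y \<in> carrier (kQ m)" if "x \<in> carrier (kQ m)" "y \<in> carrier (kQ m)"
    using that K.M.a_closed by (simp add: kQ_simps)
  show "c \<odot>\<^bsub>P\<^esub> x \<in> carrier (kQ m)" if "c \<in> carrier R" "x \<in> carrier (kQ m)"
    using that K.smult_closed by (simp add: kQ_simps)
qed

lemma kQ_induct [consumes 1, case_names zero add]:
  assumes "x \<in> carrier (kQ m)" and "H \<zero>\<^bsub>P\<^esub>"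
    and "\<And>c w x. \<lbrakk>c \<in> carrier R; w \<in> paths_of_length Q m; x \<in> carrier (kQ m); H x\<rbrakk>
      \<Longrightarrow> H (c \<odot>\<^bsub>P\<^esub> bv w \<oplus>\<^bsub>P\<^esub> x)"
  shows "H x"
proof -
  have "x \<in> carrier (free_module R (paths_of_length Q m))"
    using assms(1) by (simp add: kQ_len_def)
  then show ?thesis
  proof (induction rule: free_module_induct)
    case zero
    then show ?case using assms(2) by (simp add: path_algebra_simps free_module_simps)
  next
    case (add c w x)
    then show ?case using assms(3)[of c w x]
      by (simp add: kQ_len_def path_algebra_simps free_module_simps)
  qed
qed

lemma kQ_linear_eqI:
  assumes "Module.module R M" and "linear_map R (kQ m) M f" and "linear_map R (kQ m) M g"
    and "\<And>w. w \<in> paths_of_length Q m \<Longrightarrow> f (bv w) = g (bv w)" and "x \<in> carrier (kQ m)"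
  shows "f x = g x"
  using assms unfolding kQ_len_def by (rule free_linear_eqI[of M "paths_of_length Q m" f g x])

lemma linear_map_kQ:
  assumes "linear_map R P M f"
  shows "linear_map R (kQ m) M f"
  using assms by (simp add: linear_map_def kQ_simps)

text \<open>Two basis paths multiply to a path of length \<open>m + n\<close> or to zero, and zero
  lies in every graded piece.\<close>

lemma kQ_mult:
  assumes x: "x \<in> carrier (kQ m)" and y: "y \<in> carrier (kQ n)"
  shows "x \<otimes>\<^bsub>P\<^esub> y \<in> carrier (kQ (m + n))"
proof -
  have *: "bv a \<otimes>\<^bsub>P\<^esub> y \<in> carrier (kQ (m + n))" if a: "a \<in> paths_of_length Q m" for a
    using y
  proof (induction rule: kQ_induct)
    case (add c b y)
    have ap: "a \<in> paths Q" and bp: "b \<in> paths Q" using a add by (auto dest: paths_of_lengthD)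
    have "bv a \<otimes>\<^bsub>P\<^esub> bv b \<in> carrier (kQ (m + n))"
    proof (cases "target a = source b")
      case True
      then show ?thesis
        using a add ap bp by (auto simp: basis_mult_comp paths_of_length_def
            intro!: basis_in_kQ path_comp_in_paths)
    qed (use ap bp in \<open>simp add: basis_mult_zero kQ_closed\<close>)
    then show ?case
      using add ap bp
      by (simp add: P.r_distr P.smult_mult_right basis_closed kQ_closed)
  qed (use a in \<open>auto simp: kQ_closed basis_closed dest!: paths_of_lengthD\<close>)
  show ?thesis
    using x
  proof (induction rule: kQ_induct)
    case (add c a x)
    then have "a \<in> paths Q" by (auto dest: paths_of_lengthD)
    then show ?case
      using add * y by (simp add: P.l_distr P.smult_mult_left basis_closed kQ_closed)
  qed (use y in \<open>simp add: kQ_closed\<close>)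
qed

end

section \<open>The truncated algebra\<close>

locale trunc_quiver = quiver R Q
  for R :: "('k, 'r) ring_scheme" (structure) and Q :: "('v, 'e) pre_digraph" +
  fixes N :: nat
begin

abbreviation "A \<equiv> trunc_algebra R Q N"
abbreviation "cl \<equiv> trunc_class R Q N"

lemma trunc_ideal: "ideal (trunc_ideal R Q N) P"
  unfolding trunc_ideal_def
  by (rule P.genideal_ideal) (auto simp: basis_closed paths_of_length_def)

sublocale A: assoc_algebra R A
  unfolding trunc_algebra_def by (rule P.quotient_assoc_algebra[OF trunc_ideal])

lemmas trunc_submodule = P.ideal_submodule[OF trunc_ideal]

lemma cl_linear: "linear_map R P A cl"
  using P.quotient_linear[OF trunc_submodule] unfolding trunc_class_def trunc_algebra_def .

lemma cl_closed [simp]: "x \<in> carrier P \<Longrightarrow> cl x \<in> carrier A"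
  by (rule linear_map_closed[OF cl_linear])

lemma cl_mult: "\<lbrakk>x \<in> carrier P; y \<in> carrier P\<rbrakk> \<Longrightarrow> cl (x \<otimes>\<^bsub>P\<^esub> y) = cl x \<otimes>\<^bsub>A\<^esub> cl y"
  by (simp add: trunc_class_def trunc_algebra_def P.quotient_mult[OF trunc_ideal])

lemma cl_one: "cl \<one>\<^bsub>P\<^esub> = \<one>\<^bsub>A\<^esub>"
  by (simp add: trunc_class_def trunc_algebra_def quotient_module_simps)

lemma cl_zero: "cl \<zero>\<^bsub>P\<^esub> = \<zero>\<^bsub>A\<^esub>"
  by (rule linear_map_zero[OF P.module_axioms A.module_axioms cl_linear])

text \<open>The first \<open>N\<close> arrows of \<open>w\<close> already form a generator of the
  ideal, and the ideal absorbs the remaining ones.\<close>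

lemma cl_basis_long:
  assumes w: "w \<in> paths Q" and "N \<le> path_length w"
  shows "cl (bv w) = \<zero>\<^bsub>A\<^esub>"
proof -
  obtain a b where ab: "a \<in> paths Q" "b \<in> paths Q" "target a = source b" "w = path_comp a b"
    "path_length a = N"
    by (rule path_split[OF assms])
  have "bv a \<in> trunc_ideal R Q N"
    unfolding trunc_ideal_def using ab(1,5)
    by (intro P.genideal_self[THEN subsetD] imageI)
      (auto simp: basis_closed paths_of_length_def)
  then have "bv a \<otimes>\<^bsub>P\<^esub> bv b \<in> trunc_ideal R Q N"
    using ab by (intro ideal.I_r_closed[OF trunc_ideal] basis_closed)
  then show ?thesis
    using ab by (simp add: basis_mult_comp trunc_class_def trunc_algebra_def
        P.quotient_eq_zeroI[OF trunc_submodule])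
qed

section \<open>The tensor product\<close>

abbreviation "T \<equiv> tensor_module R Q N"
abbreviation "pt \<equiv> pure_tensor R Q N"
abbreviation "act \<equiv> bimod_act R Q N"
abbreviation "F \<equiv> triple_module R Q N"
abbreviation "rels \<equiv> tensor_relations R Q N"

lemma F_module: "Module.module R (F m)"
  unfolding triple_module_def by (rule free_module_module)

sublocale F: Module.module R "triple_module R Q N m" for m by (rule F_module)

lemma triple_basis_closed [simp]:
  "\<lbrakk>a \<in> carrier A; u \<in> carrier (kQ m); b \<in> carrier A\<rbrakk> \<Longrightarrow> basis_vec R (a, u, b) \<in> carrier (F m)"
  by (simp add: triple_module_def basis_vec_closed)

lemma kQ_0_mult:
  "\<lbrakk>e \<in> carrier (kQ 0); u \<in> carrier (kQ m)\<rbrakk> \<Longrightarrow> e \<otimes>\<^bsub>P\<^esub> u \<in> carrier (kQ m)"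
  "\<lbrakk>e \<in> carrier (kQ 0); u \<in> carrier (kQ m)\<rbrakk> \<Longrightarrow> u \<otimes>\<^bsub>P\<^esub> e \<in> carrier (kQ m)"
  using kQ_mult[of e 0 u m] kQ_mult[of u m e 0] by simp_all

sublocale K: Module.module R "kQ_len R Q m" for m by (rule kQ_module)

lemma rels_closed: "rels m \<subseteq> carrier (F m)"
  unfolding tensor_relations_def Let_def
  by (intro Un_least subsetI; elim CollectE exE conjE; hypsubst) (simp_all add: kQ_0_mult)

lemmas span_rels_submodule = F.span_submodule[OF rels_closed]

sublocale T: Module.module R "tensor_module R Q N m" for m
  unfolding tensor_module_def by (rule F.quotient_module_module[OF span_rels_submodule])

lemma T_class_linear: "linear_map R (F m) (T m) (\<lambda>f. span_module R (F m) (rels m) +>\<^bsub>F m\<^esub> f)"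
  unfolding tensor_module_def by (rule F.quotient_linear[OF span_rels_submodule])

lemma T_class_eqI:
  assumes "x \<ominus>\<^bsub>F m\<^esub> y \<in> rels m" and "x \<in> carrier (F m)" and "y \<in> carrier (F m)"
  shows "span_module R (F m) (rels m) +>\<^bsub>F m\<^esub> x = span_module R (F m) (rels m) +>\<^bsub>F m\<^esub> y"
  using assms F.span_superset by (intro F.quotient_eqI[OF span_rels_submodule]) auto

text \<open>The tensor product is a quotient of the free module on triples, and the pure tensors are
  the classes of the basis vectors.\<close>

lemma T_linear_eqI:
  assumes "Module.module R M" and "linear_map R (T m) M f" and "linear_map R (T m) M g"
    and "\<And>a u b. \<lbrakk>a \<in> carrier A; u \<in> carrier (kQ m); b \<in> carrier A\<rbrakk> \<Longrightarrow> f (pt m a u b) = g (pt m a u b)"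
    and X: "X \<in> carrier (T m)"
  shows "f X = g X"
proof -
  obtain x where x: "x \<in> carrier (F m)" "X = span_module R (F m) (rels m) +>\<^bsub>F m\<^esub> x"
    using X unfolding tensor_module_def by (rule F.quotient_cases[OF span_rels_submodule])
  have "f (span_module R (F m) (rels m) +>\<^bsub>F m\<^esub> x) = g (span_module R (F m) (rels m) +>\<^bsub>F m\<^esub> x)"
    by (rule free_linear_eqI[OF assms(1) linear_map_comp[OF T_class_linear[unfolded triple_module_def] assms(2)[folded triple_module_def]]
          linear_map_comp[OF T_class_linear[unfolded triple_module_def] assms(3)], folded triple_module_def, OF _ x(1)])
      (use assms(4) in \<open>auto simp: pure_tensor_def\<close>)
  then show ?thesis using x by simp
qed

section \<open>The universal property of the tensor product\<close>

definition balanced ::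
  "nat \<Rightarrow> ('k, 'm, 's) module_scheme
    \<Rightarrow> (('v, 'e, 'k) trunc \<Rightarrow> (('v, 'e) path \<Rightarrow> 'k) \<Rightarrow> ('v, 'e, 'k) trunc \<Rightarrow> 'm) \<Rightarrow> bool" where
  "balanced m M g \<longleftrightarrow>
    (\<forall>u\<in>carrier (kQ m). \<forall>b\<in>carrier A. linear_map R A M (\<lambda>a. g a u b)) \<and>
    (\<forall>a\<in>carrier A. \<forall>b\<in>carrier A. linear_map R (kQ m) M (\<lambda>u. g a u b)) \<and>
    (\<forall>a\<in>carrier A. \<forall>u\<in>carrier (kQ m). linear_map R A M (\<lambda>b. g a u b)) \<and>
    (\<forall>a\<in>carrier A. \<forall>e\<in>carrier (kQ 0). \<forall>u\<in>carrier (kQ m). \<forall>b\<in>carrier A.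
       g (a \<otimes>\<^bsub>A\<^esub> cl e) u b = g a (e \<otimes>\<^bsub>P\<^esub> u) b \<and> g a (u \<otimes>\<^bsub>P\<^esub> e) b = g a u (cl e \<otimes>\<^bsub>A\<^esub> b))"

lemma balancedI:
  assumes "\<And>u b. \<lbrakk>u \<in> carrier (kQ m); b \<in> carrier A\<rbrakk> \<Longrightarrow> linear_map R A M (\<lambda>a. g a u b)"
    and "\<And>a b. \<lbrakk>a \<in> carrier A; b \<in> carrier A\<rbrakk> \<Longrightarrow> linear_map R (kQ m) M (\<lambda>u. g a u b)"
    and "\<And>a u. \<lbrakk>a \<in> carrier A; u \<in> carrier (kQ m)\<rbrakk> \<Longrightarrow> linear_map R A M (\<lambda>b. g a u b)"
    and "\<And>a e u b. \<lbrakk>a \<in> carrier A; e \<in> carrier (kQ 0); u \<in> carrier (kQ m); b \<in> carrier A\<rbrakk>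
      \<Longrightarrow> g (a \<otimes>\<^bsub>A\<^esub> cl e) u b = g a (e \<otimes>\<^bsub>P\<^esub> u) b"
    and "\<And>a e u b. \<lbrakk>a \<in> carrier A; e \<in> carrier (kQ 0); u \<in> carrier (kQ m); b \<in> carrier A\<rbrakk>
      \<Longrightarrow> g a (u \<otimes>\<^bsub>P\<^esub> e) b = g a u (cl e \<otimes>\<^bsub>A\<^esub> b)"
  shows "balanced m M g"
  unfolding balanced_def by (intro conjI ballI) (rule assms; assumption)+

lemma
  assumes "balanced m M g"
  shows balanced_linear_left:
      "\<lbrakk>u \<in> carrier (kQ m); b \<in> carrier A\<rbrakk> \<Longrightarrow> linear_map R A M (\<lambda>a. g a u b)"
    and balanced_linear_mid:
      "\<lbrakk>a \<in> carrier A; b \<in> carrier A\<rbrakk> \<Longrightarrow> linear_map R (kQ m) M (\<lambda>u. g a u b)"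
    and balanced_linear_right:
      "\<lbrakk>a \<in> carrier A; u \<in> carrier (kQ m)\<rbrakk> \<Longrightarrow> linear_map R A M (\<lambda>b. g a u b)"
    and balanced_left:
      "\<lbrakk>a \<in> carrier A; e \<in> carrier (kQ 0); u \<in> carrier (kQ m); b \<in> carrier A\<rbrakk>
        \<Longrightarrow> g (a \<otimes>\<^bsub>A\<^esub> cl e) u b = g a (e \<otimes>\<^bsub>P\<^esub> u) b"
    and balanced_right:
      "\<lbrakk>a \<in> carrier A; e \<in> carrier (kQ 0); u \<in> carrier (kQ m); b \<in> carrier A\<rbrakk>
        \<Longrightarrow> g a (u \<otimes>\<^bsub>P\<^esub> e) b = g a u (cl e \<otimes>\<^bsub>A\<^esub> b)"
  using assms by (simp_all add: balanced_def)

lemma balanced_closed: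
  "\<lbrakk>balanced m M g; a \<in> carrier A; u \<in> carrier (kQ m); b \<in> carrier A\<rbrakk> \<Longrightarrow> g a u b \<in> carrier M"
  by (rule linear_map_closed[OF balanced_linear_left])

lemma balanced_add:
  assumes M: "Module.module R M" and g: "balanced m M g" and h: "balanced m M h"
  shows "balanced m M (\<lambda>a u b. g a u b \<oplus>\<^bsub>M\<^esub> h a u b)"
  by (intro balancedI linear_map_plus[OF M])
    (simp_all add: balanced_linear_left[OF g] balanced_linear_left[OF h] balanced_linear_mid[OF g]
      balanced_linear_mid[OF h] balanced_linear_right[OF g] balanced_linear_right[OF h]
      balanced_left[OF g] balanced_left[OF h] balanced_right[OF g] balanced_right[OF h])

lemma tensor_relations_mem:
  "\<lbrakk>a \<in> carrier A; a' \<in> carrier A; u \<in> carrier (kQ m); b \<in> carrier A\<rbrakk> \<Longrightarrow>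
     basis_vec R (a \<oplus>\<^bsub>A\<^esub> a', u, b) \<ominus>\<^bsub>F m\<^esub> (basis_vec R (a, u, b) \<oplus>\<^bsub>F m\<^esub> basis_vec R (a', u, b)) \<in> rels m"
  "\<lbrakk>a \<in> carrier A; u \<in> carrier (kQ m); u' \<in> carrier (kQ m); b \<in> carrier A\<rbrakk> \<Longrightarrow>
     basis_vec R (a, u \<oplus>\<^bsub>kQ m\<^esub> u', b) \<ominus>\<^bsub>F m\<^esub> (basis_vec R (a, u, b) \<oplus>\<^bsub>F m\<^esub> basis_vec R (a, u', b)) \<in> rels m"
  "\<lbrakk>a \<in> carrier A; u \<in> carrier (kQ m); b \<in> carrier A; b' \<in> carrier A\<rbrakk> \<Longrightarrow>
     basis_vec R (a, u, b \<oplus>\<^bsub>A\<^esub> b') \<ominus>\<^bsub>F m\<^esub> (basis_vec R (a, u, b) \<oplus>\<^bsub>F m\<^esub> basis_vec R (a, u, b')) \<in> rels m"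
  "\<lbrakk>c \<in> carrier R; a \<in> carrier A; u \<in> carrier (kQ m); b \<in> carrier A\<rbrakk> \<Longrightarrow>
     basis_vec R (c \<odot>\<^bsub>A\<^esub> a, u, b) \<ominus>\<^bsub>F m\<^esub> c \<odot>\<^bsub>F m\<^esub> basis_vec R (a, u, b) \<in> rels m"
  "\<lbrakk>c \<in> carrier R; a \<in> carrier A; u \<in> carrier (kQ m); b \<in> carrier A\<rbrakk> \<Longrightarrow>
     basis_vec R (a, c \<odot>\<^bsub>kQ m\<^esub> u, b) \<ominus>\<^bsub>F m\<^esub> c \<odot>\<^bsub>F m\<^esub> basis_vec R (a, u, b) \<in> rels m"
  "\<lbrakk>c \<in> carrier R; a \<in> carrier A; u \<in> carrier (kQ m); b \<in> carrier A\<rbrakk> \<Longrightarrow>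
     basis_vec R (a, u, c \<odot>\<^bsub>A\<^esub> b) \<ominus>\<^bsub>F m\<^esub> c \<odot>\<^bsub>F m\<^esub> basis_vec R (a, u, b) \<in> rels m"
  "\<lbrakk>a \<in> carrier A; e \<in> carrier (kQ 0); u \<in> carrier (kQ m); b \<in> carrier A\<rbrakk> \<Longrightarrow>
     basis_vec R (a \<otimes>\<^bsub>A\<^esub> cl e, u, b) \<ominus>\<^bsub>F m\<^esub> basis_vec R (a, e \<otimes>\<^bsub>P\<^esub> u, b) \<in> rels m"
  "\<lbrakk>a \<in> carrier A; e \<in> carrier (kQ 0); u \<in> carrier (kQ m); b \<in> carrier A\<rbrakk> \<Longrightarrow>
     basis_vec R (a, u \<otimes>\<^bsub>P\<^esub> e, b) \<ominus>\<^bsub>F m\<^esub> basis_vec R (a, u, cl e \<otimes>\<^bsub>A\<^esub> b) \<in> rels m"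
  unfolding tensor_relations_def Let_def Un_iff mem_Collect_eq
  \<comment> \<open>The unions in \<open>tensor_relations\<close> associate to the left, so the
    first family of relations lies deepest.\<close>
  subgoal by (rule disjI1, rule disjI1, rule disjI1, rule disjI1, rule disjI1, rule disjI1, rule disjI1, intro exI conjI, rule refl, assumption+)
  subgoal by (rule disjI1, rule disjI1, rule disjI1, rule disjI1, rule disjI1, rule disjI1, rule disjI2, intro exI conjI, rule refl, assumption+)
  subgoal by (rule disjI1, rule disjI1, rule disjI1, rule disjI1, rule disjI1, rule disjI2, intro exI conjI, rule refl, assumption+)
  subgoal by (rule disjI1, rule disjI1, rule disjI1, rule disjI1, rule disjI2, intro exI conjI, rule refl, assumption+)
  subgoal by (rule disjI1, rule disjI1, rule disjI1, rule disjI2, intro exI conjI, rule refl, assumption+)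
  subgoal by (rule disjI1, rule disjI1, rule disjI2, intro exI conjI, rule refl, assumption+)
  subgoal by (rule disjI1, rule disjI2, intro exI conjI, rule refl, assumption+)
  subgoal by (rule disjI2, intro exI conjI, rule refl, assumption+)
  done

lemma pt_laws:
  assumes [simp]: "a \<in> carrier A" "u \<in> carrier (kQ m)" "b \<in> carrier A"
  shows "pt m a u b \<in> carrier (T m)"
    and "a' \<in> carrier A \<Longrightarrow> pt m (a \<oplus>\<^bsub>A\<^esub> a') u b = pt m a u b \<oplus>\<^bsub>T m\<^esub> pt m a' u b"
    and "u' \<in> carrier (kQ m) \<Longrightarrow> pt m a (u \<oplus>\<^bsub>kQ m\<^esub> u') b = pt m a u b \<oplus>\<^bsub>T m\<^esub> pt m a u' b"
    and "b' \<in> carrier A \<Longrightarrow> pt m a u (b \<oplus>\<^bsub>A\<^esub> b') = pt m a u b \<oplus>\<^bsub>T m\<^esub> pt m a u b'"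
    and "c \<in> carrier R \<Longrightarrow> pt m (c \<odot>\<^bsub>A\<^esub> a) u b = c \<odot>\<^bsub>T m\<^esub> pt m a u b"
    and "c \<in> carrier R \<Longrightarrow> pt m a (c \<odot>\<^bsub>kQ m\<^esub> u) b = c \<odot>\<^bsub>T m\<^esub> pt m a u b"
    and "c \<in> carrier R \<Longrightarrow> pt m a u (c \<odot>\<^bsub>A\<^esub> b) = c \<odot>\<^bsub>T m\<^esub> pt m a u b"
    and "e \<in> carrier (kQ 0) \<Longrightarrow> pt m (a \<otimes>\<^bsub>A\<^esub> cl e) u b = pt m a (e \<otimes>\<^bsub>P\<^esub> u) b"
    and "e \<in> carrier (kQ 0) \<Longrightarrow> pt m a (u \<otimes>\<^bsub>P\<^esub> e) b = pt m a u (cl e \<otimes>\<^bsub>A\<^esub> b)"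
proof -
  note add = linear_map_add[OF T_class_linear, symmetric]
    and smult = linear_map_smult[OF T_class_linear, symmetric]
    and rel = T_class_eqI[OF tensor_relations_mem(1)] T_class_eqI[OF tensor_relations_mem(2)]
      T_class_eqI[OF tensor_relations_mem(3)] T_class_eqI[OF tensor_relations_mem(4)]
      T_class_eqI[OF tensor_relations_mem(5)] T_class_eqI[OF tensor_relations_mem(6)]
      T_class_eqI[OF tensor_relations_mem(7)] T_class_eqI[OF tensor_relations_mem(8)]
  show "pt m a u b \<in> carrier (T m)"
    unfolding pure_tensor_def by (rule linear_map_closed[OF T_class_linear]) simp
  show "a' \<in> carrier A \<Longrightarrow> pt m (a \<oplus>\<^bsub>A\<^esub> a') u b = pt m a u b \<oplus>\<^bsub>T m\<^esub> pt m a' u b"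
    unfolding pure_tensor_def by (subst add) (simp_all, rule rel(1), simp_all)
  show "u' \<in> carrier (kQ m) \<Longrightarrow> pt m a (u \<oplus>\<^bsub>kQ m\<^esub> u') b = pt m a u b \<oplus>\<^bsub>T m\<^esub> pt m a u' b"
    unfolding pure_tensor_def by (subst add) (simp_all, rule rel(2), simp_all)
  show "b' \<in> carrier A \<Longrightarrow> pt m a u (b \<oplus>\<^bsub>A\<^esub> b') = pt m a u b \<oplus>\<^bsub>T m\<^esub> pt m a u b'"
    unfolding pure_tensor_def by (subst add) (simp_all, rule rel(3), simp_all)
  show "c \<in> carrier R \<Longrightarrow> pt m (c \<odot>\<^bsub>A\<^esub> a) u b = c \<odot>\<^bsub>T m\<^esub> pt m a u b"
    unfolding pure_tensor_def by (subst smult) (simp_all, rule rel(4), simp_all)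
  show "c \<in> carrier R \<Longrightarrow> pt m a (c \<odot>\<^bsub>kQ m\<^esub> u) b = c \<odot>\<^bsub>T m\<^esub> pt m a u b"
    unfolding pure_tensor_def by (subst smult) (simp_all, rule rel(5), simp_all)
  show "c \<in> carrier R \<Longrightarrow> pt m a u (c \<odot>\<^bsub>A\<^esub> b) = c \<odot>\<^bsub>T m\<^esub> pt m a u b"
    unfolding pure_tensor_def by (subst smult) (simp_all, rule rel(6), simp_all)
  show "e \<in> carrier (kQ 0) \<Longrightarrow> pt m (a \<otimes>\<^bsub>A\<^esub> cl e) u b = pt m a (e \<otimes>\<^bsub>P\<^esub> u) b"
    unfolding pure_tensor_def by (rule rel(7)) (simp_all add: kQ_0_mult)
  show "e \<in> carrier (kQ 0) \<Longrightarrow> pt m a (u \<otimes>\<^bsub>P\<^esub> e) b = pt m a u (cl e \<otimes>\<^bsub>A\<^esub> b)"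
    unfolding pure_tensor_def by (rule rel(8)) (simp_all add: kQ_0_mult)
qed

lemma pt_balanced: "balanced m (T m) (pt m)"
  by (intro balancedI linear_mapI) (simp_all only: pt_laws)

lemmas pt_linear_left = balanced_linear_left[OF pt_balanced]
  and pt_linear_mid = balanced_linear_mid[OF pt_balanced]
  and pt_linear_right = balanced_linear_right[OF pt_balanced]
  and pt_left = balanced_left[OF pt_balanced]
  and pt_right = balanced_right[OF pt_balanced]
  and pt_closed [simp] = balanced_closed[OF pt_balanced]

context
  fixes m :: nat and M :: "('k, 'm, 's) module_scheme" and g
  assumes M: "Module.module R M" and g: "balanced m M g"
begin

interpretation M: Module.module R M by (rule M)

lemma tensor_lift_wf:
  "rels m \<subseteq> carrier (free_module R (carrier A \<times> carrier (kQ m) \<times> carrier A))"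
  "z \<in> carrier A \<times> carrier (kQ m) \<times> carrier A \<Longrightarrow> (case z of (x, u, y) \<Rightarrow> g x u y) \<in> carrier M"
  using rels_closed balanced_closed[OF g] by (auto simp: triple_module_def)

text \<open>Each relation is a difference of two elements with the same image, by trilinearity for
  the first six families and by balancedness over \<open>E\<close> for the last two.\<close>

lemma tensor_lift_relations:
  assumes "s \<in> rels m"
  shows "linear_ext R M (\<lambda>(x, u, y). g x u y) s = \<zero>\<^bsub>M\<^esub>"
proof -
  have lin: "linear_map R (F m) M (linear_ext R M (\<lambda>(x, u, y). g x u y))"
    unfolding triple_module_def by (rule M.linear_ext_linear[OF tensor_lift_wf(2)])
  have basis: "linear_ext R M (\<lambda>(x, u, y). g x u y) (basis_vec R (a, u, b)) = g a u b"
    if "a \<in> carrier A" "u \<in> carrier (kQ m)" "b \<in> carrier A" for a u b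
    using that by (subst M.linear_ext_basis_vec) (auto intro: balanced_closed[OF g])
  note [simp] = linear_map_minus[OF F_module M lin] linear_map_add[OF lin] linear_map_smult[OF lin]
    basis kQ_0_mult balanced_left[OF g] balanced_right[OF g] balanced_closed[OF g]
    linear_map_add[OF balanced_linear_left[OF g]] linear_map_smult[OF balanced_linear_left[OF g]]
    linear_map_add[OF balanced_linear_mid[OF g]] linear_map_smult[OF balanced_linear_mid[OF g]]
    linear_map_add[OF balanced_linear_right[OF g]] linear_map_smult[OF balanced_linear_right[OF g]]
    M.M.r_neg M.M.minus_eq
  have "rels m \<subseteq> {s. linear_ext R M (\<lambda>(x, u, y). g x u y) s = \<zero>\<^bsub>M\<^esub>}"
    unfolding tensor_relations_def Let_def
    by (intro Un_least subsetI; elim CollectE exE conjE; hypsubst) simp_all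
  then show ?thesis using assms by blast
qed

lemma tensor_lift_pt:
  assumes "a \<in> carrier A" and "u \<in> carrier (kQ m)" and "b \<in> carrier A"
  shows "tensor_lift R M (\<lambda>(x, u, y). g x u y) (pt m a u b) = g a u b"
proof -
  have "tensor_lift R M (\<lambda>(x, u, y). g x u y) (pt m a u b)
      = linear_ext R M (\<lambda>(x, u, y). g x u y) (basis_vec R (a, u, b))"
    unfolding pure_tensor_def triple_module_def
    using assms by (intro tensor_lift_coset[OF M tensor_lift_wf tensor_lift_relations]) (auto intro: basis_vec_closed)
  then show ?thesis
    using assms balanced_closed[OF g] by (simp add: M.linear_ext_basis_vec)
qed

lemma tensor_lift_linear_map: "linear_map R (T m) M (tensor_lift R M (\<lambda>(x, u, y). g x u y))"
  unfolding tensor_module_def triple_module_def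
  by (rule tensor_lift_linear[OF M tensor_lift_wf tensor_lift_relations])

end

subsection \<open>The bimodule structure\<close>

lemma pt_act_balanced:
  assumes a: "a \<in> carrier A" and b: "b \<in> carrier A"
  shows "balanced m (T m) (\<lambda>x u y. pt m (a \<otimes>\<^bsub>A\<^esub> x) u (y \<otimes>\<^bsub>A\<^esub> b))"
  using a b
  by (intro balancedI linear_map_comp[OF A.mult_left_linear pt_linear_left]
      linear_map_comp[OF A.mult_right_linear pt_linear_right] pt_linear_mid)
    (simp_all add: pt_left[symmetric] pt_right A.m_assoc)

lemma act_eq:
  "act m a X b = tensor_lift R (T m) (\<lambda>(x, u, y). pt m (a \<otimes>\<^bsub>A\<^esub> x) u (y \<otimes>\<^bsub>A\<^esub> b)) X"
  by (simp add: bimod_act_def Let_def)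

lemma act_pt [simp]:
  assumes "a \<in> carrier A" and "b \<in> carrier A"
    and "x \<in> carrier A" and "u \<in> carrier (kQ m)" and "y \<in> carrier A"
  shows "act m a (pt m x u y) b = pt m (a \<otimes>\<^bsub>A\<^esub> x) u (y \<otimes>\<^bsub>A\<^esub> b)"
  unfolding act_eq using assms by (intro tensor_lift_pt[OF T.module_axioms pt_act_balanced])

lemma act_linear_mid:
  "\<lbrakk>a \<in> carrier A; b \<in> carrier A\<rbrakk> \<Longrightarrow> linear_map R (T m) (T m) (\<lambda>X. act m a X b)"
  unfolding act_eq by (rule tensor_lift_linear_map[OF T.module_axioms pt_act_balanced])

lemma act_closed [simp]:
  "\<lbrakk>a \<in> carrier A; X \<in> carrier (T m); b \<in> carrier A\<rbrakk> \<Longrightarrow> act m a X b \<in> carrier (T m)"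
  by (rule linear_map_closed[OF act_linear_mid])

lemma linear_map_smult_left:
  assumes "c \<in> carrier R" and f: "linear_map R (T m) (T n) f"
  shows "linear_map R (T m) (T n) (\<lambda>X. c \<odot>\<^bsub>T n\<^esub> f X)"
  using assms
  by (intro linear_mapI)
    (simp_all add: linear_map_closed[OF f] linear_map_add[OF f] linear_map_smult[OF f]
      T.smult_r_distr T.smult_assoc1[symmetric] m_comm)

lemma act_linear_left:
  assumes X: "X \<in> carrier (T m)" and b: "b \<in> carrier A"
  shows "linear_map R A (T m) (\<lambda>a. act m a X b)"
proof (rule linear_mapI)
  fix a a' assume a: "a \<in> carrier A" and a': "a' \<in> carrier A"
  show "act m (a \<oplus>\<^bsub>A\<^esub> a') X b = act m a X b \<oplus>\<^bsub>T m\<^esub> act m a' X b"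
    using X by (rule T_linear_eqI[OF T.module_axioms, rotated 3])
      (use a a' b in \<open>auto intro!: act_linear_mid linear_map_plus[OF T.module_axioms]
        simp: A.l_distr linear_map_add[OF pt_linear_left]\<close>)
next
  fix c a assume c: "c \<in> carrier R" and a: "a \<in> carrier A"
  show "act m (c \<odot>\<^bsub>A\<^esub> a) X b = c \<odot>\<^bsub>T m\<^esub> act m a X b"
    using X by (rule T_linear_eqI[OF T.module_axioms, rotated 3])
      (use a b c in \<open>auto intro!: act_linear_mid linear_map_smult_left
        simp: A.smult_mult_left linear_map_smult[OF pt_linear_left]\<close>)
qed (use X b in simp)

lemma act_linear_right:
  assumes X: "X \<in> carrier (T m)" and a: "a \<in> carrier A"
  shows "linear_map R A (T m) (\<lambda>b. act m a X b)"
proof (rule linear_mapI)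
  fix b b' assume b: "b \<in> carrier A" and b': "b' \<in> carrier A"
  show "act m a X (b \<oplus>\<^bsub>A\<^esub> b') = act m a X b \<oplus>\<^bsub>T m\<^esub> act m a X b'"
    using X by (rule T_linear_eqI[OF T.module_axioms, rotated 3])
      (use a b b' in \<open>auto intro!: act_linear_mid linear_map_plus[OF T.module_axioms]
        simp: A.r_distr linear_map_add[OF pt_linear_right]\<close>)
next
  fix c b assume c: "c \<in> carrier R" and b: "b \<in> carrier A"
  show "act m a X (c \<odot>\<^bsub>A\<^esub> b) = c \<odot>\<^bsub>T m\<^esub> act m a X b"
    using X by (rule T_linear_eqI[OF T.module_axioms, rotated 3])
      (use a b c in \<open>auto intro!: act_linear_mid linear_map_smult_left
        simp: A.smult_mult_right linear_map_smult[OF pt_linear_right]\<close>)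
qed (use X a in simp)

lemma act_act:
  assumes "a \<in> carrier A" "a' \<in> carrier A" "b \<in> carrier A" "b' \<in> carrier A"
    and X: "X \<in> carrier (T m)"
  shows "act m a (act m a' X b') b = act m (a \<otimes>\<^bsub>A\<^esub> a') X (b' \<otimes>\<^bsub>A\<^esub> b)"
  using X by (rule T_linear_eqI[OF T.module_axioms, rotated 3])
    (use assms in \<open>auto intro!: act_linear_mid linear_map_comp[OF act_linear_mid act_linear_mid]
      simp: A.m_assoc\<close>)

lemma act_one:
  assumes X: "X \<in> carrier (T m)"
  shows "act m \<one>\<^bsub>A\<^esub> X \<one>\<^bsub>A\<^esub> = X"
proof (rule T_linear_eqI[OF T.module_axioms _ _ _ X])
  show "linear_map R (T m) (T m) (\<lambda>X. act m \<one>\<^bsub>A\<^esub> X \<one>\<^bsub>A\<^esub>)"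
    by (intro act_linear_mid A.one_closed)
  show "linear_map R (T m) (T m) (\<lambda>X. X)"
    by (rule linear_mapI) (rule refl | assumption)+
  show "act m \<one>\<^bsub>A\<^esub> (pt m a u b) \<one>\<^bsub>A\<^esub> = pt m a u b"
    if "a \<in> carrier A" "u \<in> carrier (kQ m)" "b \<in> carrier A" for a u b
    using that by simp
qed

subsection \<open>Bimodule maps out of the tensor product\<close>

text \<open>On \<open>kQ m\<close> the subalgebra \<open>E\<close> acts inside the path algebra, on
  the target through the outer factors in \<open>A\<close>; hence the passage from \<open>e\<close>
  to \<open>cl e\<close>.\<close>

definition E_bilinear ::
  "nat \<Rightarrow> nat \<Rightarrow> ((('v, 'e) path \<Rightarrow> 'k) \<Rightarrow> ('v, 'e, 'k) tensor) \<Rightarrow> bool" where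
  "E_bilinear m n g \<longleftrightarrow> linear_map R (kQ m) (T n) g \<and>
     (\<forall>e\<in>carrier (kQ 0). \<forall>u\<in>carrier (kQ m).
        g (e \<otimes>\<^bsub>P\<^esub> u) = act n (cl e) (g u) \<one>\<^bsub>A\<^esub> \<and> g (u \<otimes>\<^bsub>P\<^esub> e) = act n \<one>\<^bsub>A\<^esub> (g u) (cl e))"

definition bimod_ext ::
  "nat \<Rightarrow> ((('v, 'e) path \<Rightarrow> 'k) \<Rightarrow> ('v, 'e, 'k) tensor) \<Rightarrow> ('v, 'e, 'k) tensor \<Rightarrow> ('v, 'e, 'k) tensor" where
  "bimod_ext n g = tensor_lift R (T n) (\<lambda>(x, u, y). act n x (g u) y)"

lemma E_bilinear_balanced:
  assumes "E_bilinear m n g"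
  shows "balanced m (T n) (\<lambda>x u y. act n x (g u) y)"
proof -
  have lin: "linear_map R (kQ m) (T n) g"
    and bil: "\<And>e u. \<lbrakk>e \<in> carrier (kQ 0); u \<in> carrier (kQ m)\<rbrakk> \<Longrightarrow> g (e \<otimes>\<^bsub>P\<^esub> u) = act n (cl e) (g u) \<one>\<^bsub>A\<^esub>"
      "\<And>e u. \<lbrakk>e \<in> carrier (kQ 0); u \<in> carrier (kQ m)\<rbrakk> \<Longrightarrow> g (u \<otimes>\<^bsub>P\<^esub> e) = act n \<one>\<^bsub>A\<^esub> (g u) (cl e)"
    using assms by (auto simp: E_bilinear_def)
  show ?thesis
    by (intro balancedI linear_map_comp[OF lin act_linear_mid] act_linear_left act_linear_right)
      (simp_all add: linear_map_closed[OF lin] bil act_act)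
qed

lemma bimod_ext_pt:
  "\<lbrakk>E_bilinear m n g; a \<in> carrier A; u \<in> carrier (kQ m); b \<in> carrier A\<rbrakk>
    \<Longrightarrow> bimod_ext n g (pt m a u b) = act n a (g u) b"
  unfolding bimod_ext_def by (rule tensor_lift_pt[OF T.module_axioms E_bilinear_balanced])

lemma bimod_ext_linear: "E_bilinear m n g \<Longrightarrow> linear_map R (T m) (T n) (bimod_ext n g)"
  unfolding bimod_ext_def by (rule tensor_lift_linear_map[OF T.module_axioms E_bilinear_balanced])

lemma bimod_ext_act:
  assumes g: "E_bilinear m n g" and a: "a \<in> carrier A" and b: "b \<in> carrier A"
    and X: "X \<in> carrier (T m)"
  shows "bimod_ext n g (act m a X b) = act n a (bimod_ext n g X) b"
proof (rule T_linear_eqI[OF T.module_axioms _ _ _ X])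
  show "linear_map R (T m) (T n) (\<lambda>X. bimod_ext n g (act m a X b))"
    using a b by (intro linear_map_comp[OF act_linear_mid bimod_ext_linear[OF g]])
  show "linear_map R (T m) (T n) (\<lambda>X. act n a (bimod_ext n g X) b)"
    using a b by (intro linear_map_comp[OF bimod_ext_linear[OF g] act_linear_mid])
  have gc: "u \<in> carrier (kQ m) \<Longrightarrow> g u \<in> carrier (T n)" for u
    using g by (auto simp: E_bilinear_def dest: linear_map_closed)
  show "bimod_ext n g (act m a (pt m x u y) b) = act n a (bimod_ext n g (pt m x u y)) b"
    if "x \<in> carrier A" "u \<in> carrier (kQ m)" "y \<in> carrier A" for x u y
    using that a b by (simp add: bimod_ext_pt[OF g] gc act_act)
qed

section \<open>The maps \<open>\<Delta>\<close>\<close>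

abbreviation "\<Delta> \<equiv> Delta R Q N"

lemma one_in_kQ: "\<one>\<^bsub>P\<^esub> \<in> carrier (kQ 0)"
  using P.one_closed by (auto simp: kQ_len_def path_algebra_simps free_module_simps)

lemma cl_kQ_closed [simp]: "x \<in> carrier (kQ m) \<Longrightarrow> cl x \<in> carrier A"
  by simp

lemma pt_zero [simp]:
  assumes "u \<in> carrier (kQ m)" and "a \<in> carrier A"
  shows "pt m \<zero>\<^bsub>A\<^esub> u a = \<zero>\<^bsub>T m\<^esub>" and "pt m a u \<zero>\<^bsub>A\<^esub> = \<zero>\<^bsub>T m\<^esub>"
  using linear_map_zero[OF A.module_axioms T.module_axioms pt_linear_left[OF assms]]
    linear_map_zero[OF A.module_axioms T.module_axioms pt_linear_right[OF assms(2,1)]] by simp_all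

lemma subpath_basis_in_kQ:
  "\<lbrakk>w \<in> paths Q; i \<le> j; j \<le> path_length w; m = j - i\<rbrakk> \<Longrightarrow> bv (subpath Q w i j) \<in> carrier (kQ m)"
  by (simp add: basis_in_kQ subpath_in_paths_of_length)

lemma subpath_basis_closed [simp]:
  "\<lbrakk>w \<in> paths Q; i \<le> j; j \<le> path_length w\<rbrakk> \<Longrightarrow> bv (subpath Q w i j) \<in> carrier P"
  by (simp add: basis_closed subpath_in_paths)

lemma split_tensor_closed:
  "\<lbrakk>w \<in> paths Q; n + m \<le> path_length w\<rbrakk> \<Longrightarrow> split_tensor R Q N n m w \<in> carrier (T m)"
  unfolding split_tensor_def by (intro pt_closed) (simp_all add: subpath_basis_in_kQ)

lemma Delta_linear: "linear_map R P (T m) (\<Delta> n m)"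
  unfolding Delta_def linear_map_path_algebra
  by (rule T.linear_ext_linear) (simp add: split_tensor_closed)

lemma Delta_closed [simp]: "f \<in> carrier P \<Longrightarrow> \<Delta> n m f \<in> carrier (T m)"
  by (rule linear_map_closed[OF Delta_linear])

lemma Delta_basis:
  assumes "w \<in> paths Q"
  shows "\<Delta> n m (bv w) = (if path_length w < n + m then \<zero>\<^bsub>T m\<^esub> else split_tensor R Q N n m w)"
  unfolding Delta_def using assms
  by (subst T.linear_ext_basis_vec) (simp_all add: split_tensor_closed)

lemma zero_linear: "linear_map R (kQ p) (T m) (\<lambda>_. \<zero>\<^bsub>T m\<^esub>)"
  by (rule linear_mapI) simp_all

text \<open>A path of length \<open>p\<close> is cut into outer factors of lengths \<open>n\<close>
  and \<open>p - n - m\<close>. One of them is at least \<open>N\<close>, hence zero in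
  \<open>A\<close>, unless the path is too short to be cut, where \<open>Delta\<close> is zero by
  convention.\<close>

lemma Delta_vanish:
  assumes "f \<in> carrier (kQ p)" and "N \<le> n \<or> N + n + m \<le> p"
  shows "\<Delta> n m f = \<zero>\<^bsub>T m\<^esub>"
proof (rule kQ_linear_eqI[OF T.module_axioms linear_map_kQ[OF Delta_linear] zero_linear _ assms(1)])
  fix w assume "w \<in> paths_of_length Q p"
  then have w: "w \<in> paths Q" "path_length w = p" by (simp_all add: paths_of_length_def)
  show "\<Delta> n m (bv w) = \<zero>\<^bsub>T m\<^esub>"
  proof (cases "p < n + m")
    case False
    then have "cl (bv (subpath Q w 0 n)) = \<zero>\<^bsub>A\<^esub> \<or> cl (bv (subpath Q w (n + m) p)) = \<zero>\<^bsub>A\<^esub>"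
      using w assms(2) by (auto intro!: cl_basis_long simp: subpath_in_paths subpath_length)
    then show ?thesis
      using False w by (auto simp: Delta_basis split_tensor_def subpath_basis_in_kQ)
  qed (use w in \<open>simp add: Delta_basis\<close>)
qed

lemma vertex_mult:
  assumes "v \<in> verts Q" and "w \<in> paths Q"
  shows "bv (v, [], v) \<otimes>\<^bsub>P\<^esub> bv w = (if v = source w then bv w else \<zero>\<^bsub>P\<^esub>)"
    and "bv w \<otimes>\<^bsub>P\<^esub> bv (v, [], v) = (if v = target w then bv w else \<zero>\<^bsub>P\<^esub>)"
  using assms by (auto simp: basis_mult_comp basis_mult_zero trivial_path_in_paths)

lemma vertex_in_kQ: "v \<in> verts Q \<Longrightarrow> bv (v, [], v) \<in> carrier (kQ 0)"
  by (intro basis_in_kQ) (auto simp: paths_of_length_0)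

text \<open>Insert the vertex at the source or the target of \<open>u\<close> and move it across the
  tensor sign: it fixes \<open>u\<close> but kills the outer path that does not meet it.\<close>

lemma pt_basis_zero:
  assumes "a \<in> paths Q" and "u \<in> paths_of_length Q m" and "b \<in> paths Q"
    and "target a \<noteq> source u \<or> target u \<noteq> source b"
  shows "pt m (cl (bv a)) (bv u) (cl (bv b)) = \<zero>\<^bsub>T m\<^esub>"
proof -
  have u: "u \<in> paths Q" "bv u \<in> carrier (kQ m)"
    using assms(2) by (auto simp: paths_of_length_def intro: basis_in_kQ)
  note v = source_target_in_verts[OF u(1)]
  have left: "pt m (cl (bv a)) (bv u) (cl (bv b)) = pt m (cl (bv a \<otimes>\<^bsub>P\<^esub> bv (source u, [], source u))) (bv u) (cl (bv b))"
    using assms u v pt_left[of "cl (bv a)" "bv (source u, [], source u)" "bv u" m "cl (bv b)"]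
    by (simp add: vertex_in_kQ cl_mult basis_closed vertex_mult(1) trivial_path_in_paths)
  have right: "pt m (cl (bv a)) (bv u) (cl (bv b)) = pt m (cl (bv a)) (bv u) (cl (bv (target u, [], target u) \<otimes>\<^bsub>P\<^esub> bv b))"
    using assms u v pt_right[of "cl (bv a)" "bv (target u, [], target u)" "bv u" m "cl (bv b)"]
    by (simp add: vertex_in_kQ cl_mult basis_closed vertex_mult(2) trivial_path_in_paths)
  show ?thesis
  proof (cases "target a = source u")
    case True
    then show ?thesis
      unfolding right using assms u v by (simp add: vertex_mult(1) cl_zero basis_closed)
  next
    case False
    then show ?thesis
      unfolding left using assms u v by (subst vertex_mult(2)) (auto simp: cl_zero basis_closed)
  qed
qed

text \<open>If the paths compose, the lengths \<open>n\<close> and \<open>m\<close> determine where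
  the composite is cut, and cutting returns the three factors. If they do not, both sides vanish.
  The right factor is whatever remains, so \<open>g\<close> may be inhomogeneous. Linearity extends
  this from paths, in the order \<open>g\<close>, \<open>u\<close>, \<open>f\<close>.\<close>

lemma pt_eq_Delta:
  assumes f: "f \<in> carrier (kQ n)" and u: "u \<in> carrier (kQ m)" and g: "g \<in> carrier P"
  shows "pt m (cl f) u (cl g) = \<Delta> n m (f \<otimes>\<^bsub>P\<^esub> u \<otimes>\<^bsub>P\<^esub> g)"
proof -
  have basis: "pt m (cl (bv a)) (bv v) (cl (bv b)) = \<Delta> n m (bv a \<otimes>\<^bsub>P\<^esub> bv v \<otimes>\<^bsub>P\<^esub> bv b)"
    if "a \<in> paths_of_length Q n" "v \<in> paths_of_length Q m" "b \<in> paths Q" for a v b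
  proof -
    have p: "a \<in> paths Q" "v \<in> paths Q" "path_length a = n" "path_length v = m"
      using that by (auto simp: paths_of_length_def)
    show ?thesis
    proof (cases "target a = source v \<and> target v = source b")
      case True
      let ?w = "path_comp a (path_comp v b)"
      have vb: "path_comp v b \<in> paths Q" using p True that by (simp add: path_comp_in_paths)
      have w: "?w \<in> paths Q" using p True vb by (simp add: path_comp_in_paths)
      have "subpath Q ?w 0 n = a"
        using subpath_comp_left[of a "path_comp v b" 0 n] p True vb subpath_full[of a] by simp
      moreover have "subpath Q ?w n (n + m) = v"
        using subpath_comp_right[of a "path_comp v b" 0 m] subpath_comp_left[of v b 0 m]
          p True vb that subpath_full[of v] by simp
      moreover have "subpath Q ?w (n + m) (path_length ?w) = b"
        using subpath_comp_right[of "path_comp a v" b 0 "path_length b"] path_comp_in_paths[of a v]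
          p True that subpath_full[of b] by (simp add: add.assoc)
      ultimately show ?thesis
        using p True that w by (simp add: basis_mult_comp path_comp_in_paths Delta_basis split_tensor_def)
    next
      case False
      then have "bv a \<otimes>\<^bsub>P\<^esub> bv v \<otimes>\<^bsub>P\<^esub> bv b = \<zero>\<^bsub>P\<^esub>"
        using p that by (cases "target a = source v")
          (auto simp: basis_mult_zero basis_mult_comp path_comp_in_paths basis_closed)
      then show ?thesis
        using False p that linear_map_zero[OF P.module_axioms T.module_axioms Delta_linear]
        by (auto simp: pt_basis_zero)
    qed
  qed
  note lin = linear_map_comp[OF _ Delta_linear]
  have 1: "pt m (cl (bv a)) (bv v) (cl g) = \<Delta> n m (bv a \<otimes>\<^bsub>P\<^esub> bv v \<otimes>\<^bsub>P\<^esub> g)"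
    if "a \<in> paths_of_length Q n" "v \<in> paths_of_length Q m" for a v
    using that basis_in_kQ[OF that(1)] basis_in_kQ[OF that(2)]
    by (intro P_linear_eqI[OF T.module_axioms linear_map_comp[OF cl_linear pt_linear_right]
          lin[OF P.mult_left_linear] _ g] basis) auto
  have 2: "pt m (cl (bv a)) u (cl g) = \<Delta> n m (bv a \<otimes>\<^bsub>P\<^esub> u \<otimes>\<^bsub>P\<^esub> g)"
    if "a \<in> paths_of_length Q n" for a
    using that basis_in_kQ[OF that(1)] g
    by (intro kQ_linear_eqI[OF T.module_axioms pt_linear_mid
          lin[OF linear_map_comp[OF linear_map_kQ[OF P.mult_left_linear] P.mult_right_linear]] _ u] 1) auto
  show ?thesis
    using u g
    by (intro kQ_linear_eqI[OF T.module_axioms linear_map_comp[OF linear_map_kQ[OF cl_linear] pt_linear_left]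
          lin[OF linear_map_comp[OF linear_map_kQ[OF P.mult_right_linear] P.mult_right_linear]] _ f] 2) auto
qed

lemma Delta_basis_pt:
  assumes "w \<in> paths Q" and "n + m \<le> path_length w"
  shows "\<Delta> n m (bv w) = pt m (cl (bv (subpath Q w 0 n))) (bv (subpath Q w n (n + m)))
     (cl (bv (subpath Q w (n + m) (path_length w))))"
  using assms by (simp add: Delta_basis split_tensor_def)

lemma subpath_mult3:
  assumes "w \<in> paths Q" and "i \<le> j" and "j \<le> path_length w"
  shows "bv (subpath Q w 0 i) \<otimes>\<^bsub>P\<^esub> bv (subpath Q w i j) \<otimes>\<^bsub>P\<^esub> bv (subpath Q w j (path_length w)) = bv w"
  using assms by (simp add: subpath_mult subpath_full)

text \<open>A left factor of length \<open>p\<close> moves the cut by \<open>p\<close> places, and a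
  right factor does not move it. The bound excludes paths on which \<open>Delta\<close> is zero by
  convention although their longer product can be cut.\<close>

lemma act_Delta:
  assumes h: "h \<in> carrier (kQ p)" and f: "f \<in> carrier (kQ q)" and "n + m \<le> q" and g: "g \<in> carrier P"
  shows "act m (cl h) (\<Delta> n m f) (cl g) = \<Delta> (p + n) m (h \<otimes>\<^bsub>P\<^esub> f \<otimes>\<^bsub>P\<^esub> g)"
proof (rule kQ_linear_eqI[OF T.module_axioms _ _ _ f])
  show "linear_map R (kQ q) (T m) (\<lambda>f. act m (cl h) (\<Delta> n m f) (cl g))"
    using h g by (intro linear_map_comp[OF linear_map_kQ[OF Delta_linear] act_linear_mid]) auto
  show "linear_map R (kQ q) (T m) (\<lambda>f. \<Delta> (p + n) m (h \<otimes>\<^bsub>P\<^esub> f \<otimes>\<^bsub>P\<^esub> g))"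
    using h g by (intro linear_map_kQ linear_map_comp[OF linear_map_comp[OF P.mult_left_linear P.mult_right_linear]
          Delta_linear]) auto
  fix w assume "w \<in> paths_of_length Q q"
  then have w: "w \<in> paths Q" "path_length w = q" by (simp_all add: paths_of_length_def)
  define a b c where abc: "a = bv (subpath Q w 0 n)" "b = bv (subpath Q w n (n + m))"
    "c = bv (subpath Q w (n + m) q)"
  have k: "a \<in> carrier (kQ n)" "b \<in> carrier (kQ m)" "c \<in> carrier P"
    using w assms(3) by (simp_all add: abc subpath_basis_in_kQ)
  have "act m (cl h) (\<Delta> n m (bv w)) (cl g) = pt m (cl (h \<otimes>\<^bsub>P\<^esub> a)) b (cl (c \<otimes>\<^bsub>P\<^esub> g))"
    using k w assms by (simp add: Delta_basis_pt abc[symmetric] cl_mult)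
  also have "\<dots> = \<Delta> (p + n) m (h \<otimes>\<^bsub>P\<^esub> a \<otimes>\<^bsub>P\<^esub> b \<otimes>\<^bsub>P\<^esub> (c \<otimes>\<^bsub>P\<^esub> g))"
    using k g h by (intro pt_eq_Delta kQ_mult) auto
  also have "h \<otimes>\<^bsub>P\<^esub> a \<otimes>\<^bsub>P\<^esub> b \<otimes>\<^bsub>P\<^esub> (c \<otimes>\<^bsub>P\<^esub> g) = h \<otimes>\<^bsub>P\<^esub> (a \<otimes>\<^bsub>P\<^esub> b \<otimes>\<^bsub>P\<^esub> c) \<otimes>\<^bsub>P\<^esub> g"
    using k g h by (simp add: P.m_assoc)
  also have "a \<otimes>\<^bsub>P\<^esub> b \<otimes>\<^bsub>P\<^esub> c = bv w"
    using subpath_mult3[of w n "n + m"] w assms(3) by (simp add: abc)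
  finally show "act m (cl h) (\<Delta> n m (bv w)) (cl g) = \<Delta> (p + n) m (h \<otimes>\<^bsub>P\<^esub> bv w \<otimes>\<^bsub>P\<^esub> g)" .
qed

text \<open>Elements of \<open>E\<close> have length 0, so by \<open>act_Delta\<close> multiplying
  with them does not move the cut.\<close>

lemma Delta_E_bilinear:
  assumes lin: "linear_map R (kQ m) (kQ q) \<phi>" and "n + m' \<le> q"
    and bil: "\<And>e u. \<lbrakk>e \<in> carrier (kQ 0); u \<in> carrier (kQ m)\<rbrakk>
      \<Longrightarrow> \<phi> (e \<otimes>\<^bsub>P\<^esub> u) = e \<otimes>\<^bsub>P\<^esub> \<phi> u \<and> \<phi> (u \<otimes>\<^bsub>P\<^esub> e) = \<phi> u \<otimes>\<^bsub>P\<^esub> e"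
  shows "E_bilinear m m' (\<lambda>u. \<Delta> n m' (\<phi> u))"
  unfolding E_bilinear_def
proof (intro conjI ballI linear_map_comp[OF lin linear_map_kQ[OF Delta_linear]])
  fix e u assume e: "e \<in> carrier (kQ 0)" and u: "u \<in> carrier (kQ m)"
  note \<phi> = linear_map_closed[OF lin u]
  show "\<Delta> n m' (\<phi> (e \<otimes>\<^bsub>P\<^esub> u)) = act m' (cl e) (\<Delta> n m' (\<phi> u)) \<one>\<^bsub>A\<^esub>"
    using act_Delta[OF e \<phi> assms(2) P.one_closed] e \<phi> bil[OF e u] by (simp add: cl_one)
  show "\<Delta> n m' (\<phi> (u \<otimes>\<^bsub>P\<^esub> e)) = act m' \<one>\<^bsub>A\<^esub> (\<Delta> n m' (\<phi> u)) (cl e)"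
    using act_Delta[OF one_in_kQ \<phi> assms(2), of e] e \<phi> bil[OF e u] by (simp add: cl_one)
qed

lemma E_bilinear_add:
  assumes g: "E_bilinear m n g" and h: "E_bilinear m n h"
  shows "E_bilinear m n (\<lambda>u. g u \<oplus>\<^bsub>T n\<^esub> h u)"
  using g h unfolding E_bilinear_def
  by (auto intro!: linear_map_plus T.module_axioms simp: linear_map_add[OF act_linear_mid] linear_map_closed)

lemma E_bilinear_zero: "E_bilinear m n (\<lambda>_. \<zero>\<^bsub>T n\<^esub>)"
  unfolding E_bilinear_def
  by (auto simp: zero_linear linear_map_zero[OF T.module_axioms T.module_axioms act_linear_mid])

lemma E_bilinear_cong:
  assumes "E_bilinear m n g" and "\<And>u. u \<in> carrier (kQ m) \<Longrightarrow> h u = g u"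
  shows "E_bilinear m n h"
  using assms linear_map_cong[OF kQ_module, of m "T n" g h] unfolding E_bilinear_def
  by (simp add: kQ_0_mult)

lemma E_bilinear_closed: "\<lbrakk>E_bilinear m n g; u \<in> carrier (kQ m)\<rbrakk> \<Longrightarrow> g u \<in> carrier (T n)"
  by (auto simp: E_bilinear_def dest: linear_map_closed)

lemma E_bilinear_finsum:
  assumes "finite S" and "\<And>i. i \<in> S \<Longrightarrow> E_bilinear m n (g i)"
  shows "E_bilinear m n (\<lambda>u. \<Oplus>\<^bsub>T n\<^esub> i\<in>S. g i u)"
  using assms
proof (induction S)
  case empty
  then show ?case by (simp add: E_bilinear_zero)
next
  case (insert i S)
  have "E_bilinear m n (\<lambda>u. g i u \<oplus>\<^bsub>T n\<^esub> (\<Oplus>\<^bsub>T n\<^esub> i\<in>S. g i u))"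
    using insert by (intro E_bilinear_add) auto
  moreover have "g j u \<in> carrier (T n)" if "j \<in> insert i S" "u \<in> carrier (kQ m)" for j u
    using that by (intro E_bilinear_closed[OF insert.prems])
  ultimately show ?case
    by (elim E_bilinear_cong) (use insert.hyps in \<open>simp add: Pi_def\<close>)
qed

lemma E_bilinear_minus:
  assumes g: "E_bilinear m n g" and h: "E_bilinear m n h"
  shows "E_bilinear m n (\<lambda>u. g u \<ominus>\<^bsub>T n\<^esub> h u)"
proof -
  have "linear_map R (kQ m) (T n) (\<lambda>u. g u \<ominus>\<^bsub>T n\<^esub> h u)"
    using g h unfolding E_bilinear_def
    by (intro linear_mapI)
      (auto simp: linear_map_add linear_map_smult linear_map_closed a_minus_def T.M.minus_add
        T.M.a_ac T.smult_r_distr T.smult_r_minus)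
  then show ?thesis
    using g h E_bilinear_closed[OF g] E_bilinear_closed[OF h] unfolding E_bilinear_def
    by (auto simp: linear_map_minus[OF T.module_axioms T.module_axioms act_linear_mid])
qed

section \<open>The differential\<close>

text \<open>The differential at 1 \<otimes> u \<otimes> 1 in terms of \<open>Delta\<close>, for
  combinations of paths as well. In even degree a segment of length \<open>zeta N (i - 1)\<close>
  has \<open>N\<close> possible positions in a path of length \<open>zeta N i\<close>.\<close>

definition diff_gen :: "nat \<Rightarrow> (('v, 'e) path \<Rightarrow> 'k) \<Rightarrow> ('v, 'e, 'k) tensor" where
  "diff_gen i u = (let m' = zeta N (i - 1) in
     if even i then \<Oplus>\<^bsub>T m'\<^esub> j\<in>{..<N}. \<Delta> j m' u else \<Delta> 1 m' u \<ominus>\<^bsub>T m'\<^esub> \<Delta> 0 m' u)"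

context
  fixes i :: nat
  assumes i: "i \<ge> 1" and N: "N \<ge> 1"
begin

lemma zeta_step:
  "zeta N i = zeta N (i - 1) + (if even i then N - 1 else 1)"
proof (cases "even i")
  case True
  then obtain k where "i = 2 * Suc k" using i by (metis One_nat_def dvd_def le_zero_eq mult_0_right nat.simps(3) not0_implies_Suc)
  then show ?thesis using N by (simp add: zeta_def algebra_simps)
next
  case False
  then obtain k where "i = 2 * k + 1" by (elim oddE)
  then show ?thesis by (simp add: zeta_def)
qed

lemma diff_gen_E_bilinear: "E_bilinear (zeta N i) (zeta N (i - 1)) (diff_gen i)"
proof -
  let ?m = "zeta N i" and ?m' = "zeta N (i - 1)"
  have id: "linear_map R (kQ ?m) (kQ ?m) (\<lambda>u. u)" by (rule linear_mapI) (rule refl | assumption)+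
  have *: "E_bilinear ?m ?m' (\<lambda>u. \<Delta> j ?m' u)" if "j + ?m' \<le> ?m" for j
    using that by (rule Delta_E_bilinear[OF id]) simp
  show ?thesis
  proof (cases "even i")
    case True
    then have "E_bilinear ?m ?m' (\<lambda>u. \<Oplus>\<^bsub>T ?m'\<^esub> j\<in>{..<N}. \<Delta> j ?m' u)"
      using zeta_step by (intro E_bilinear_finsum *) auto
    then show ?thesis using True by (simp add: diff_gen_def[abs_def] Let_def)
  next
    case False
    then have "E_bilinear ?m ?m' (\<lambda>u. \<Delta> 1 ?m' u \<ominus>\<^bsub>T ?m'\<^esub> \<Delta> 0 ?m' u)"
      using zeta_step by (intro E_bilinear_minus *) auto
    then show ?thesis using False by (simp add: diff_gen_def[abs_def] Let_def)
  qed
qed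

lemma Br_diff_gen_eq:
  assumes "w \<in> paths_of_length Q (zeta N i)"
  shows "Br_diff_gen R Q N i w = diff_gen i (bv w)"
proof -
  let ?m = "zeta N i" and ?m' = "zeta N (i - 1)"
  have w: "w \<in> paths Q" "path_length w = ?m" using assms by (simp_all add: paths_of_length_def)
  show ?thesis
  proof (cases "even i")
    case True
    then have "{j. j + ?m' \<le> path_length w} = {..<N}" using zeta_step N w by auto
    moreover have "(\<Oplus>\<^bsub>T ?m'\<^esub> j\<in>{..<N}. split_tensor R Q N j ?m' w) = (\<Oplus>\<^bsub>T ?m'\<^esub> j\<in>{..<N}. \<Delta> j ?m' (bv w))"
      using True zeta_step w by (intro T.M.finsum_cong') (auto simp: Delta_basis basis_closed split_tensor_closed)
    ultimately show ?thesis
      using True by (simp add: Br_diff_gen_def diff_gen_def Let_def Br_def)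
  next
    case False
    let ?n = "path_length w"
    have n: "?n = Suc ?m'" and full: "subpath Q w 0 (zeta N i) = w"
      using False zeta_step w subpath_full[of w] by simp_all
    \<comment> \<open>The definition puts the unit of \<open>A\<close> where \<open>Delta\<close>
      produces the class of a trivial path; \<open>pt_eq_Delta\<close> with the unit of
      \<open>P\<close> as outer factor identifies the two.\<close>
    have "pt ?m' (cl (bv (subpath Q w 0 1))) (bv (subpath Q w 1 ?n)) \<one>\<^bsub>A\<^esub> = \<Delta> 1 ?m' (bv w)"
      using pt_eq_Delta[of "bv (subpath Q w 0 1)" 1 "bv (subpath Q w 1 ?n)" ?m' "\<one>\<^bsub>P\<^esub>"] w n
      by (simp add: subpath_basis_in_kQ cl_one subpath_mult full basis_closed)
    moreover have "pt ?m' \<one>\<^bsub>A\<^esub> (bv (subpath Q w 0 (?n - 1))) (cl (bv (subpath Q w (?n - 1) ?n))) = \<Delta> 0 ?m' (bv w)"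
      using pt_eq_Delta[of "\<one>\<^bsub>P\<^esub>" 0 "bv (subpath Q w 0 (?n - 1))" ?m' "bv (subpath Q w (?n - 1) ?n)"] w n
      by (simp add: subpath_basis_in_kQ cl_one subpath_mult full basis_closed one_in_kQ)
    ultimately show ?thesis
      using False by (simp add: Br_diff_gen_def diff_gen_def Let_def Br_def)
  qed
qed

lemma diff_ext_eq:
  assumes "u \<in> carrier (kQ (zeta N i))"
  shows "linear_ext R (T (zeta N (i - 1))) (Br_diff_gen R Q N i) u = diff_gen i u"
proof -
  have lin: "linear_map R (kQ (zeta N i)) (T (zeta N (i - 1))) (diff_gen i)"
    using diff_gen_E_bilinear by (simp add: E_bilinear_def)
  have closed: "diff_gen i (bv w) \<in> carrier (T (zeta N (i - 1)))"
    if "w \<in> paths_of_length Q (zeta N i)" for w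
    using that by (intro linear_map_closed[OF lin] basis_in_kQ)
  show ?thesis
  proof (rule kQ_linear_eqI[OF T.module_axioms _ lin _ assms])
    show "linear_map R (kQ (zeta N i)) (T (zeta N (i - 1)))
        (linear_ext R (T (zeta N (i - 1))) (Br_diff_gen R Q N i))"
      unfolding kQ_len_def by (rule T.linear_ext_linear) (simp add: Br_diff_gen_eq closed del: One_nat_def)
  qed (simp add: T.linear_ext_basis_vec Br_diff_gen_eq closed del: One_nat_def)
qed

lemma Br_diff_E_bilinear:
  "E_bilinear (zeta N i) (zeta N (i - 1)) (linear_ext R (T (zeta N (i - 1))) (Br_diff_gen R Q N i))"
  by (rule E_bilinear_cong[OF diff_gen_E_bilinear]) (rule diff_ext_eq)

lemma Br_diff_eq:
  "Br_diff R Q N i = bimod_ext (zeta N (i - 1)) (linear_ext R (T (zeta N (i - 1))) (Br_diff_gen R Q N i))"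
  by (simp add: Br_diff_def bimod_ext_def Br_def Let_def)

lemma Br_diff_linear: "linear_map R (T (zeta N i)) (T (zeta N (i - 1))) (Br_diff R Q N i)"
  unfolding Br_diff_eq by (rule bimod_ext_linear[OF Br_diff_E_bilinear])

lemma Br_diff_pt:
  "\<lbrakk>a \<in> carrier A; u \<in> carrier (kQ (zeta N i)); b \<in> carrier A\<rbrakk>
    \<Longrightarrow> Br_diff R Q N i (pt (zeta N i) a u b) = act (zeta N (i - 1)) a (diff_gen i u) b"
  unfolding Br_diff_eq by (simp add: bimod_ext_pt[OF Br_diff_E_bilinear] diff_ext_eq del: One_nat_def)

lemma Br_diff_act:
  "\<lbrakk>a \<in> carrier A; b \<in> carrier A; X \<in> carrier (T (zeta N i))\<rbrakk>
    \<Longrightarrow> Br_diff R Q N i (act (zeta N i) a X b) = act (zeta N (i - 1)) a (Br_diff R Q N i X) b"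
  unfolding Br_diff_eq by (rule bimod_ext_act[OF Br_diff_E_bilinear])

text \<open>The differential acts on the middle factor only, and the left factor of length
  \<open>n\<close> then raises every index by \<open>n\<close>. In odd degree this is a unit shift
  minus the unshifted term, the source of all telescoping below.\<close>

lemma Br_diff_Delta:
  assumes f: "f \<in> carrier (kQ q)" and q: "n + zeta N i \<le> q"
  shows "Br_diff R Q N i (\<Delta> n (zeta N i) f) = (let m' = zeta N (i - 1) in
     if even i then \<Oplus>\<^bsub>T m'\<^esub> j\<in>{..<N}. \<Delta> (n + j) m' f else \<Delta> (n + 1) m' f \<ominus>\<^bsub>T m'\<^esub> \<Delta> n m' f)"
proof -
  let ?m = "zeta N i" and ?m' = "zeta N (i - 1)"
  have basis: "act ?m' (cl a) (\<Delta> j ?m' u) (cl b) = \<Delta> (n + j) ?m' (bv w)"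
    if "j + ?m' \<le> ?m" and w: "w \<in> paths_of_length Q q" and
      abu: "a = bv (subpath Q w 0 n)" "u = bv (subpath Q w n (n + ?m))" "b = bv (subpath Q w (n + ?m) q)"
    for j w a u b
  proof -
    have w: "w \<in> paths Q" "path_length w = q" using w by (simp_all add: paths_of_length_def)
    have k: "a \<in> carrier (kQ n)" "u \<in> carrier (kQ ?m)" "b \<in> carrier P"
      using w q by (simp_all add: abu subpath_basis_in_kQ)
    have "a \<otimes>\<^bsub>P\<^esub> u \<otimes>\<^bsub>P\<^esub> b = bv w"
      using subpath_mult3[of w n "n + ?m"] w q by (simp add: abu)
    then show ?thesis
      using act_Delta[OF k(1,2) that(1) k(3)] by simp
  qed
  have lin: "linear_map R (kQ q) (T ?m') (\<lambda>f. Br_diff R Q N i (\<Delta> n ?m f))"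
    by (rule linear_map_comp[OF linear_map_kQ[OF Delta_linear] Br_diff_linear])
  have pt_form: "Br_diff R Q N i (\<Delta> n ?m (bv w)) = act ?m' (cl a) (diff_gen i u) (cl b)"
    if w: "w \<in> paths_of_length Q q" and
      abu: "a = bv (subpath Q w 0 n)" "u = bv (subpath Q w n (n + ?m))" "b = bv (subpath Q w (n + ?m) q)"
    for w a u b
    using w q by (simp add: abu paths_of_length_def Delta_basis_pt Br_diff_pt subpath_basis_in_kQ)
  show ?thesis
  proof (cases "even i")
    case True
    have "Br_diff R Q N i (\<Delta> n ?m f) = (\<Oplus>\<^bsub>T ?m'\<^esub> j\<in>{..<N}. \<Delta> (n + j) ?m' f)"
    proof (rule kQ_linear_eqI[OF T.module_axioms lin _ _ f])
      show "linear_map R (kQ q) (T ?m') (\<lambda>f. \<Oplus>\<^bsub>T ?m'\<^esub> j\<in>{..<N}. \<Delta> (n + j) ?m' f)"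
        by (intro finsum_linear_map kQ_module T.module_axioms linear_map_kQ[OF Delta_linear])
      fix w assume w: "w \<in> paths_of_length Q q"
      define a u b where abu: "a = bv (subpath Q w 0 n)" "u = bv (subpath Q w n (n + ?m))"
        "b = bv (subpath Q w (n + ?m) q)"
      have k: "a \<in> carrier P" "u \<in> carrier P" "b \<in> carrier P"
        using w q by (auto simp: abu paths_of_length_def)
      have "Br_diff R Q N i (\<Delta> n ?m (bv w)) = act ?m' (cl a) (\<Oplus>\<^bsub>T ?m'\<^esub> j\<in>{..<N}. \<Delta> j ?m' u) (cl b)"
        using True pt_form[OF w abu] by (simp add: diff_gen_def Let_def)
      also have "\<dots> = (\<Oplus>\<^bsub>T ?m'\<^esub> j\<in>{..<N}. act ?m' (cl a) (\<Delta> j ?m' u) (cl b))"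
        using k by (intro linear_map_finsum[OF T.module_axioms T.module_axioms act_linear_mid]) auto
      also have "\<dots> = (\<Oplus>\<^bsub>T ?m'\<^esub> j\<in>{..<N}. \<Delta> (n + j) ?m' (bv w))"
        using True zeta_step w by (intro T.M.finsum_cong' basis[OF _ w abu])
          (auto simp: basis_closed paths_of_length_def)
      finally show "Br_diff R Q N i (\<Delta> n ?m (bv w)) = (\<Oplus>\<^bsub>T ?m'\<^esub> j\<in>{..<N}. \<Delta> (n + j) ?m' (bv w))" .
    qed
    then show ?thesis using True by (simp add: Let_def)
  next
    case False
    \<comment> \<open>With the subtracted term moved to the left, both sides are sums of linear maps
      and can be compared on paths.\<close>
    have "Br_diff R Q N i (\<Delta> n ?m f) \<oplus>\<^bsub>T ?m'\<^esub> \<Delta> n ?m' f = \<Delta> (n + 1) ?m' f"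
    proof (rule kQ_linear_eqI[OF T.module_axioms linear_map_plus[OF T.module_axioms lin
            linear_map_kQ[OF Delta_linear]] linear_map_kQ[OF Delta_linear] _ f])
      fix w assume w: "w \<in> paths_of_length Q q"
      define a u b where abu: "a = bv (subpath Q w 0 n)" "u = bv (subpath Q w n (n + ?m))"
        "b = bv (subpath Q w (n + ?m) q)"
      have k: "a \<in> carrier P" "u \<in> carrier P" "b \<in> carrier P" "bv w \<in> carrier P"
        using w q by (auto simp: abu paths_of_length_def basis_closed)
      have "Br_diff R Q N i (\<Delta> n ?m (bv w)) = act ?m' (cl a) (\<Delta> 1 ?m' u \<ominus>\<^bsub>T ?m'\<^esub> \<Delta> 0 ?m' u) (cl b)"
        using False pt_form[OF w abu] by (simp add: diff_gen_def Let_def)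
      also have "\<dots> = act ?m' (cl a) (\<Delta> 1 ?m' u) (cl b) \<ominus>\<^bsub>T ?m'\<^esub> act ?m' (cl a) (\<Delta> 0 ?m' u) (cl b)"
        using k by (intro linear_map_minus[OF T.module_axioms T.module_axioms act_linear_mid]) auto
      also have "\<dots> = \<Delta> (n + 1) ?m' (bv w) \<ominus>\<^bsub>T ?m'\<^esub> \<Delta> n ?m' (bv w)"
        using basis[OF _ w abu, of 1] basis[OF _ w abu, of 0] False zeta_step by simp
      finally show "Br_diff R Q N i (\<Delta> n ?m (bv w)) \<oplus>\<^bsub>T ?m'\<^esub> \<Delta> n ?m' (bv w) = \<Delta> (n + 1) ?m' (bv w)"
        using k by (simp add: T.M.minus_eq T.M.a_assoc T.M.l_neg)
    qed
    moreover have "Br_diff R Q N i (\<Delta> n ?m f) \<in> carrier (T ?m')"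
      using linear_map_closed[OF lin f] .
    moreover have "f \<in> carrier P" using f by simp
    ultimately have "Br_diff R Q N i (\<Delta> n ?m f) = \<Delta> (n + 1) ?m' f \<ominus>\<^bsub>T ?m'\<^esub> \<Delta> n ?m' f"
      by (metis Delta_closed T.M.a_assoc T.M.a_inv_closed T.M.minus_eq T.M.r_neg T.M.r_zero)
    then show ?thesis using False by (simp add: Let_def)
  qed
qed

end

end

section \<open>The lifting\<close>

text \<open>The two derivations are tied to each other only by their values on arrows. Vanishing on
  vertices, homogeneity and compatibility with \<open>cl\<close> are consequences, proved
  below.\<close>

locale quiver_derivation = trunc_quiver R Q N
  for R :: "('k, 'r) ring_scheme" (structure) and Q :: "('v, 'e) pre_digraph" and N :: nat +
  fixes l :: nat
    and \<delta> \<delta>Q :: "(('v, 'e) path \<Rightarrow> 'k) \<Rightarrow> (('v, 'e) path \<Rightarrow> 'k)"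
    and \<delta>A :: "(('v, 'e) path \<Rightarrow> 'k) set \<Rightarrow> (('v, 'e) path \<Rightarrow> 'k) set"
  assumes N: "N \<ge> 1" and l: "l \<ge> 1"
    and \<delta>: "bimodule_linear R (path_algebra R Q) (carrier (kQ_len R Q 0)) (kQ_len R Q 1) (kQ_len R Q l) \<delta>"
    and \<delta>Q: "bilinear_derivation R (path_algebra R Q) (carrier (kQ_len R Q 0)) \<delta>Q"
    and \<delta>Q_arrow: "\<And>x. x \<in> carrier (kQ_len R Q 1) \<Longrightarrow> \<delta>Q x = \<delta> x"
    and \<delta>A: "bilinear_derivation R (trunc_algebra R Q N) (vertex_subalgebra R Q N) \<delta>A"
    and \<delta>A_arrow: "\<And>x. x \<in> carrier (kQ_len R Q 1) \<Longrightarrow> \<delta>A (trunc_class R Q N x) = trunc_class R Q N (\<delta> x)"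
begin

text \<open>The facts about arrows and about consecutive degrees speak of \<open>kQ 1\<close> and
  \<open>i - 1\<close>; rewriting 1 to \<open>Suc 0\<close> would keep them from matching.\<close>

declare One_nat_def [simp del]

section \<open>Consequences of E-bilinearity and the Leibniz rule\<close>

lemma \<delta>Q_linear: "linear_map R P P \<delta>Q"
  using \<delta>Q by (simp add: bilinear_derivation_def bimodule_linear_def)

lemma \<delta>A_linear: "linear_map R A A \<delta>A"
  using \<delta>A by (simp add: bilinear_derivation_def bimodule_linear_def)

lemma \<delta>Q_closed [simp]: "x \<in> carrier P \<Longrightarrow> \<delta>Q x \<in> carrier P"
  by (rule linear_map_closed[OF \<delta>Q_linear])

lemma \<delta>A_closed [simp]: "x \<in> carrier A \<Longrightarrow> \<delta>A x \<in> carrier A"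
  by (rule linear_map_closed[OF \<delta>A_linear])

lemma \<delta>Q_mult:
  "\<lbrakk>x \<in> carrier P; y \<in> carrier P\<rbrakk> \<Longrightarrow> \<delta>Q (x \<otimes>\<^bsub>P\<^esub> y) = \<delta>Q x \<otimes>\<^bsub>P\<^esub> y \<oplus>\<^bsub>P\<^esub> x \<otimes>\<^bsub>P\<^esub> \<delta>Q y"
  using \<delta>Q by (simp add: bilinear_derivation_def)

lemma \<delta>A_mult:
  "\<lbrakk>x \<in> carrier A; y \<in> carrier A\<rbrakk> \<Longrightarrow> \<delta>A (x \<otimes>\<^bsub>A\<^esub> y) = \<delta>A x \<otimes>\<^bsub>A\<^esub> y \<oplus>\<^bsub>A\<^esub> x \<otimes>\<^bsub>A\<^esub> \<delta>A y"
  using \<delta>A by (simp add: bilinear_derivation_def)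

lemma \<delta>Q_E:
  assumes "e \<in> carrier (kQ 0)" and "x \<in> carrier P"
  shows "\<delta>Q (e \<otimes>\<^bsub>P\<^esub> x) = e \<otimes>\<^bsub>P\<^esub> \<delta>Q x" and "\<delta>Q (x \<otimes>\<^bsub>P\<^esub> e) = \<delta>Q x \<otimes>\<^bsub>P\<^esub> e"
  using \<delta>Q assms by (simp_all add: bilinear_derivation_def bimodule_linear_def)

lemma \<delta>A_E:
  assumes "e \<in> carrier (kQ 0)" and "x \<in> carrier A"
  shows "\<delta>A (cl e \<otimes>\<^bsub>A\<^esub> x) = cl e \<otimes>\<^bsub>A\<^esub> \<delta>A x" and "\<delta>A (x \<otimes>\<^bsub>A\<^esub> cl e) = \<delta>A x \<otimes>\<^bsub>A\<^esub> cl e"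
proof -
  have "cl e \<in> vertex_subalgebra R Q N" using assms(1) by (simp add: vertex_subalgebra_def)
  then show "\<delta>A (cl e \<otimes>\<^bsub>A\<^esub> x) = cl e \<otimes>\<^bsub>A\<^esub> \<delta>A x" and "\<delta>A (x \<otimes>\<^bsub>A\<^esub> cl e) = \<delta>A x \<otimes>\<^bsub>A\<^esub> cl e"
    using \<delta>A assms(2) unfolding bilinear_derivation_def bimodule_linear_def by blast+
qed

text \<open>By bilinearity both summands of \<open>\<delta>(e \<cdot> 1) = \<delta>(e) \<cdot> 1 + e \<cdot> \<delta>(1)\<close> are equal to \<open>\<delta>(e)\<close>.\<close>

lemma \<delta>Q_vertices: "e \<in> carrier (kQ 0) \<Longrightarrow> \<delta>Q e = \<zero>\<^bsub>P\<^esub>"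
proof -
  have "\<delta>Q (e \<otimes>\<^bsub>P\<^esub> \<one>\<^bsub>P\<^esub>) = \<delta>Q e \<otimes>\<^bsub>P\<^esub> \<one>\<^bsub>P\<^esub> \<oplus>\<^bsub>P\<^esub> e \<otimes>\<^bsub>P\<^esub> \<delta>Q \<one>\<^bsub>P\<^esub>" if e: "e \<in> carrier (kQ 0)" for e
    using e by (intro \<delta>Q_mult) auto
  moreover have "e \<otimes>\<^bsub>P\<^esub> \<delta>Q \<one>\<^bsub>P\<^esub> = \<delta>Q e" if "e \<in> carrier (kQ 0)" for e
    using that \<delta>Q_E(1)[of e "\<one>\<^bsub>P\<^esub>"] by simp
  ultimately have "\<delta>Q e = \<delta>Q e \<oplus>\<^bsub>P\<^esub> \<delta>Q e" if "e \<in> carrier (kQ 0)" for e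
    using that by simp
  then show "e \<in> carrier (kQ 0) \<Longrightarrow> \<delta>Q e = \<zero>\<^bsub>P\<^esub>"
    by (metis P.M.add.l_cancel_one' \<delta>Q_closed kQ_in_P)
qed

lemma \<delta>A_vertices:
  assumes e: "e \<in> carrier (kQ 0)"
  shows "\<delta>A (cl e) = \<zero>\<^bsub>A\<^esub>"
proof -
  have "\<delta>A (cl e \<otimes>\<^bsub>A\<^esub> \<one>\<^bsub>A\<^esub>) = \<delta>A (cl e) \<otimes>\<^bsub>A\<^esub> \<one>\<^bsub>A\<^esub> \<oplus>\<^bsub>A\<^esub> cl e \<otimes>\<^bsub>A\<^esub> \<delta>A \<one>\<^bsub>A\<^esub>"
    using e by (intro \<delta>A_mult) auto
  moreover have "cl e \<otimes>\<^bsub>A\<^esub> \<delta>A \<one>\<^bsub>A\<^esub> = \<delta>A (cl e)"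
    using e \<delta>A_E(1)[of e "\<one>\<^bsub>A\<^esub>"] by simp
  ultimately have "\<delta>A (cl e) = \<delta>A (cl e) \<oplus>\<^bsub>A\<^esub> \<delta>A (cl e)"
    using e by simp
  then show ?thesis
    using e by (metis A.M.add.l_cancel_one' \<delta>A_closed cl_kQ_closed)
qed

lemma \<delta>A_one: "\<delta>A \<one>\<^bsub>A\<^esub> = \<zero>\<^bsub>A\<^esub>"
  using \<delta>A_vertices[OF one_in_kQ] by (simp add: cl_one)

lemma \<delta>_in_kQ: "x \<in> carrier (kQ 1) \<Longrightarrow> \<delta>Q x \<in> carrier (kQ l)"
  using \<delta> linear_map_closed by (fastforce simp: bimodule_linear_def \<delta>Q_arrow)

lemma path_snoc:
  assumes "w \<in> paths_of_length Q (Suc m)"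
  obtains a b where "a \<in> paths_of_length Q m" "b \<in> paths_of_length Q 1" "bv w = bv a \<otimes>\<^bsub>P\<^esub> bv b"
proof
  have w: "w \<in> paths Q" "path_length w = Suc m" using assms by (simp_all add: paths_of_length_def)
  show "subpath Q w 0 m \<in> paths_of_length Q m"
    using w subpath_in_paths_of_length[of w 0 m] by simp
  show "subpath Q w m (Suc m) \<in> paths_of_length Q 1"
    using w subpath_in_paths_of_length[of w m "Suc m"] by (simp add: One_nat_def)
  show "bv w = bv (subpath Q w 0 m) \<otimes>\<^bsub>P\<^esub> bv (subpath Q w m (Suc m))"
    using w subpath_full[of w] by (simp add: subpath_mult)
qed

text \<open>Each Leibniz term replaces one arrow by paths of length \<open>l\<close>. A vertex has
  derivative zero, which lies in the required degree too.\<close>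

lemma \<delta>Q_basis_degree: "w \<in> paths_of_length Q m \<Longrightarrow> \<delta>Q (bv w) \<in> carrier (kQ (m + (l - 1)))"
proof (induction m arbitrary: w)
  case 0
  then show ?case by (simp add: \<delta>Q_vertices basis_in_kQ kQ_closed)
next
  case (Suc m)
  obtain a b where ab: "a \<in> paths_of_length Q m" "b \<in> paths_of_length Q 1" "bv w = bv a \<otimes>\<^bsub>P\<^esub> bv b"
    using path_snoc[OF Suc.prems] .
  note k = basis_in_kQ[OF ab(1)] basis_in_kQ[OF ab(2)]
  have "\<delta>Q (bv w) = \<delta>Q (bv a) \<otimes>\<^bsub>P\<^esub> bv b \<oplus>\<^bsub>P\<^esub> bv a \<otimes>\<^bsub>P\<^esub> \<delta>Q (bv b)"
    using k by (simp add: ab \<delta>Q_mult)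
  moreover have "\<delta>Q (bv a) \<otimes>\<^bsub>P\<^esub> bv b \<in> carrier (kQ (Suc m + (l - 1)))"
    using kQ_mult[OF Suc.IH[OF ab(1)] k(2)] by (simp add: One_nat_def)
  moreover have "bv a \<otimes>\<^bsub>P\<^esub> \<delta>Q (bv b) \<in> carrier (kQ (Suc m + (l - 1)))"
    using kQ_mult[OF k(1) \<delta>_in_kQ[OF k(2)]] l by simp
  ultimately show ?case by (simp add: kQ_closed)
qed

lemma \<delta>Q_degree:
  assumes "x \<in> carrier (kQ m)"
  shows "\<delta>Q x \<in> carrier (kQ (m + (l - 1)))"
  using assms
proof (induction rule: kQ_induct)
  case zero
  then show ?case
    by (simp add: linear_map_zero[OF P.module_axioms P.module_axioms \<delta>Q_linear] kQ_closed)
next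
  case (add c w x)
  then show ?case
    using basis_in_kQ[of w m]
    by (simp add: linear_map_add[OF \<delta>Q_linear] linear_map_smult[OF \<delta>Q_linear] kQ_closed \<delta>Q_basis_degree)
qed

text \<open>Both composites obey the same Leibniz rule, vanish on vertices and agree on arrows, so
  splitting off the last arrow gives equality on every path.\<close>

lemma \<delta>A_cl:
  assumes "x \<in> carrier P"
  shows "\<delta>A (cl x) = cl (\<delta>Q x)"
proof (rule P_linear_eqI[OF A.module_axioms linear_map_comp[OF cl_linear \<delta>A_linear]
      linear_map_comp[OF \<delta>Q_linear cl_linear] _ assms])
  have "\<delta>A (cl (bv w)) = cl (\<delta>Q (bv w))" if "w \<in> paths_of_length Q m" for w m
    using that
  proof (induction m arbitrary: w)
    case 0
    then show ?case by (simp add: \<delta>Q_vertices \<delta>A_vertices basis_in_kQ cl_zero)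
  next
    case (Suc m)
    obtain a b where ab: "a \<in> paths_of_length Q m" "b \<in> paths_of_length Q 1" "bv w = bv a \<otimes>\<^bsub>P\<^esub> bv b"
      using path_snoc[OF Suc.prems] .
    note k = basis_in_kQ[OF ab(1)] basis_in_kQ[OF ab(2)]
    have "\<delta>A (cl (bv b)) = cl (\<delta>Q (bv b))"
      using k by (simp only: \<delta>A_arrow \<delta>Q_arrow)
    then show ?case
      using k Suc.IH[OF ab(1)]
      by (simp add: ab(3) cl_mult \<delta>A_mult \<delta>Q_mult linear_map_add[OF cl_linear])
  qed
  then show "\<delta>A (cl (bv w)) = cl (\<delta>Q (bv w))" if "w \<in> paths Q" for w
    using path_in_paths_of_length[OF that] .
qed

text \<open>\<open>tail_der w q\<close> is \<open>\<alpha>\<^sub>1 \<cdots> \<alpha>\<^sub>q \<delta>(\<alpha>\<^bsub>q+1\<^esub> \<cdots> \<alpha>\<^sub>n)\<close> for \<open>w = \<alpha>\<^sub>1 \<cdots> \<alpha>\<^sub>n\<close>.\<close>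

definition tail_der :: "('v, 'e) path \<Rightarrow> nat \<Rightarrow> ('v, 'e) path \<Rightarrow> 'k" where
  "tail_der w q = bv (subpath Q w 0 q) \<otimes>\<^bsub>P\<^esub> \<delta>Q (bv (subpath Q w q (path_length w)))"

lemma tail_der_degree:
  assumes "w \<in> paths Q" and "q \<le> path_length w"
  shows "tail_der w q \<in> carrier (kQ (path_length w + (l - 1)))"
  using kQ_mult[OF subpath_basis_in_kQ[of w 0 q q] \<delta>Q_degree[OF subpath_basis_in_kQ[of w q "path_length w" "path_length w - q"]]] assms
  by (simp add: tail_der_def)

lemma tail_der_closed: "\<lbrakk>w \<in> paths Q; q \<le> path_length w\<rbrakk> \<Longrightarrow> tail_der w q \<in> carrier P"
  by (rule kQ_in_P[OF tail_der_degree])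

lemma tail_der_full: "w \<in> paths Q \<Longrightarrow> tail_der w (path_length w) = \<zero>\<^bsub>P\<^esub>"
  by (simp add: tail_der_def \<delta>Q_vertices subpath_basis_in_kQ)

text \<open>The Leibniz rule applied to the part of \<open>w\<close> after its vertex
  \<open>i\<close>, cut at \<open>j\<close>. For \<open>j = i + 1\<close> the difference of the two
  tail derivatives is the term of \<delta>(w) in which a single arrow is differentiated.\<close>

lemma tail_der_diff:
  assumes w: "w \<in> paths Q" and "i \<le> j" and "j \<le> path_length w"
  shows "tail_der w i = bv (subpath Q w 0 i) \<otimes>\<^bsub>P\<^esub> \<delta>Q (bv (subpath Q w i j)) \<otimes>\<^bsub>P\<^esub> bv (subpath Q w j (path_length w))
    \<oplus>\<^bsub>P\<^esub> tail_der w j"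
proof -
  let ?n = "path_length w"
  define a b c where abc: "a = bv (subpath Q w 0 i)" "b = bv (subpath Q w i j)" "c = bv (subpath Q w j ?n)"
  have k: "a \<in> carrier P" "b \<in> carrier P" "c \<in> carrier P" using assms by (simp_all add: abc)
  have "bv (subpath Q w i ?n) = b \<otimes>\<^bsub>P\<^esub> c" "bv (subpath Q w 0 j) = a \<otimes>\<^bsub>P\<^esub> b"
    using assms by (simp_all add: abc subpath_mult)
  then show ?thesis
    using k unfolding tail_der_def abc[symmetric] by (simp add: \<delta>Q_mult P.r_distr P.m_assoc)
qed

lemma source_subpath: "w \<in> paths Q \<Longrightarrow> source (subpath Q w 0 j) = source w"
  by (cases w) (auto simp: subpath_def paths_iff awalk_verts_nth_0)

lemma target_subpath: "w \<in> paths Q \<Longrightarrow> target (subpath Q w j (path_length w)) = target w"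
  by (cases w) (auto simp: subpath_def paths_iff path_length_def awalk_verts_nth_length)

text \<open>The element inside the correction sum, extended from paths to a linear map: the value on
  a generator must be E-bilinear in order to extend to the bimodule.\<close>

definition last_der :: "nat \<Rightarrow> (('v, 'e) path \<Rightarrow> 'k) \<Rightarrow> ('v, 'e) path \<Rightarrow> 'k" where
  "last_der m = linear_ext R (kQ (m + (l - 1))) (\<lambda>w. tail_der w (m - 1))"

lemma last_der_linear: "linear_map R (kQ m) (kQ (m + (l - 1))) (last_der m)"
  unfolding last_der_def
  \<comment> \<open>Only the source is unfolded to a free module; the target stays a graded
    piece.\<close>
  by (subst (1) kQ_len_def, rule K.linear_ext_linear)
    (use tail_der_degree in \<open>fastforce simp: paths_of_length_def\<close>)

lemma last_der_basis:
  assumes "w \<in> paths_of_length Q m"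
  shows "last_der m (bv w) = tail_der w (m - 1)"
  unfolding last_der_def using assms tail_der_degree[of w "m - 1"]
  by (intro K.linear_ext_basis_vec) (auto simp: paths_of_length_def)

lemma P_from_kQ_linear: "linear_map R M (kQ m) f \<Longrightarrow> linear_map R M P f"
  by (auto simp: linear_map_def kQ_simps)

text \<open>Differentiating the last arrow preserves both end points of a path. Hence a vertex fixes
  or kills a path and its image alike, and linearity in \<open>u\<close> and then in
  \<open>e\<close> gives the rest.\<close>

lemma last_der_E:
  assumes e: "e \<in> carrier (kQ 0)" and u: "u \<in> carrier (kQ m)"
  shows "last_der m (e \<otimes>\<^bsub>P\<^esub> u) = e \<otimes>\<^bsub>P\<^esub> last_der m u"
    and "last_der m (u \<otimes>\<^bsub>P\<^esub> e) = last_der m u \<otimes>\<^bsub>P\<^esub> e"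
proof -
  note lin = P_from_kQ_linear[OF last_der_linear]
  have zero: "last_der m \<zero>\<^bsub>P\<^esub> = \<zero>\<^bsub>P\<^esub>"
    using linear_map_zero[OF kQ_module P.module_axioms lin, of m] by (simp add: kQ_simps)
  have vertex: "last_der m (bv x \<otimes>\<^bsub>P\<^esub> bv w) = bv x \<otimes>\<^bsub>P\<^esub> last_der m (bv w)"
    "last_der m (bv w \<otimes>\<^bsub>P\<^esub> bv x) = last_der m (bv w) \<otimes>\<^bsub>P\<^esub> bv x"
    if x: "x \<in> paths_of_length Q 0" and w: "w \<in> paths_of_length Q m" for x w
  proof -
    obtain v where v: "x = (v, [], v)" "v \<in> verts Q" using x by (auto simp: paths_of_length_0)
    have wp: "w \<in> paths Q" "path_length w = m" using w by (simp_all add: paths_of_length_def)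
    let ?a = "subpath Q w 0 (m - 1)" and ?b = "subpath Q w (m - 1) m"
    have ab: "?a \<in> paths Q" "?b \<in> paths Q" "bv ?a \<in> carrier P" "bv ?b \<in> carrier P"
      "bv (v, [], v) \<in> carrier P"
      using wp v by (simp_all add: subpath_in_paths basis_closed trivial_path_in_paths)
    have td: "tail_der w (m - 1) = bv ?a \<otimes>\<^bsub>P\<^esub> \<delta>Q (bv ?b)" by (simp add: tail_der_def wp)
    have "bv (v, [], v) \<otimes>\<^bsub>P\<^esub> bv ?a = (if v = source w then bv ?a else \<zero>\<^bsub>P\<^esub>)"
      using v ab wp by (simp add: vertex_mult source_subpath)
    then have "bv (v, [], v) \<otimes>\<^bsub>P\<^esub> tail_der w (m - 1) = (if v = source w then tail_der w (m - 1) else \<zero>\<^bsub>P\<^esub>)"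
      using ab by (simp add: td P.m_assoc[symmetric])
    then show "last_der m (bv x \<otimes>\<^bsub>P\<^esub> bv w) = bv x \<otimes>\<^bsub>P\<^esub> last_der m (bv w)"
      using v wp w by (simp add: vertex_mult(1) last_der_basis zero)
    have "bv ?b \<otimes>\<^bsub>P\<^esub> bv (v, [], v) = (if v = target w then bv ?b else \<zero>\<^bsub>P\<^esub>)"
      using v ab wp target_subpath[of w "m - 1"] by (simp add: vertex_mult)
    \<comment> \<open>On the right the vertex must be taken under the derivation before it can meet
      the last arrow.\<close>
    moreover have "\<delta>Q (bv ?b) \<otimes>\<^bsub>P\<^esub> bv (v, [], v) = \<delta>Q (bv ?b \<otimes>\<^bsub>P\<^esub> bv (v, [], v))"
      using v ab by (intro \<delta>Q_E(2)[symmetric] vertex_in_kQ)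
    ultimately have "tail_der w (m - 1) \<otimes>\<^bsub>P\<^esub> bv (v, [], v) = (if v = target w then tail_der w (m - 1) else \<zero>\<^bsub>P\<^esub>)"
      using ab by (simp add: td P.m_assoc \<delta>Q_vertices[OF kQ_closed(1)])
    then show "last_der m (bv w \<otimes>\<^bsub>P\<^esub> bv x) = last_der m (bv w) \<otimes>\<^bsub>P\<^esub> bv x"
      using v wp w by (simp add: vertex_mult(2) last_der_basis zero)
  qed
  have mult_lin: "linear_map R (kQ m) (kQ m) (\<lambda>u. e \<otimes>\<^bsub>P\<^esub> u)" "linear_map R (kQ m) (kQ m) (\<lambda>u. u \<otimes>\<^bsub>P\<^esub> e)"
    "linear_map R (kQ 0) (kQ m) (\<lambda>e. e \<otimes>\<^bsub>P\<^esub> u)" "linear_map R (kQ 0) (kQ m) (\<lambda>e. u \<otimes>\<^bsub>P\<^esub> e)"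
    if "e \<in> carrier (kQ 0)" "u \<in> carrier (kQ m)" for e u
    using that
    by (auto intro!: linear_mapI
        simp: kQ_0_mult kQ_simps P.r_distr P.l_distr P.smult_mult_left P.smult_mult_right)
  have 1: "last_der m (bv x \<otimes>\<^bsub>P\<^esub> u) = bv x \<otimes>\<^bsub>P\<^esub> last_der m u"
    "last_der m (u \<otimes>\<^bsub>P\<^esub> bv x) = last_der m u \<otimes>\<^bsub>P\<^esub> bv x" if x: "x \<in> paths_of_length Q 0" for x
  proof -
    note bx = basis_in_kQ[OF x]
    show "last_der m (bv x \<otimes>\<^bsub>P\<^esub> u) = bv x \<otimes>\<^bsub>P\<^esub> last_der m u"
      by (rule kQ_linear_eqI[OF P.module_axioms linear_map_comp[OF mult_lin(1) lin]
            linear_map_comp[OF lin P.mult_left_linear] vertex(1) u]) (use bx x u in auto)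
    show "last_der m (u \<otimes>\<^bsub>P\<^esub> bv x) = last_der m u \<otimes>\<^bsub>P\<^esub> bv x"
      by (rule kQ_linear_eqI[OF P.module_axioms linear_map_comp[OF mult_lin(2) lin]
            linear_map_comp[OF lin P.mult_right_linear] vertex(2) u]) (use bx x u in auto)
  qed
  note lu = linear_map_closed[OF lin u]
  show "last_der m (e \<otimes>\<^bsub>P\<^esub> u) = e \<otimes>\<^bsub>P\<^esub> last_der m u"
    by (rule kQ_linear_eqI[OF P.module_axioms linear_map_comp[OF mult_lin(3)[OF e u] lin]
          linear_map_kQ[OF P.mult_right_linear[OF lu]] 1(1) e])
  show "last_der m (u \<otimes>\<^bsub>P\<^esub> e) = last_der m u \<otimes>\<^bsub>P\<^esub> e"
    by (rule kQ_linear_eqI[OF P.module_axioms linear_map_comp[OF mult_lin(4)[OF e u] lin]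
          linear_map_kQ[OF P.mult_left_linear[OF lu]] 1(2) e])
qed

section \<open>The lifting and its Leibniz rule\<close>

definition lift_gen :: "nat \<Rightarrow> (('v, 'e) path \<Rightarrow> 'k) \<Rightarrow> ('v, 'e, 'k) tensor" where
  "lift_gen i u = \<Delta> (l - 1) (zeta N i) (\<delta>Q u) \<oplus>\<^bsub>T (zeta N i)\<^esub>
     (if even i then \<zero>\<^bsub>T (zeta N i)\<^esub>
      else \<Oplus>\<^bsub>T (zeta N i)\<^esub> s\<in>{..<l - 1}. \<Delta> s (zeta N i) (last_der (zeta N i) u))"

lemma lift_gen_E_bilinear: "E_bilinear (zeta N i) (zeta N i) (lift_gen i)"
proof -
  let ?m = "zeta N i"
  have lin: "linear_map R (kQ ?m) (kQ (?m + (l - 1))) \<delta>Q"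
    using \<delta>Q_linear \<delta>Q_degree by (auto simp: linear_map_def kQ_simps)
  have 1: "E_bilinear ?m ?m (\<lambda>u. \<Delta> (l - 1) ?m (\<delta>Q u))"
    by (rule Delta_E_bilinear[OF lin]) (simp_all add: \<delta>Q_E)
  have 2: "E_bilinear ?m ?m (\<lambda>u. \<Oplus>\<^bsub>T ?m\<^esub> s\<in>{..<l - 1}. \<Delta> s ?m (last_der ?m u))"
    by (intro E_bilinear_finsum Delta_E_bilinear[OF last_der_linear]) (auto simp: last_der_E)
  show ?thesis
    unfolding lift_gen_def[abs_def]
    by (cases "even i") (simp_all only: if_True if_False E_bilinear_add[OF 1 E_bilinear_zero]
        E_bilinear_add[OF 1 2] not_False_eq_True)
qed

definition lift :: "nat \<Rightarrow> ('v, 'e, 'k) tensor \<Rightarrow> ('v, 'e, 'k) tensor" where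
  "lift i = tensor_lift R (T (zeta N i)) (\<lambda>(x, u, y).
     pt (zeta N i) (\<delta>A x) u y \<oplus>\<^bsub>T (zeta N i)\<^esub> act (zeta N i) x (lift_gen i u) y
       \<oplus>\<^bsub>T (zeta N i)\<^esub> pt (zeta N i) x u (\<delta>A y))"

text \<open>Each of the three summands is balanced by itself: the outer ones because \<delta> on
  \<open>A\<close> is E-bilinear, the middle one because \<open>lift_gen\<close> is.\<close>

lemma lift_balanced:
  "balanced (zeta N i) (T (zeta N i)) (\<lambda>x u y.
     pt (zeta N i) (\<delta>A x) u y \<oplus>\<^bsub>T (zeta N i)\<^esub> act (zeta N i) x (lift_gen i u) y
       \<oplus>\<^bsub>T (zeta N i)\<^esub> pt (zeta N i) x u (\<delta>A y))"
proof (intro balanced_add T.module_axioms E_bilinear_balanced[OF lift_gen_E_bilinear])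
  let ?m = "zeta N i"
  show "balanced ?m (T ?m) (\<lambda>x u y. pt ?m (\<delta>A x) u y)"
    by (intro balancedI linear_map_comp[OF \<delta>A_linear pt_linear_left] pt_linear_mid pt_linear_right)
      (simp_all add: \<delta>A_E pt_left pt_right)
  show "balanced ?m (T ?m) (\<lambda>x u y. pt ?m x u (\<delta>A y))"
    by (intro balancedI linear_map_comp[OF \<delta>A_linear pt_linear_right] pt_linear_mid pt_linear_left)
      (simp_all add: \<delta>A_E pt_left pt_right)
qed

lemma lift_pt:
  assumes "x \<in> carrier A" and "u \<in> carrier (kQ (zeta N i))" and "y \<in> carrier A"
  shows "lift i (pt (zeta N i) x u y) = pt (zeta N i) (\<delta>A x) u y \<oplus>\<^bsub>T (zeta N i)\<^esub>
    act (zeta N i) x (lift_gen i u) y \<oplus>\<^bsub>T (zeta N i)\<^esub> pt (zeta N i) x u (\<delta>A y)"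
  unfolding lift_def using assms by (rule tensor_lift_pt[OF T.module_axioms lift_balanced])

lemma lift_linear: "linear_map R (T (zeta N i)) (T (zeta N i)) (lift i)"
  unfolding lift_def by (rule tensor_lift_linear_map[OF T.module_axioms lift_balanced])

lemma lift_gen_closed [simp]:
  "u \<in> carrier (kQ (zeta N i)) \<Longrightarrow> lift_gen i u \<in> carrier (T (zeta N i))"
  by (rule E_bilinear_closed[OF lift_gen_E_bilinear])

lemma lift_one:
  assumes "w \<in> paths_of_length Q (zeta N i)"
  shows "lift i (pt (zeta N i) \<one>\<^bsub>A\<^esub> (bv w) \<one>\<^bsub>A\<^esub>) = lift_gen i (bv w)"
  using basis_in_kQ[OF assms] by (simp add: lift_pt \<delta>A_one act_one)

lemma lift_act:
  assumes a: "a \<in> carrier A" and b: "b \<in> carrier A" and X: "X \<in> carrier (T (zeta N i))"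
  shows "lift i (act (zeta N i) a X b) = act (zeta N i) (\<delta>A a) X b \<oplus>\<^bsub>T (zeta N i)\<^esub>
    act (zeta N i) a (lift i X) b \<oplus>\<^bsub>T (zeta N i)\<^esub> act (zeta N i) a X (\<delta>A b)"
proof (rule T_linear_eqI[OF T.module_axioms _ _ _ X])
  let ?m = "zeta N i"
  show "linear_map R (T ?m) (T ?m) (\<lambda>X. lift i (act ?m a X b))"
    using a b by (intro linear_map_comp[OF act_linear_mid lift_linear])
  show "linear_map R (T ?m) (T ?m) (\<lambda>X. act ?m (\<delta>A a) X b \<oplus>\<^bsub>T ?m\<^esub> act ?m a (lift i X) b \<oplus>\<^bsub>T ?m\<^esub> act ?m a X (\<delta>A b))"
    using a b by (intro linear_map_plus T.module_axioms act_linear_mid linear_map_comp[OF lift_linear act_linear_mid]) auto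
  fix x u y
  assume k: "x \<in> carrier A" "u \<in> carrier (kQ ?m)" "y \<in> carrier A"
  have "lift i (act ?m a (pt ?m x u y) b)
      = (pt ?m (\<delta>A a \<otimes>\<^bsub>A\<^esub> x) u (y \<otimes>\<^bsub>A\<^esub> b) \<oplus>\<^bsub>T ?m\<^esub> pt ?m (a \<otimes>\<^bsub>A\<^esub> \<delta>A x) u (y \<otimes>\<^bsub>A\<^esub> b))
        \<oplus>\<^bsub>T ?m\<^esub> act ?m (a \<otimes>\<^bsub>A\<^esub> x) (lift_gen i u) (y \<otimes>\<^bsub>A\<^esub> b)
        \<oplus>\<^bsub>T ?m\<^esub> (pt ?m (a \<otimes>\<^bsub>A\<^esub> x) u (\<delta>A y \<otimes>\<^bsub>A\<^esub> b) \<oplus>\<^bsub>T ?m\<^esub> pt ?m (a \<otimes>\<^bsub>A\<^esub> x) u (y \<otimes>\<^bsub>A\<^esub> \<delta>A b))"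
    using a b k by (simp add: lift_pt \<delta>A_mult linear_map_add[OF pt_linear_left] linear_map_add[OF pt_linear_right])
  moreover have "act ?m a (lift i (pt ?m x u y)) b
      = pt ?m (a \<otimes>\<^bsub>A\<^esub> \<delta>A x) u (y \<otimes>\<^bsub>A\<^esub> b) \<oplus>\<^bsub>T ?m\<^esub> act ?m (a \<otimes>\<^bsub>A\<^esub> x) (lift_gen i u) (y \<otimes>\<^bsub>A\<^esub> b)
        \<oplus>\<^bsub>T ?m\<^esub> pt ?m (a \<otimes>\<^bsub>A\<^esub> x) u (\<delta>A y \<otimes>\<^bsub>A\<^esub> b)"
    using a b k by (simp add: lift_pt linear_map_add[OF act_linear_mid] act_act)
  ultimately show "lift i (act ?m a (pt ?m x u y) b) = act ?m (\<delta>A a) (pt ?m x u y) b \<oplus>\<^bsub>T ?m\<^esub>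
      act ?m a (lift i (pt ?m x u y)) b \<oplus>\<^bsub>T ?m\<^esub> act ?m a (pt ?m x u y) (\<delta>A b)"
    using a b k by (simp add: T.M.a_ac)
qed

text \<open>Cut \<open>w\<close> as a u b, with \<open>a\<close> of length \<open>j\<close> and a u
  of length \<open>q\<close>, and let x_q be \<open>tail_der w q\<close>. The terms \<delta>(a) u b
  and a \<delta>(u) b add up to \<delta>(w) - x_q and are cut at j + l - 1, the first since
  \<open>a\<close> grew, the second by the choice of \<open>lift_gen\<close>. The term a u
  \<delta>(b) is x_q, and its cut stays at \<open>j\<close>. The odd correction differentiates only
  the last arrow of \<open>u\<close>, which amounts to x_{q-1} - x_q by
  \<open>tail_der_diff\<close>.\<close>

lemma lift_Delta:
  assumes w: "w \<in> paths Q" and q: "q = j + zeta N i" "q \<le> path_length w"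
  shows "lift i (\<Delta> j (zeta N i) (bv w)) = \<Delta> (j + (l - 1)) (zeta N i) (\<delta>Q (bv w) \<ominus>\<^bsub>P\<^esub> tail_der w q)
    \<oplus>\<^bsub>T (zeta N i)\<^esub> (if even i then \<zero>\<^bsub>T (zeta N i)\<^esub>
      else \<Oplus>\<^bsub>T (zeta N i)\<^esub> s\<in>{..<l - 1}. \<Delta> (j + s) (zeta N i) (tail_der w (q - 1) \<ominus>\<^bsub>P\<^esub> tail_der w q))
    \<oplus>\<^bsub>T (zeta N i)\<^esub> \<Delta> j (zeta N i) (tail_der w q)"
proof -
  let ?m = "zeta N i" and ?n = "path_length w"
  define a u b where abu: "a = bv (subpath Q w 0 j)" "u = bv (subpath Q w j q)" "b = bv (subpath Q w q ?n)"
  have k: "a \<in> carrier (kQ j)" "u \<in> carrier (kQ ?m)" "b \<in> carrier P"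
    using w q by (simp_all add: abu subpath_basis_in_kQ)
  have kP: "a \<in> carrier P" "u \<in> carrier P" using k by simp_all
  have d1: "pt ?m (\<delta>A (cl a)) u (cl b) = \<Delta> (j + (l - 1)) ?m (\<delta>Q a \<otimes>\<^bsub>P\<^esub> u \<otimes>\<^bsub>P\<^esub> b)"
    using k kP by (simp add: \<delta>A_cl pt_eq_Delta[OF \<delta>Q_degree])
  have au: "a \<otimes>\<^bsub>P\<^esub> u = bv (subpath Q w 0 q)"
    using w q by (simp add: abu subpath_mult)
  have d3: "pt ?m (cl a) u (\<delta>A (cl b)) = \<Delta> j ?m (tail_der w q)"
    using k kP by (simp add: \<delta>A_cl pt_eq_Delta au) (simp add: tail_der_def abu)
  have gen1: "act ?m (cl a) (\<Delta> (l - 1) ?m (\<delta>Q u)) (cl b) = \<Delta> (j + (l - 1)) ?m (a \<otimes>\<^bsub>P\<^esub> \<delta>Q u \<otimes>\<^bsub>P\<^esub> b)"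
    using k by (intro act_Delta[OF _ \<delta>Q_degree]) auto
  have abu_w: "bv w = a \<otimes>\<^bsub>P\<^esub> u \<otimes>\<^bsub>P\<^esub> b"
    using w q subpath_mult3[of w j q] by (simp add: abu)
  have dw: "\<delta>Q (bv w) \<ominus>\<^bsub>P\<^esub> tail_der w q = \<delta>Q a \<otimes>\<^bsub>P\<^esub> u \<otimes>\<^bsub>P\<^esub> b \<oplus>\<^bsub>P\<^esub> a \<otimes>\<^bsub>P\<^esub> \<delta>Q u \<otimes>\<^bsub>P\<^esub> b"
  proof -
    have "tail_der w q = a \<otimes>\<^bsub>P\<^esub> u \<otimes>\<^bsub>P\<^esub> \<delta>Q b" by (simp add: tail_der_def au) (simp add: abu)
    then show ?thesis
      using k kP by (simp add: abu_w \<delta>Q_mult P.l_distr P.minus_eq P.M.a_assoc P.M.r_neg)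
  qed
  have d12: "\<Delta> (j + (l - 1)) ?m (\<delta>Q a \<otimes>\<^bsub>P\<^esub> u \<otimes>\<^bsub>P\<^esub> b) \<oplus>\<^bsub>T ?m\<^esub> \<Delta> (j + (l - 1)) ?m (a \<otimes>\<^bsub>P\<^esub> \<delta>Q u \<otimes>\<^bsub>P\<^esub> b)
      = \<Delta> (j + (l - 1)) ?m (\<delta>Q (bv w) \<ominus>\<^bsub>P\<^esub> tail_der w q)"
    using k kP unfolding dw by (intro linear_map_add[OF Delta_linear, symmetric]) auto
  have gen2: "act ?m (cl a) (\<Oplus>\<^bsub>T ?m\<^esub> s\<in>{..<l - 1}. \<Delta> s ?m (last_der ?m u)) (cl b)
      = (\<Oplus>\<^bsub>T ?m\<^esub> s\<in>{..<l - 1}. \<Delta> (j + s) ?m (tail_der w (q - 1) \<ominus>\<^bsub>P\<^esub> tail_der w q))" if "odd i"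
  proof -
    \<comment> \<open>In odd degree \<open>u\<close> has a last arrow, so \<open>q - 1\<close> does
      not fall before the beginning of \<open>u\<close>.\<close>
    have m: "?m \<ge> 1" using that by (simp add: zeta_def)
    let ?c = "bv (subpath Q w j (q - 1))" and ?d = "bv (subpath Q w (q - 1) q)"
    let ?v = "subpath Q w j q"
    have v: "?v \<in> paths_of_length Q ?m" using w q subpath_in_paths_of_length[of w j q] by simp
    have cd: "?c \<in> carrier P" "?d \<in> carrier P" using w q m by simp_all
    have "path_length ?v = ?m" using v by (simp add: paths_of_length_def)
    moreover have "j + (?m - 1) = q - 1" using m q by simp
    ultimately have "last_der ?m u = ?c \<otimes>\<^bsub>P\<^esub> \<delta>Q ?d"
      using v w q m subpath_subpath[of w j q 0 "?m - 1"] subpath_subpath[of w j q "?m - 1" ?m]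
      by (simp add: abu last_der_basis tail_der_def)
    moreover have "a \<otimes>\<^bsub>P\<^esub> ?c = bv (subpath Q w 0 (q - 1))"
      using w q m unfolding abu by (intro subpath_mult) auto
    ultimately have "a \<otimes>\<^bsub>P\<^esub> last_der ?m u \<otimes>\<^bsub>P\<^esub> b = bv (subpath Q w 0 (q - 1)) \<otimes>\<^bsub>P\<^esub> \<delta>Q ?d \<otimes>\<^bsub>P\<^esub> b"
      using cd kP by (simp add: P.m_assoc[symmetric])
    moreover have "bv (subpath Q w 0 (q - 1)) \<otimes>\<^bsub>P\<^esub> \<delta>Q ?d \<otimes>\<^bsub>P\<^esub> b \<in> carrier P"
      using w q m cd k by (intro P.m_closed \<delta>Q_closed subpath_basis_closed) auto
    moreover have "tail_der w (q - 1) = bv (subpath Q w 0 (q - 1)) \<otimes>\<^bsub>P\<^esub> \<delta>Q ?d \<otimes>\<^bsub>P\<^esub> b \<oplus>\<^bsub>P\<^esub> tail_der w q"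
      unfolding abu(3) using w q by (intro tail_der_diff) auto
    moreover have "tail_der w q \<in> carrier P" using w q by (intro tail_der_closed)
    ultimately have "a \<otimes>\<^bsub>P\<^esub> last_der ?m u \<otimes>\<^bsub>P\<^esub> b = tail_der w (q - 1) \<ominus>\<^bsub>P\<^esub> tail_der w q"
      by (simp add: P.minus_eq P.M.a_assoc P.M.r_neg)
    then have "act ?m (cl a) (\<Delta> s ?m (last_der ?m u)) (cl b) = \<Delta> (j + s) ?m (tail_der w (q - 1) \<ominus>\<^bsub>P\<^esub> tail_der w q)"
      if "s < l - 1" for s
      using act_Delta[OF k(1) linear_map_closed[OF last_der_linear k(2)] _ k(3), of s ?m] that by simp
    moreover have "last_der ?m u \<in> carrier P"
      using linear_map_closed[OF last_der_linear k(2)] by simp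
    moreover have "tail_der w (q - 1) \<ominus>\<^bsub>P\<^esub> tail_der w q \<in> carrier P"
      using w q by (intro P.M.minus_closed tail_der_closed) auto
    ultimately have "(\<Oplus>\<^bsub>T ?m\<^esub> s\<in>{..<l - 1}. act ?m (cl a) (\<Delta> s ?m (last_der ?m u)) (cl b))
        = (\<Oplus>\<^bsub>T ?m\<^esub> s\<in>{..<l - 1}. \<Delta> (j + s) ?m (tail_der w (q - 1) \<ominus>\<^bsub>P\<^esub> tail_der w q))"
      by (intro T.M.finsum_cong') simp_all
    moreover have "act ?m (cl a) (\<Oplus>\<^bsub>T ?m\<^esub> s\<in>{..<l - 1}. \<Delta> s ?m (last_der ?m u)) (cl b)
        = (\<Oplus>\<^bsub>T ?m\<^esub> s\<in>{..<l - 1}. act ?m (cl a) (\<Delta> s ?m (last_der ?m u)) (cl b))"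
      using kP k linear_map_closed[OF last_der_linear k(2)]
      by (intro linear_map_finsum[OF T.module_axioms T.module_axioms act_linear_mid]) auto
    ultimately show ?thesis by (rule trans[rotated])
  qed
  have closed: "\<Delta> (l - 1) ?m (\<delta>Q u) \<in> carrier (T ?m)"
    "(\<Oplus>\<^bsub>T ?m\<^esub> s\<in>{..<l - 1}. \<Delta> s ?m (last_der ?m u)) \<in> carrier (T ?m)"
    using kP linear_map_closed[OF last_der_linear k(2)] by auto
  have "act ?m (cl a) (lift_gen i u) (cl b) = \<Delta> (j + (l - 1)) ?m (a \<otimes>\<^bsub>P\<^esub> \<delta>Q u \<otimes>\<^bsub>P\<^esub> b) \<oplus>\<^bsub>T ?m\<^esub>
      (if even i then \<zero>\<^bsub>T ?m\<^esub>
      else \<Oplus>\<^bsub>T ?m\<^esub> s\<in>{..<l - 1}. \<Delta> (j + s) ?m (tail_der w (q - 1) \<ominus>\<^bsub>P\<^esub> tail_der w q))"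
    using kP k closed
    by (auto simp: lift_gen_def linear_map_add[OF act_linear_mid] gen1 gen2
        linear_map_zero[OF T.module_axioms T.module_axioms act_linear_mid])
  moreover have "lift i (\<Delta> j ?m (bv w)) = pt ?m (\<delta>A (cl a)) u (cl b) \<oplus>\<^bsub>T ?m\<^esub>
      act ?m (cl a) (lift_gen i u) (cl b) \<oplus>\<^bsub>T ?m\<^esub> pt ?m (cl a) u (\<delta>A (cl b))"
    using w q(2) k kP by (simp add: Delta_basis_pt q(1)[symmetric] abu[symmetric] lift_pt)
  moreover have "(if even i then \<zero>\<^bsub>T ?m\<^esub>
      else \<Oplus>\<^bsub>T ?m\<^esub> s\<in>{..<l - 1}. \<Delta> (j + s) ?m (tail_der w (q - 1) \<ominus>\<^bsub>P\<^esub> tail_der w q)) \<in> carrier (T ?m)"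
    using w q by (auto intro!: T.M.finsum_closed Delta_closed P.M.minus_closed tail_der_closed)
  moreover have "tail_der w q \<in> carrier P" using w q by (intro tail_der_closed)
  ultimately show ?thesis
    unfolding d1 d3 d12[symmetric] using k kP by (simp add: T.M.a_assoc)
qed

section \<open>Compatibility with the differentials and the augmentation\<close>

lemma lift_diff_gen:
  assumes i: "i \<ge> 1" and w: "w \<in> paths_of_length Q (zeta N i)"
  shows "Br_diff R Q N i (lift_gen i (bv w)) = lift (i - 1) (diff_gen i (bv w))"
proof -
  let ?m = "zeta N i" and ?m' = "zeta N (i - 1)" and ?p = "l - 1"
  let ?X = "tail_der w"
  have wp: "w \<in> paths Q" "path_length w = ?m" using w by (simp_all add: paths_of_length_def)
  have bw: "bv w \<in> carrier P" using wp by (simp add: basis_closed)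
  have X: "?X q \<in> carrier (kQ (?m + ?p))" if "q \<le> ?m" for q
    using tail_der_degree[of w q] wp that by simp
  have XP [simp]: "?X q \<in> carrier P" if "q \<le> ?m" for q using X[OF that] by simp
  have dw: "\<delta>Q (bv w) \<in> carrier (kQ (?m + ?p))" by (rule \<delta>Q_basis_degree[OF w])
  have dwP [simp]: "\<delta>Q (bv w) \<in> carrier P" using dw by simp
  note step = zeta_step[OF i N] and diff_Delta = Br_diff_Delta[OF i N]
  note Dminus = linear_map_minus[OF P.module_axioms T.module_axioms Delta_linear]
  show ?thesis
  proof (cases "even i")
    case True
    have m: "?m = ?m' + (N - 1)" and m': "?m' \<ge> 1"
      using step True i by (auto simp: zeta_def)
    \<comment> \<open>At \<open>j = N\<close> the index j + m' - 1 reaches the length of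
      \<open>w\<close>, where the tail derivative is zero because it differentiates a trivial path.
      The cutoff agrees with this value and avoids indices past the end of \<open>w\<close>.\<close>
    define F where "F j = (\<Oplus>\<^bsub>T ?m'\<^esub> s\<in>{..<?p}. \<Delta> (j + s) ?m' (if j < N then ?X (j + ?m' - 1) else \<zero>\<^bsub>P\<^esub>))" for j
    have Fc [simp]: "F j \<in> carrier (T ?m')" for j
      unfolding F_def using m by (intro T.M.finsum_closed) (auto intro!: Delta_closed XP)
    have F0: "F 0 = \<zero>\<^bsub>T ?m'\<^esub>"
    proof -
      \<comment> \<open>The right outer factor has length (m + l - 1) - (s + m') = N + l - 2 - s,
        which is at least \<open>N\<close> because s < l - 1.\<close>
      have "\<Delta> s ?m' (?X (?m' - 1)) = \<zero>\<^bsub>T ?m'\<^esub>" if "s < ?p" for s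
        using m N that by (intro Delta_vanish[OF X]) auto
      then show ?thesis
        using N unfolding F_def by (intro T.M.finsum_eq_zero) auto
    qed
    have FN: "F N = \<zero>\<^bsub>T ?m'\<^esub>"
      unfolding F_def
      by (intro T.M.finsum_eq_zero)
        (simp add: linear_map_zero[OF P.module_axioms T.module_axioms Delta_linear])
    have F_Suc: "F (Suc j) = (\<Oplus>\<^bsub>T ?m'\<^esub> s\<in>{..<?p}. \<Delta> (j + Suc s) ?m' (?X (j + ?m')))" if "j < N" for j
    proof (cases "Suc j < N")
      case True
      then show ?thesis by (simp add: F_def)
    next
      case False
      \<comment> \<open>Here j = N - 1: the left side is zero by the cutoff, the right side because
        the tail derivative is taken at the end of \<open>w\<close>.\<close>
      then have "j + ?m' = path_length w" using that m wp by simp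
      then have "?X (j + ?m') = \<zero>\<^bsub>P\<^esub>" using tail_der_full[OF wp(1)] by simp
      then show ?thesis using False by (simp add: F_def)
    qed
    have lift_term: "lift (i - 1) (\<Delta> j ?m' (bv w)) = \<Delta> (?p + j) ?m' (\<delta>Q (bv w)) \<oplus>\<^bsub>T ?m'\<^esub> (F j \<ominus>\<^bsub>T ?m'\<^esub> F (Suc j))"
      if j: "j < N" for j
    proof -
      let ?q = "j + ?m'"
      have q: "?q \<le> ?m" "?q - 1 \<le> ?m" using j m by auto
      define f where "f s = \<Delta> (j + s) ?m' (?X ?q)" for s
      have fc [simp]: "f s \<in> carrier (T ?m')" for s using q by (simp add: f_def)
      have "lift (i - 1) (\<Delta> j ?m' (bv w)) = \<Delta> (j + ?p) ?m' (\<delta>Q (bv w) \<ominus>\<^bsub>P\<^esub> ?X ?q) \<oplus>\<^bsub>T ?m'\<^esub>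
          (\<Oplus>\<^bsub>T ?m'\<^esub> s\<in>{..<?p}. \<Delta> (j + s) ?m' (?X (?q - 1) \<ominus>\<^bsub>P\<^esub> ?X ?q)) \<oplus>\<^bsub>T ?m'\<^esub> \<Delta> j ?m' (?X ?q)"
        using lift_Delta[OF wp(1) refl, of j "i - 1"] wp q True i by simp
      also have "\<Delta> (j + ?p) ?m' (\<delta>Q (bv w) \<ominus>\<^bsub>P\<^esub> ?X ?q) = \<Delta> (?p + j) ?m' (\<delta>Q (bv w)) \<ominus>\<^bsub>T ?m'\<^esub> f ?p"
        using q by (simp add: Dminus f_def add.commute)
      also have "(\<Oplus>\<^bsub>T ?m'\<^esub> s\<in>{..<?p}. \<Delta> (j + s) ?m' (?X (?q - 1) \<ominus>\<^bsub>P\<^esub> ?X ?q)) = F j \<ominus>\<^bsub>T ?m'\<^esub> (\<Oplus>\<^bsub>T ?m'\<^esub> s\<in>{..<?p}. f s)"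
        using q j by (simp add: Dminus F_def f_def T.M.finsum_minus)
      also have "\<Delta> j ?m' (?X ?q) = f 0" by (simp add: f_def)
      \<comment> \<open>The terms f s with s < l - 1 together with f (l - 1), minus f 0, form the
        sum moved by one place, which is \<open>F (Suc j)\<close>.\<close>
      also have "\<Delta> (?p + j) ?m' (\<delta>Q (bv w)) \<ominus>\<^bsub>T ?m'\<^esub> f ?p \<oplus>\<^bsub>T ?m'\<^esub> (F j \<ominus>\<^bsub>T ?m'\<^esub> (\<Oplus>\<^bsub>T ?m'\<^esub> s\<in>{..<?p}. f s)) \<oplus>\<^bsub>T ?m'\<^esub> f 0
          = \<Delta> (?p + j) ?m' (\<delta>Q (bv w)) \<oplus>\<^bsub>T ?m'\<^esub> (F j \<ominus>\<^bsub>T ?m'\<^esub> ((\<Oplus>\<^bsub>T ?m'\<^esub> s\<in>{..<?p}. f s) \<oplus>\<^bsub>T ?m'\<^esub> f ?p) \<oplus>\<^bsub>T ?m'\<^esub> f 0)"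
        by (simp add: T.M.minus_eq T.M.minus_add T.M.a_ac)
      also have "(\<Oplus>\<^bsub>T ?m'\<^esub> s\<in>{..<?p}. f s) \<oplus>\<^bsub>T ?m'\<^esub> f ?p = f 0 \<oplus>\<^bsub>T ?m'\<^esub> F (Suc j)"
        using T.M.finsum_shift[of f ?m' ?p, OF fc] j by (simp add: F_Suc f_def)
      also have "F j \<ominus>\<^bsub>T ?m'\<^esub> (f 0 \<oplus>\<^bsub>T ?m'\<^esub> F (Suc j)) \<oplus>\<^bsub>T ?m'\<^esub> f 0 = F j \<ominus>\<^bsub>T ?m'\<^esub> F (Suc j)"
        by (simp add: T.M.minus_eq T.M.minus_add T.M.a_ac T.M.r_neg1 T.M.r_neg2 T.M.r_neg)
      finally show ?thesis .
    qed
    have "Br_diff R Q N i (lift_gen i (bv w)) = (\<Oplus>\<^bsub>T ?m'\<^esub> j\<in>{..<N}. \<Delta> (?p + j) ?m' (\<delta>Q (bv w)))"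
      using True dw diff_Delta[OF dw, of ?p] by (simp add: lift_gen_def Let_def)
    moreover have "lift (i - 1) (diff_gen i (bv w)) = (\<Oplus>\<^bsub>T ?m'\<^esub> j\<in>{..<N}. lift (i - 1) (\<Delta> j ?m' (bv w)))"
      using True bw
      by (simp add: diff_gen_def Let_def linear_map_finsum[OF T.module_axioms T.module_axioms lift_linear])
    moreover have "\<dots> = (\<Oplus>\<^bsub>T ?m'\<^esub> j\<in>{..<N}. \<Delta> (?p + j) ?m' (\<delta>Q (bv w)) \<oplus>\<^bsub>T ?m'\<^esub> (F j \<ominus>\<^bsub>T ?m'\<^esub> F (Suc j)))"
      by (intro T.M.finsum_cong') (simp_all add: lift_term)
    moreover have "\<dots> = (\<Oplus>\<^bsub>T ?m'\<^esub> j\<in>{..<N}. \<Delta> (?p + j) ?m' (\<delta>Q (bv w))) \<oplus>\<^bsub>T ?m'\<^esub>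
        (\<Oplus>\<^bsub>T ?m'\<^esub> j\<in>{..<N}. F j \<ominus>\<^bsub>T ?m'\<^esub> F (Suc j))"
      by (intro T.M.finsum_addf) auto
    moreover have "(\<Oplus>\<^bsub>T ?m'\<^esub> j\<in>{..<N}. F j \<ominus>\<^bsub>T ?m'\<^esub> F (Suc j)) = \<zero>\<^bsub>T ?m'\<^esub>"
      by (subst T.M.finsum_telescope) (simp_all add: F0 FN T.M.minus_eq)
    moreover have "(\<Oplus>\<^bsub>T ?m'\<^esub> j\<in>{..<N}. \<Delta> (?p + j) ?m' (\<delta>Q (bv w))) \<in> carrier (T ?m')"
      by (intro T.M.finsum_closed) auto
    ultimately show ?thesis by simp
  next
    case False
    have m: "?m = Suc ?m'" using step False by simp
    \<comment> \<open>As m = m' + 1, only the last arrow of \<open>w\<close> is differentiated here;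
      this is the element inside the correction sum.\<close>
    let ?Y = "?X ?m'"
    have Y: "?Y \<in> carrier (kQ (?m + ?p))" using X[of ?m'] m by simp
    define f where "f s = \<Delta> s ?m' ?Y" for s
    have fc [simp]: "f s \<in> carrier (T ?m')" for s using Y by (simp add: f_def)
    define g where "g s = \<Delta> s ?m' (\<delta>Q (bv w))" for s
    have gc [simp]: "g s \<in> carrier (T ?m')" for s by (simp add: g_def)
    have last: "last_der ?m (bv w) = ?Y" using last_der_basis[OF w] m by simp
    have terms: "Br_diff R Q N i (\<Delta> s ?m ?Y) = f (Suc s) \<ominus>\<^bsub>T ?m'\<^esub> f s" if "s < ?p" for s
      using diff_Delta[OF Y, of s] False that by (simp add: f_def Let_def One_nat_def)
    have "Br_diff R Q N i (lift_gen i (bv w)) = Br_diff R Q N i (\<Delta> ?p ?m (\<delta>Q (bv w))) \<oplus>\<^bsub>T ?m'\<^esub>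
        Br_diff R Q N i (\<Oplus>\<^bsub>T ?m\<^esub> s\<in>{..<?p}. \<Delta> s ?m ?Y)"
      using False Y by (simp add: lift_gen_def last linear_map_add[OF Br_diff_linear[OF i N]])
    also have "Br_diff R Q N i (\<Delta> ?p ?m (\<delta>Q (bv w))) = g (Suc ?p) \<ominus>\<^bsub>T ?m'\<^esub> g ?p"
      using diff_Delta[OF dw, of ?p] False by (simp add: g_def Let_def One_nat_def)
    also have "Br_diff R Q N i (\<Oplus>\<^bsub>T ?m\<^esub> s\<in>{..<?p}. \<Delta> s ?m ?Y)
        = (\<Oplus>\<^bsub>T ?m'\<^esub> s\<in>{..<?p}. Br_diff R Q N i (\<Delta> s ?m ?Y))"
      using Y by (intro linear_map_finsum[OF T.module_axioms T.module_axioms Br_diff_linear[OF i N]]) auto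
    also have "\<dots> = (\<Oplus>\<^bsub>T ?m'\<^esub> s\<in>{..<?p}. f (Suc s) \<ominus>\<^bsub>T ?m'\<^esub> f s)"
      by (intro T.M.finsum_cong') (auto simp: terms)
    also have "\<dots> = (\<Oplus>\<^bsub>T ?m'\<^esub> s\<in>{..<?p}. f (Suc s)) \<ominus>\<^bsub>T ?m'\<^esub> (\<Oplus>\<^bsub>T ?m'\<^esub> s\<in>{..<?p}. f s)"
      by (rule T.M.finsum_minus) auto
    also have "\<dots> = f ?p \<ominus>\<^bsub>T ?m'\<^esub> f 0"
    proof -
      have "(\<Oplus>\<^bsub>T ?m'\<^esub> s\<in>{..<?p}. f (Suc s)) = \<ominus>\<^bsub>T ?m'\<^esub> f 0 \<oplus>\<^bsub>T ?m'\<^esub> ((\<Oplus>\<^bsub>T ?m'\<^esub> s\<in>{..<?p}. f s) \<oplus>\<^bsub>T ?m'\<^esub> f ?p)"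
        by (subst T.M.finsum_shift[of f ?m' ?p, OF fc, symmetric]) (simp_all add: T.M.r_neg1)
      then show ?thesis
        by (simp add: T.M.minus_eq T.M.a_ac T.M.r_neg2 T.M.r_neg1 T.M.r_neg)
    qed
    finally have lhs: "Br_diff R Q N i (lift_gen i (bv w)) =
        g (Suc ?p) \<ominus>\<^bsub>T ?m'\<^esub> g ?p \<oplus>\<^bsub>T ?m'\<^esub> (f ?p \<ominus>\<^bsub>T ?m'\<^esub> f 0)" .
    have even: "even (i - 1)" using False i by simp
    \<comment> \<open>The middle segment reaches the end of \<open>w\<close>, so q = m and the tail
      derivative drops out.\<close>
    have "lift (i - 1) (\<Delta> 1 ?m' (bv w)) = g (Suc ?p)"
      using lift_Delta[OF wp(1), of "Suc ?m'" 1 "i - 1"] even wp m tail_der_full[OF wp(1)] bw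
        linear_map_zero[OF P.module_axioms T.module_axioms Delta_linear, of 1 ?m']
      by (simp add: g_def P.minus_eq One_nat_def)
    \<comment> \<open>Now the last arrow is the right outer factor: its derivative \<open>?Y\<close>
      is removed at place l - 1 and put back at place 0, the same jump that the correction sum
      produces.\<close>
    moreover have "lift (i - 1) (\<Delta> 0 ?m' (bv w)) = g ?p \<ominus>\<^bsub>T ?m'\<^esub> f ?p \<oplus>\<^bsub>T ?m'\<^esub> f 0"
      using lift_Delta[OF wp(1), of ?m' 0 "i - 1"] even wp m Y
      by (simp add: g_def f_def Dminus)
    moreover have "lift (i - 1) (diff_gen i (bv w)) = lift (i - 1) (\<Delta> 1 ?m' (bv w)) \<ominus>\<^bsub>T ?m'\<^esub> lift (i - 1) (\<Delta> 0 ?m' (bv w))"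
      using False bw
      by (simp add: diff_gen_def Let_def linear_map_minus[OF T.module_axioms T.module_axioms lift_linear])
    ultimately show ?thesis
      by (simp add: lhs T.M.minus_eq T.M.minus_add T.M.a_ac)
  qed
qed

lemma lift_commutes:
  assumes i: "i \<ge> 1" and X: "X \<in> carrier (T (zeta N i))"
  shows "Br_diff R Q N i (lift i X) = lift (i - 1) (Br_diff R Q N i X)"
proof (rule T_linear_eqI[OF T.module_axioms _ _ _ X])
  let ?m = "zeta N i" and ?m' = "zeta N (i - 1)"
  note dl = Br_diff_linear[OF i N]
  show lin1: "linear_map R (T ?m) (T ?m') (\<lambda>X. Br_diff R Q N i (lift i X))"
    by (rule linear_map_comp[OF lift_linear dl])
  show lin2: "linear_map R (T ?m) (T ?m') (\<lambda>X. lift (i - 1) (Br_diff R Q N i X))"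
    by (rule linear_map_comp[OF dl lift_linear])
  fix a u b
  assume a: "a \<in> carrier A" and u: "u \<in> carrier (kQ ?m)" and b: "b \<in> carrier A"
  show "Br_diff R Q N i (lift i (pt ?m a u b)) = lift (i - 1) (Br_diff R Q N i (pt ?m a u b))"
  proof (rule kQ_linear_eqI[OF T.module_axioms linear_map_comp[OF pt_linear_mid[OF a b] lin1]
        linear_map_comp[OF pt_linear_mid[OF a b] lin2] _ u])
    fix w assume w: "w \<in> paths_of_length Q ?m"
    note bw = basis_in_kQ[OF w]
    have dc: "diff_gen i (bv w) \<in> carrier (T ?m')"
      using bw by (rule E_bilinear_closed[OF diff_gen_E_bilinear[OF i N]])
    \<comment> \<open>Both sides are expanded instead of subtracted: the outer terms coincide since
      the differential is a bimodule map, the middle ones by \<open>lift_diff_gen\<close>.\<close>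
    have "Br_diff R Q N i (lift i (pt ?m a (bv w) b)) = act ?m' (\<delta>A a) (diff_gen i (bv w)) b \<oplus>\<^bsub>T ?m'\<^esub>
        act ?m' a (lift (i - 1) (diff_gen i (bv w))) b \<oplus>\<^bsub>T ?m'\<^esub> act ?m' a (diff_gen i (bv w)) (\<delta>A b)"
      using a b bw
      by (simp add: lift_pt linear_map_add[OF dl] Br_diff_pt[OF i N] Br_diff_act[OF i N] lift_diff_gen[OF i w])
    then show "Br_diff R Q N i (lift i (pt ?m a (bv w) b)) = lift (i - 1) (Br_diff R Q N i (pt ?m a (bv w) b))"
      using a b bw dc by (simp add: Br_diff_pt[OF i N] lift_act)
  qed
qed

text \<open>In degree 0 the middle factor is a combination of vertices, on which \<delta> vanishes.
  So \<open>lift 0\<close> differentiates the outer factors only, and the claim is the Leibniz rule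
  in \<open>A\<close>.\<close>

lemma lift_augmentation:
  assumes X: "X \<in> carrier (T (zeta N 0))"
  shows "Br_aug R Q N (lift 0 X) = \<delta>A (Br_aug R Q N X)"
proof -
  have z: "zeta N 0 = 0" by (simp add: zeta_def)
  have bal: "balanced 0 A (\<lambda>x u y. x \<otimes>\<^bsub>A\<^esub> cl u \<otimes>\<^bsub>A\<^esub> y)"
    by (intro balancedI linear_map_comp[OF A.mult_right_linear A.mult_right_linear] A.mult_left_linear
        linear_map_comp[OF linear_map_comp[OF linear_map_kQ[OF cl_linear] A.mult_left_linear] A.mult_right_linear])
      (simp_all add: cl_mult A.m_assoc)
  have aug: "Br_aug R Q N = tensor_lift R A (\<lambda>(x, u, y). x \<otimes>\<^bsub>A\<^esub> cl u \<otimes>\<^bsub>A\<^esub> y)"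
    by (simp add: Br_aug_def Let_def)
  have aug_lin: "linear_map R (T 0) A (Br_aug R Q N)"
    unfolding aug by (rule tensor_lift_linear_map[OF A.module_axioms bal])
  have aug_pt: "Br_aug R Q N (pt 0 x u y) = x \<otimes>\<^bsub>A\<^esub> cl u \<otimes>\<^bsub>A\<^esub> y"
    if "x \<in> carrier A" "u \<in> carrier (kQ 0)" "y \<in> carrier A" for x u y
    unfolding aug using that by (rule tensor_lift_pt[OF A.module_axioms bal])
  note lift0 = lift_linear[of 0, unfolded z] and lift_pt0 = lift_pt[of _ _ 0, unfolded z]
  show ?thesis
  proof (rule T_linear_eqI[OF A.module_axioms linear_map_comp[OF lift0 aug_lin]
        linear_map_comp[OF aug_lin \<delta>A_linear] _ X[unfolded z]])
    fix x u y assume k: "x \<in> carrier A" "u \<in> carrier (kQ 0)" "y \<in> carrier A"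
    have "lift_gen 0 u = \<zero>\<^bsub>T 0\<^esub>"
      using k by (simp add: lift_gen_def z \<delta>Q_vertices
          linear_map_zero[OF P.module_axioms T.module_axioms Delta_linear])
    then have "lift 0 (pt 0 x u y) = pt 0 (\<delta>A x) u y \<oplus>\<^bsub>T 0\<^esub> pt 0 x u (\<delta>A y)"
      using k by (simp add: lift_pt0 linear_map_zero[OF T.module_axioms T.module_axioms act_linear_mid])
    moreover have "\<delta>A (x \<otimes>\<^bsub>A\<^esub> cl u) = \<delta>A x \<otimes>\<^bsub>A\<^esub> cl u"
      using k by (intro \<delta>A_E)
    ultimately show "Br_aug R Q N (lift 0 (pt 0 x u y)) = \<delta>A (Br_aug R Q N (pt 0 x u y))"
      using k by (simp add: linear_map_add[OF aug_lin] aug_pt \<delta>A_mult[of "x \<otimes>\<^bsub>A\<^esub> cl u" y])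
  qed
qed

lemma lift_e_lifting: "e_lifting R Q N \<delta>A lift"
  unfolding e_lifting_def Br_def Let_def
  using lift_linear lift_commutes lift_augmentation lift_act by auto

lemma lift_gen_formula:
  assumes w: "w \<in> paths_of_length Q (zeta N i)"
  shows "lift_gen i (bv w) =
    (if even i then \<Delta> (l - 1) (zeta N i) (\<delta>Q (bv w))
     else \<Delta> (l - 1) (zeta N i) (\<delta>Q (bv w)) \<oplus>\<^bsub>Br R Q N i\<^esub>
       (\<Oplus>\<^bsub>Br R Q N i\<^esub> j\<in>{..<l - 1}. \<Delta> j (zeta N i)
          (bv (subpath Q w 0 (zeta N i - 1)) \<otimes>\<^bsub>P\<^esub> \<delta> (bv (subpath Q w (zeta N i - 1) (zeta N i))))))"
proof -
  have wp: "w \<in> paths Q" "path_length w = zeta N i" using w by (simp_all add: paths_of_length_def)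
  have bw: "bv w \<in> carrier P" using wp by (simp add: basis_closed)
  have "last_der (zeta N i) (bv w)
      = bv (subpath Q w 0 (zeta N i - 1)) \<otimes>\<^bsub>P\<^esub> \<delta> (bv (subpath Q w (zeta N i - 1) (zeta N i)))" if "odd i"
  proof -
    \<comment> \<open>In odd degree \<open>zeta N i\<close> is positive, so this segment is an arrow
      and the derivation takes the given value \<delta> on it.\<close>
    have "bv (subpath Q w (zeta N i - 1) (zeta N i)) \<in> carrier (kQ 1)"
      using wp that by (intro subpath_basis_in_kQ) (auto simp: zeta_def)
    then show ?thesis
      by (simp add: last_der_basis[OF w] tail_der_def wp \<delta>Q_arrow)
  qed
  then show ?thesis
    using bw by (simp add: lift_gen_def Br_def)
qed

end

theorem mainTheorem6:
  fixes R :: "('k, 'r) ring_scheme"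
    and Q :: "('v, 'e) pre_digraph"
    and N l :: nat
    and \<delta> \<delta>Q :: "(('v, 'e) path \<Rightarrow> 'k) \<Rightarrow> (('v, 'e) path \<Rightarrow> 'k)"
    and \<delta>A :: "(('v, 'e) path \<Rightarrow> 'k) set \<Rightarrow> (('v, 'e) path \<Rightarrow> 'k) set"
  assumes "cring R"
    and "fin_digraph Q"
    and "N \<ge> 2"
    and "l \<in> {1..N - 1}"
    and "bimodule_linear R (path_algebra R Q) (carrier (kQ_len R Q 0)) (kQ_len R Q 1) (kQ_len R Q l) \<delta>"
    and "bilinear_derivation R (path_algebra R Q) (carrier (kQ_len R Q 0)) \<delta>Q"
    and "\<forall>x\<in>carrier (kQ_len R Q 1). \<delta>Q x = \<delta> x"
    and "bilinear_derivation R (trunc_algebra R Q N) (vertex_subalgebra R Q N) \<delta>A"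
    and "\<forall>x\<in>carrier (kQ_len R Q 1). \<delta>A (trunc_class R Q N x) = trunc_class R Q N (\<delta> x)"
  shows "\<exists>D. e_lifting R Q N \<delta>A D \<and>
    (\<forall>i. \<forall>w\<in>paths_of_length Q (zeta N i).
       D i (pure_tensor R Q N (zeta N i)
              \<one>\<^bsub>trunc_algebra R Q N\<^esub> (basis_vec R w) \<one>\<^bsub>trunc_algebra R Q N\<^esub>) =
       (if even i
        then Delta R Q N (l - 1) (zeta N i) (\<delta>Q (basis_vec R w))
        else Delta R Q N (l - 1) (zeta N i) (\<delta>Q (basis_vec R w)) \<oplus>\<^bsub>Br R Q N i\<^esub>
          (\<Oplus>\<^bsub>Br R Q N i\<^esub> j \<in> {..<l - 1}.
             Delta R Q N j (zeta N i)
               (basis_vec R (subpath Q w 0 (zeta N i - 1)) \<otimes>\<^bsub>path_algebra R Q\<^esub>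
                \<delta> (basis_vec R (subpath Q w (zeta N i - 1) (zeta N i)))))))"
proof -
  interpret quiver_derivation R Q N l \<delta> \<delta>Q \<delta>A
    using assms by (intro quiver_derivation.intro trunc_quiver.intro quiver.intro quiver_derivation_axioms.intro)
      auto
  show ?thesis
    using lift_e_lifting lift_one lift_gen_formula by (intro exI[of _ lift] conjI allI ballI) simp_all
qed

end
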